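(* Let $\mathbf{C}$ be a left proper, tractable, symmetric monoidal model category. Let $\mathcal{I}$ denote the injective model structure on $\mathbf{C}_\Delta$ and, for $d=1,2$, let $\mathcal{S}eg_d$ denote the model structure for $d$-Segal objects on $\mathbf{C}_\Delta$. Write $\mathfrak{W}_?,\mathfrak{F}_?,\mathfrak{C}_?$ for the classes of weak equivalences, fibrations and cofibrations of a model structure $?$. Then $$\mathfrak{W}_{\mathcal{I}}\subset\mathfrak{W}_{\mathcal{S}eg_2}\subset\mathfrak{W}_{\mathcal{S}eg_1},\qquad \mathfrak{F}_{\mathcal{I}}\supset\mathfrak{F}_{\mathcal{S}eg_2}\supset\mathfrak{F}_{\mathcal{S}eg_1},\qquad \mathfrak{C}_{\mathcal{I}}=\mathfrak{C}_{\mathcal{S}eg_2}=\mathfrak{C}_{\mathcal{S}eg_1},$$ so that the identity functors induce Quillen adjunctions $$(\mathbf{C}_\Delta,\mathcal{I})\overset{\mathrm{Id}}{\longleftrightarrow}(\mathbf{C}_\Delta,\mathcal{S}eg_2)\overset{\mathrm{Id}}{\longleftrightarrow}(\mathbf{C}_\Delta,\mathcal{S}eg_1).$$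
   Context: Model categories have small limits and colimits. A model category is combinatorial if it is presentable and cofibrantly generated by sets of generating cofibrations and generating trivial cofibrations; tractable if moreover these can be chosen with cofibrant domains; left proper if weak equivalences are stable under pushout along cofibrations. A symmetric monoidal model category is a model category with a closed symmetric monoidal structure such that $\otimes$ is a left Quillen bifunctor and the unit $\mathbf{1}$ is cofibrant; $\mathrm{Map}_{\mathbf{C}}$ is the internal Hom. $\mathbf{C}_\Delta=\mathrm{Fun}(\Delta^{op},\mathbf{C})$. Its injective model structure $\mathcal{I}$ has levelwise weak equivalences and cofibrations. $\mathrm{Map}_{\mathbf{C}_\Delta}(X,Y)=\int_{[n]\in\Delta}\mathrm{Map}_{\mathbf{C}}(X_n,Y_n)$ and $\mathrm{RMap}_{\mathbf{C}_\Delta}(X,Y)=\mathrm{Map}_{\mathbf{C}_\Delta}(QX,FY)\in\mathrm{Ho}(\mathbf{C})$ with $Q,F$ cofibrant/fibrant replacement for $\mathcal{I}$. $\mathcal{S}_1=\{\Delta^{\mathcal{I}_n}\hookrightarrow\Delta^n\mid n\ge2\}$, with $\Delta^{\mathcal{I}_n}=\bigcup_{0\le i<n}\Delta^{\{i,i+1\}}$; $\mathcal{S}_2=\{\Delta^{\mathcal{T}}\hookrightarrow\Delta^n\mid n\ge3,\ \mathcal{T}$ a triangulation of a convex $(n+1)$-gon with vertices $0,\dots,n$ labelled counterclockwise, using only these vertices$\}$, with $\Delta^{\mathcal{T}}$ the union of the faces $\Delta^J$ over the vertex sets $J$ of the triangles of $\mathcal{T}$. $\langle D\rangle_n=\coprod_{D_n}\mathbf{1}$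 for a simplicial set $D$, and $\langle\mathcal{S}_d\rangle=\{\langle f\rangle:f\in\mathcal{S}_d\}$. $Z$ is $\langle\mathcal{S}_d\rangle$-local if $\mathrm{RMap}(g,Z)$ is an isomorphism in $\mathrm{Ho}(\mathbf{C})$ for each $g\in\langle\mathcal{S}_d\rangle$; $f$ is an $\langle\mathcal{S}_d\rangle$-equivalence if $\mathrm{RMap}(f,Z)$ is an isomorphism for every $\langle\mathcal{S}_d\rangle$-local $Z$. $X$ is a $d$-Segal object if for each $D\hookrightarrow\Delta^n$ in $\mathcal{S}_d$ the map $X_n\to\mathrm{holim}_{\{\Delta^p\to D\}}X_p$ is a weak equivalence. $\mathcal{S}eg_d$ is the model structure on $\mathbf{C}_\Delta$ whose weak equivalences are the $\langle\mathcal{S}_d\rangle$-equivalences, whose cofibrations are the injective cofibrations, and whose fibrant objects are the injectively fibrant $d$-Segal objects (it exists under the stated hypotheses on $\mathbf{C}$). *)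

theory Defs
  imports "HOL-Analysis.Analysis" "HOL-Library.FuncSet"
begin

unbundle cardinal_syntax

section \<open>Categories\<close>

record ('o, 'm) cat =
  Obj :: "'o set"
  Arr :: "'m set"
  Dom :: "'m \<Rightarrow> 'o"
  Cod :: "'m \<Rightarrow> 'o"
  Ident :: "'o \<Rightarrow> 'm"
  Comp :: "'m \<Rightarrow> 'm \<Rightarrow> 'm"  (infixr "\<cdot>\<index>" 65)

definition Hom :: "('o, 'm) cat \<Rightarrow> 'o \<Rightarrow> 'o \<Rightarrow> 'm set" where
  "Hom C a b = {f \<in> Arr C. Dom C f = a \<and> Cod C f = b}"

locale category =
  fixes C :: "('o, 'm) cat" (structure)
  assumes Dom_Obj: "f \<in> Arr C \<Longrightarrow> Dom C f \<in> Obj C"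
    and Cod_Obj: "f \<in> Arr C \<Longrightarrow> Cod C f \<in> Obj C"
    and Ident_Hom: "a \<in> Obj C \<Longrightarrow> Ident C a \<in> Hom C a a"
    and Comp_Hom: "\<lbrakk>f \<in> Hom C a b; g \<in> Hom C b c\<rbrakk> \<Longrightarrow> g \<cdot> f \<in> Hom C a c"
    and Comp_Ident_left: "f \<in> Hom C a b \<Longrightarrow> Ident C b \<cdot> f = f"
    and Comp_Ident_right: "f \<in> Hom C a b \<Longrightarrow> f \<cdot> Ident C a = f"
    and Comp_assoc: "\<lbrakk>f \<in> Hom C a b; g \<in> Hom C b c; h \<in> Hom C c d\<rbrakk>
      \<Longrightarrow> (h \<cdot> g) \<cdot> f = h \<cdot> (g \<cdot> f)"

definition op_cat :: "('o, 'm) cat \<Rightarrow> ('o, 'm) cat" where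
  "op_cat C = \<lparr>Obj = Obj C, Arr = Arr C, Dom = Cod C, Cod = Dom C,
     Ident = Ident C, Comp = (\<lambda>g f. Comp C f g)\<rparr>"

definition prod_cat :: "('o, 'm) cat \<Rightarrow> ('p, 'q) cat \<Rightarrow> ('o \<times> 'p, 'm \<times> 'q) cat" where
  "prod_cat C D = \<lparr>Obj = Obj C \<times> Obj D, Arr = Arr C \<times> Arr D,
     Dom = map_prod (Dom C) (Dom D), Cod = map_prod (Cod C) (Cod D),
     Ident = map_prod (Ident C) (Ident D),
     Comp = (\<lambda>(g, g') (f, f'). (Comp C g f, Comp D g' f'))\<rparr>"

definition discrete_cat :: "'a set \<Rightarrow> ('a, 'a) cat" where
  "discrete_cat A = \<lparr>Obj = A, Arr = A, Dom = (\<lambda>a. a), Cod = (\<lambda>a. a),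
     Ident = (\<lambda>a. a), Comp = (\<lambda>g f. f)\<rparr>"

definition poset_cat :: "'a set \<Rightarrow> 'a rel \<Rightarrow> ('a, 'a \<times> 'a) cat" where
  "poset_cat I P = \<lparr>Obj = I, Arr = P, Dom = fst, Cod = snd,
     Ident = (\<lambda>i. (i, i)), Comp = (\<lambda>g f. (fst f, snd g))\<rparr>"

definition is_iso :: "('o, 'm) cat \<Rightarrow> 'm \<Rightarrow> bool" where
  "is_iso C f \<longleftrightarrow> f \<in> Arr C \<and> (\<exists>g \<in> Hom C (Cod C f) (Dom C f).
     Comp C g f = Ident C (Dom C f) \<and> Comp C f g = Ident C (Cod C f))"

definition is_initial :: "('o, 'm) cat \<Rightarrow> 'o \<Rightarrow> bool" where
  "is_initial C z \<longleftrightarrow> z \<in> Obj C \<and> (\<forall>a \<in> Obj C. \<exists>!f. f \<in> Hom C z a)"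

definition is_terminal :: "('o, 'm) cat \<Rightarrow> 'o \<Rightarrow> bool" where
  "is_terminal C t \<longleftrightarrow> t \<in> Obj C \<and> (\<forall>a \<in> Obj C. \<exists>!f. f \<in> Hom C a t)"

subsection \<open>Functors and natural transformations\<close>

record ('o, 'm, 'p, 'q) functr =
  OMap :: "'o \<Rightarrow> 'p"
  AMap :: "'m \<Rightarrow> 'q"

definition is_functor ::
  "('o, 'm) cat \<Rightarrow> ('p, 'q) cat \<Rightarrow> ('o, 'm, 'p, 'q) functr \<Rightarrow> bool" where
  "is_functor D C F \<longleftrightarrow> category D \<and> category C
     \<and> (\<forall>a \<in> Obj D. OMap F a \<in> Obj C)
     \<and> (\<forall>f \<in> Arr D. AMap F f \<in> Hom C (OMap F (Dom D f)) (OMap F (Cod D f)))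
     \<and> (\<forall>a \<in> Obj D. AMap F (Ident D a) = Ident C (OMap F a))
     \<and> (\<forall>f \<in> Arr D. \<forall>g \<in> Arr D. Cod D f = Dom D g
          \<longrightarrow> AMap F (Comp D g f) = Comp C (AMap F g) (AMap F f))"

definition id_functor :: "('o, 'm, 'o, 'm) functr" where
  "id_functor = \<lparr>OMap = (\<lambda>a. a), AMap = (\<lambda>f. f)\<rparr>"

definition comp_functor ::
  "('p, 'q, 'r, 's) functr \<Rightarrow> ('o, 'm, 'p, 'q) functr \<Rightarrow> ('o, 'm, 'r, 's) functr" where
  "comp_functor G F = \<lparr>OMap = OMap G \<circ> OMap F, AMap = AMap G \<circ> AMap F\<rparr>"

definition is_nat_trans ::
  "('o, 'm) cat \<Rightarrow> ('p, 'q) cat \<Rightarrow> ('o, 'm, 'p, 'q) functr \<Rightarrow> ('o, 'm, 'p, 'q) functr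
     \<Rightarrow> ('o \<Rightarrow> 'q) \<Rightarrow> bool" where
  "is_nat_trans D C F G \<eta> \<longleftrightarrow> is_functor D C F \<and> is_functor D C G
     \<and> (\<forall>a \<in> Obj D. \<eta> a \<in> Hom C (OMap F a) (OMap G a))
     \<and> (\<forall>f \<in> Arr D. Comp C (AMap G f) (\<eta> (Dom D f)) = Comp C (\<eta> (Cod D f)) (AMap F f))"

definition is_adjunction ::
  "('o, 'm) cat \<Rightarrow> ('p, 'q) cat \<Rightarrow> ('o, 'm, 'p, 'q) functr \<Rightarrow> ('p, 'q, 'o, 'm) functr
     \<Rightarrow> ('o \<Rightarrow> 'm) \<Rightarrow> ('p \<Rightarrow> 'q) \<Rightarrow> bool" where
  "is_adjunction A B F G \<eta> \<epsilon> \<longleftrightarrow> is_functor A B F \<and> is_functor B A G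
     \<and> is_nat_trans A A id_functor (comp_functor G F) \<eta>
     \<and> is_nat_trans B B (comp_functor F G) id_functor \<epsilon>
     \<and> (\<forall>a \<in> Obj A. Comp B (\<epsilon> (OMap F a)) (AMap F (\<eta> a)) = Ident B (OMap F a))
     \<and> (\<forall>b \<in> Obj B. Comp A (AMap G (\<epsilon> b)) (\<eta> (OMap G b)) = Ident A (OMap G b))"

record ('o, 'm, 'p, 'q) ntrans =
  NSrc :: "('o, 'm, 'p, 'q) functr"
  NTgt :: "('o, 'm, 'p, 'q) functr"
  NCmp :: "'o \<Rightarrow> 'q"

text \<open>Functors and transformations are required to be undefined outside their domain, so that
  equality in the functor category is equality on the domain.\<close>

definition fun_cat_obj ::
  "('o, 'm) cat \<Rightarrow> ('p, 'q) cat \<Rightarrow> ('o, 'm, 'p, 'q) functr set" where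
  "fun_cat_obj D C =
     {F. is_functor D C F \<and> OMap F \<in> extensional (Obj D) \<and> AMap F \<in> extensional (Arr D)}"

definition fun_cat ::
  "('o, 'm) cat \<Rightarrow> ('p, 'q) cat
     \<Rightarrow> (('o, 'm, 'p, 'q) functr, ('o, 'm, 'p, 'q) ntrans) cat" where
  "fun_cat D C = \<lparr>
     Obj = fun_cat_obj D C,
     Arr = {\<alpha>. NSrc \<alpha> \<in> fun_cat_obj D C \<and> NTgt \<alpha> \<in> fun_cat_obj D C
              \<and> is_nat_trans D C (NSrc \<alpha>) (NTgt \<alpha>) (NCmp \<alpha>) \<and> NCmp \<alpha> \<in> extensional (Obj D)},
     Dom = NSrc, Cod = NTgt,
     Ident = (\<lambda>F. \<lparr>NSrc = F, NTgt = F, NCmp = (\<lambda>a \<in> Obj D. Ident C (OMap F a))\<rparr>),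
     Comp = (\<lambda>\<beta> \<alpha>. \<lparr>NSrc = NSrc \<alpha>, NTgt = NTgt \<beta>,
               NCmp = (\<lambda>a \<in> Obj D. Comp C (NCmp \<beta> a) (NCmp \<alpha> a))\<rparr>)\<rparr>"

subsection \<open>Limits and colimits\<close>

definition is_cone ::
  "('o, 'm) cat \<Rightarrow> ('p, 'q) cat \<Rightarrow> ('o, 'm, 'p, 'q) functr \<Rightarrow> 'p \<Rightarrow> ('o \<Rightarrow> 'q) \<Rightarrow> bool" where
  "is_cone J C F L \<pi> \<longleftrightarrow> L \<in> Obj C \<and> (\<forall>j \<in> Obj J. \<pi> j \<in> Hom C L (OMap F j))
     \<and> (\<forall>u \<in> Arr J. Comp C (AMap F u) (\<pi> (Dom J u)) = \<pi> (Cod J u))"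

definition is_limit ::
  "('o, 'm) cat \<Rightarrow> ('p, 'q) cat \<Rightarrow> ('o, 'm, 'p, 'q) functr \<Rightarrow> 'p \<Rightarrow> ('o \<Rightarrow> 'q) \<Rightarrow> bool" where
  "is_limit J C F L \<pi> \<longleftrightarrow> is_cone J C F L \<pi>
     \<and> (\<forall>K \<kappa>. is_cone J C F K \<kappa> \<longrightarrow>
          (\<exists>!h. h \<in> Hom C K L \<and> (\<forall>j \<in> Obj J. Comp C (\<pi> j) h = \<kappa> j)))"

definition is_colimit ::
  "('o, 'm) cat \<Rightarrow> ('p, 'q) cat \<Rightarrow> ('o, 'm, 'p, 'q) functr \<Rightarrow> 'p \<Rightarrow> ('o \<Rightarrow> 'q) \<Rightarrow> bool" where
  "is_colimit J C F L \<iota> \<longleftrightarrow> is_limit (op_cat J) (op_cat C) F L \<iota>"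

definition is_coproduct ::
  "('p, 'q) cat \<Rightarrow> 'a set \<Rightarrow> ('a \<Rightarrow> 'p) \<Rightarrow> 'p \<Rightarrow> ('a \<Rightarrow> 'q) \<Rightarrow> bool" where
  "is_coproduct C A X P \<iota> \<longleftrightarrow>
     is_colimit (discrete_cat A) C \<lparr>OMap = X, AMap = (\<lambda>a. Ident C (X a))\<rparr> P \<iota>"

definition is_pushout :: "('o, 'm) cat \<Rightarrow> 'm \<Rightarrow> 'm \<Rightarrow> 'm \<Rightarrow> 'm \<Rightarrow> bool" where
  "is_pushout C f g i j \<longleftrightarrow> f \<in> Arr C \<and> g \<in> Arr C \<and> Dom C f = Dom C g
     \<and> i \<in> Arr C \<and> j \<in> Arr C \<and> Dom C i = Cod C f \<and> Dom C j = Cod C g \<and> Cod C i = Cod C j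
     \<and> Comp C i f = Comp C j g
     \<and> (\<forall>x. \<forall>u \<in> Hom C (Cod C f) x. \<forall>v \<in> Hom C (Cod C g) x. Comp C u f = Comp C v g \<longrightarrow>
          (\<exists>!h. h \<in> Hom C (Cod C i) x \<and> Comp C h i = u \<and> Comp C h j = v))"

subsection \<open>Smallness\<close>

text \<open>Smallness is relative to a Grothendieck universe, given as a type \<open>'u\<close> whose cardinality
  is an uncountable strongly inaccessible cardinal; a set is small if it has smaller cardinality
  than \<open>'u\<close>.  Every small category is isomorphic to one whose objects and arrows lie in \<open>'u\<close>, so
  only diagrams of that shape need be considered.\<close>

definition universe :: "'u itself \<Rightarrow> bool" where
  "universe (_ :: 'u itself) \<longleftrightarrow> natLeq <o |UNIV :: 'u set| \<and> regularCard |UNIV :: 'u set|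
     \<and> (\<forall>A :: 'u set. |A| <o |UNIV :: 'u set| \<longrightarrow> |Pow A| <o |UNIV :: 'u set| )"

definition small :: "'u itself \<Rightarrow> 'a set \<Rightarrow> bool" where
  "small (_ :: 'u itself) A \<longleftrightarrow> |A| <o |UNIV :: 'u set|"

definition has_small_limits :: "'u itself \<Rightarrow> ('o, 'm) cat \<Rightarrow> bool" where
  "has_small_limits (U :: 'u itself) C \<longleftrightarrow>
     (\<forall>(J :: ('u, 'u) cat) F. small U (Obj J) \<and> small U (Arr J) \<and> is_functor J C F
        \<longrightarrow> (\<exists>L \<pi>. is_limit J C F L \<pi>))"

definition has_small_colimits :: "'u itself \<Rightarrow> ('o, 'm) cat \<Rightarrow> bool" where
  "has_small_colimits (U :: 'u itself) C \<longleftrightarrow>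
     (\<forall>(J :: ('u, 'u) cat) F. small U (Obj J) \<and> small U (Arr J) \<and> is_functor J C F
        \<longrightarrow> (\<exists>L \<iota>. is_colimit J C F L \<iota>))"

subsection \<open>Locally presentable categories\<close>

definition is_directed :: "'u itself \<Rightarrow> 'u rel \<Rightarrow> 'u set \<Rightarrow> 'u rel \<Rightarrow> bool" where
  "is_directed U lam I P \<longleftrightarrow> small U I \<and> partial_order_on I P
     \<and> (\<forall>A \<subseteq> I. |A| <o lam \<longrightarrow> (\<exists>b \<in> I. \<forall>a \<in> A. (a, b) \<in> P))"

text \<open>The two conjuncts of the conclusion say that the canonical map from
  \<open>colim Hom(K, F i)\<close> to \<open>Hom(K, colim F)\<close> is surjective and injective.\<close>

definition is_presentable_obj ::
  "'u itself \<Rightarrow> 'u rel \<Rightarrow> ('o, 'm) cat \<Rightarrow> 'o \<Rightarrow> bool" where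
  "is_presentable_obj U lam C K \<longleftrightarrow> K \<in> Obj C
     \<and> (\<forall>I P F L \<iota>. is_directed U lam I P \<and> is_functor (poset_cat I P) C F
            \<and> is_colimit (poset_cat I P) C F L \<iota> \<longrightarrow>
          (\<forall>f \<in> Hom C K L. \<exists>i \<in> I. \<exists>g \<in> Hom C K (OMap F i). f = Comp C (\<iota> i) g)
        \<and> (\<forall>i \<in> I. \<forall>g \<in> Hom C K (OMap F i). \<forall>g' \<in> Hom C K (OMap F i).
              Comp C (\<iota> i) g = Comp C (\<iota> i) g' \<longrightarrow>
              (\<exists>j. (i, j) \<in> P \<and> Comp C (AMap F (i, j)) g = Comp C (AMap F (i, j)) g')))"

definition locally_presentable :: "'u itself \<Rightarrow> ('o, 'm) cat \<Rightarrow> bool" where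
  "locally_presentable (U :: 'u itself) C \<longleftrightarrow> category C
     \<and> (\<forall>a \<in> Obj C. \<forall>b \<in> Obj C. small U (Hom C a b))
     \<and> has_small_colimits U C
     \<and> (\<exists>(lam :: 'u rel) S. Cinfinite lam \<and> regularCard lam \<and> lam <o |UNIV :: 'u set|
          \<and> small U S \<and> (\<forall>K \<in> S. is_presentable_obj U lam C K)
          \<and> (\<forall>X \<in> Obj C. \<exists>I P F \<iota>. is_directed U lam I P \<and> is_functor (poset_cat I P) C F
                \<and> OMap F ` I \<subseteq> S \<and> is_colimit (poset_cat I P) C F X \<iota>))"

section \<open>Model categories\<close>

record 'm model =
  Weq :: "'m set"
  Cof :: "'m set"
  Fib :: "'m set"

definition has_lift :: "('o, 'm) cat \<Rightarrow> 'm \<Rightarrow> 'm \<Rightarrow> bool" where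
  "has_lift C i p \<longleftrightarrow>
     (\<forall>u \<in> Hom C (Dom C i) (Dom C p). \<forall>v \<in> Hom C (Cod C i) (Cod C p).
        Comp C p u = Comp C v i \<longrightarrow>
        (\<exists>h \<in> Hom C (Cod C i) (Dom C p). Comp C h i = u \<and> Comp C p h = v))"

definition rlp :: "('o, 'm) cat \<Rightarrow> 'm set \<Rightarrow> 'm set" where
  "rlp C K = {p \<in> Arr C. \<forall>i \<in> K. has_lift C i p}"

definition is_retract :: "('o, 'm) cat \<Rightarrow> 'm \<Rightarrow> 'm \<Rightarrow> bool" where
  "is_retract C f g \<longleftrightarrow> f \<in> Arr C \<and> g \<in> Arr C \<and>
     (\<exists>s \<in> Hom C (Dom C f) (Dom C g). \<exists>r \<in> Hom C (Dom C g) (Dom C f).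
      \<exists>s' \<in> Hom C (Cod C f) (Cod C g). \<exists>r' \<in> Hom C (Cod C g) (Cod C f).
        Comp C r s = Ident C (Dom C f) \<and> Comp C r' s' = Ident C (Cod C f)
      \<and> Comp C g s = Comp C s' f \<and> Comp C f r = Comp C r' g)"

locale model_category =
  fixes U :: "'u itself" and C :: "('o, 'm) cat" (structure) and M :: "'m model"
  assumes category: "category C"
    and limits: "has_small_limits U C"
    and colimits: "has_small_colimits U C"
    and classes: "Weq M \<subseteq> Arr C" "Cof M \<subseteq> Arr C" "Fib M \<subseteq> Arr C"
    and two_of_three:
      "\<lbrakk>f \<in> Hom C a b; g \<in> Hom C b c; f \<in> Weq M; g \<in> Weq M\<rbrakk> \<Longrightarrow> g \<cdot> f \<in> Weq M"
      "\<lbrakk>f \<in> Hom C a b; g \<in> Hom C b c; f \<in> Weq M; g \<cdot> f \<in> Weq M\<rbrakk> \<Longrightarrow> g \<in> Weq M"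
      "\<lbrakk>f \<in> Hom C a b; g \<in> Hom C b c; g \<in> Weq M; g \<cdot> f \<in> Weq M\<rbrakk> \<Longrightarrow> f \<in> Weq M"
    and retracts:
      "\<lbrakk>is_retract C f g; g \<in> Weq M\<rbrakk> \<Longrightarrow> f \<in> Weq M"
      "\<lbrakk>is_retract C f g; g \<in> Cof M\<rbrakk> \<Longrightarrow> f \<in> Cof M"
      "\<lbrakk>is_retract C f g; g \<in> Fib M\<rbrakk> \<Longrightarrow> f \<in> Fib M"
    and lifting:
      "\<lbrakk>i \<in> Cof M \<inter> Weq M; p \<in> Fib M\<rbrakk> \<Longrightarrow> has_lift C i p"
      "\<lbrakk>i \<in> Cof M; p \<in> Fib M \<inter> Weq M\<rbrakk> \<Longrightarrow> has_lift C i p"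
    and factorization:
      "f \<in> Hom C a b \<Longrightarrow> \<exists>c. \<exists>i \<in> Hom C a c \<inter> (Cof M \<inter> Weq M). \<exists>p \<in> Hom C c b \<inter> Fib M.
         f = p \<cdot> i"
      "f \<in> Hom C a b \<Longrightarrow> \<exists>c. \<exists>i \<in> Hom C a c \<inter> Cof M. \<exists>p \<in> Hom C c b \<inter> (Fib M \<inter> Weq M).
         f = p \<cdot> i"

definition cofibrant :: "('o, 'm) cat \<Rightarrow> 'm model \<Rightarrow> 'o \<Rightarrow> bool" where
  "cofibrant C M a \<longleftrightarrow> (\<exists>z. is_initial C z \<and> (\<exists>f \<in> Hom C z a. f \<in> Cof M))"

definition fibrant :: "('o, 'm) cat \<Rightarrow> 'm model \<Rightarrow> 'o \<Rightarrow> bool" where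
  "fibrant C M a \<longleftrightarrow> (\<exists>t. is_terminal C t \<and> (\<exists>f \<in> Hom C a t. f \<in> Fib M))"

definition left_proper :: "('o, 'm) cat \<Rightarrow> 'm model \<Rightarrow> bool" where
  "left_proper C M \<longleftrightarrow>
     (\<forall>f w i j. is_pushout C f w i j \<and> f \<in> Cof M \<and> w \<in> Weq M \<longrightarrow> i \<in> Weq M)"

text \<open>In a locally presentable category every small set of arrows permits the small object
  argument, so this need not be demanded separately.\<close>

definition generates :: "'u itself \<Rightarrow> ('o, 'm) cat \<Rightarrow> 'm model \<Rightarrow> 'm set \<Rightarrow> 'm set \<Rightarrow> bool" where
  "generates U C M I J \<longleftrightarrow> I \<subseteq> Arr C \<and> J \<subseteq> Arr C \<and> small U I \<and> small U J
     \<and> Fib M \<inter> Weq M = rlp C I \<and> Fib M = rlp C J"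

definition combinatorial :: "'u itself \<Rightarrow> ('o, 'm) cat \<Rightarrow> 'm model \<Rightarrow> bool" where
  "combinatorial U C M \<longleftrightarrow> model_category U C M \<and> locally_presentable U C
     \<and> (\<exists>I J. generates U C M I J)"

definition tractable :: "'u itself \<Rightarrow> ('o, 'm) cat \<Rightarrow> 'm model \<Rightarrow> bool" where
  "tractable U C M \<longleftrightarrow> combinatorial U C M
     \<and> (\<exists>I J. generates U C M I J \<and> (\<forall>f \<in> I \<union> J. cofibrant C M (Dom C f)))"

definition quillen_adjunction ::
  "'u itself \<Rightarrow> ('o, 'm) cat \<Rightarrow> 'm model \<Rightarrow> ('p, 'q) cat \<Rightarrow> 'q model
     \<Rightarrow> ('o, 'm, 'p, 'q) functr \<Rightarrow> ('p, 'q, 'o, 'm) functr \<Rightarrow> bool" where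
  "quillen_adjunction U A M B N F G \<longleftrightarrow> model_category U A M \<and> model_category U B N
     \<and> (\<exists>\<eta> \<epsilon>. is_adjunction A B F G \<eta> \<epsilon>)
     \<and> AMap F ` Cof M \<subseteq> Cof N \<and> AMap F ` (Cof M \<inter> Weq M) \<subseteq> Cof N \<inter> Weq N"

subsection \<open>The homotopy category\<close>

text \<open>\<open>Ho(C)\<close> is the localization of \<open>C\<close> at \<open>W\<close>: an arrow from \<open>a\<close> to \<open>b\<close> is a class of
  zigzags (in diagrammatic order) from \<open>a\<close> to \<open>b\<close> whose backward steps lie in \<open>W\<close>, modulo the
  congruence generated by composition and identities of \<open>C\<close> and by \<open>Bwd w\<close> being inverse to
  \<open>Fwd w\<close>.\<close>

datatype 'm step = Fwd 'm | Bwd 'm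

fun zigzag :: "('o, 'm) cat \<Rightarrow> 'm set \<Rightarrow> 'o \<Rightarrow> 'm step list \<Rightarrow> 'o \<Rightarrow> bool" where
  "zigzag C W a [] b \<longleftrightarrow> a \<in> Obj C \<and> a = b"
| "zigzag C W a (Fwd f # xs) b \<longleftrightarrow> f \<in> Arr C \<and> Dom C f = a \<and> zigzag C W (Cod C f) xs b"
| "zigzag C W a (Bwd w # xs) b \<longleftrightarrow> w \<in> Arr C \<inter> W \<and> Cod C w = a \<and> zigzag C W (Dom C w) xs b"

inductive zigzag_rule :: "('o, 'm) cat \<Rightarrow> 'm set \<Rightarrow> 'm step list \<Rightarrow> 'm step list \<Rightarrow> bool"
  for C W where
  "a \<in> Obj C \<Longrightarrow> zigzag_rule C W [Fwd (Ident C a)] []"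
| "\<lbrakk>f \<in> Arr C; g \<in> Arr C; Cod C f = Dom C g\<rbrakk>
     \<Longrightarrow> zigzag_rule C W [Fwd f, Fwd g] [Fwd (Comp C g f)]"
| "w \<in> Arr C \<inter> W \<Longrightarrow> zigzag_rule C W [Fwd w, Bwd w] []"
| "w \<in> Arr C \<inter> W \<Longrightarrow> zigzag_rule C W [Bwd w, Fwd w] []"

inductive zigzag_eq ::
  "('o, 'm) cat \<Rightarrow> 'm set \<Rightarrow> 'o \<Rightarrow> 'o \<Rightarrow> 'm step list \<Rightarrow> 'm step list \<Rightarrow> bool"
  for C W a b where
  refl: "zigzag C W a xs b \<Longrightarrow> zigzag_eq C W a b xs xs"
| sym: "zigzag_eq C W a b xs ys \<Longrightarrow> zigzag_eq C W a b ys xs"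
| trans: "\<lbrakk>zigzag_eq C W a b xs ys; zigzag_eq C W a b ys zs\<rbrakk> \<Longrightarrow> zigzag_eq C W a b xs zs"
| rule: "\<lbrakk>zigzag_rule C W l r; zigzag C W a (xs @ l @ ys) b; zigzag C W a (xs @ r @ ys) b\<rbrakk>
     \<Longrightarrow> zigzag_eq C W a b (xs @ l @ ys) (xs @ r @ ys)"

type_synonym ('o, 'm) ho_arr = "'o \<times> 'm step list set \<times> 'o"

definition ho_class ::
  "('o, 'm) cat \<Rightarrow> 'm set \<Rightarrow> 'o \<Rightarrow> 'm step list \<Rightarrow> 'o \<Rightarrow> ('o, 'm) ho_arr" where
  "ho_class C W a xs b = (a, {ys. zigzag_eq C W a b xs ys}, b)"

definition ho_cat :: "('o, 'm) cat \<Rightarrow> 'm set \<Rightarrow> ('o, ('o, 'm) ho_arr) cat" where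
  "ho_cat C W = \<lparr>
     Obj = Obj C,
     Arr = {ho_class C W a xs b | a xs b. zigzag C W a xs b},
     Dom = (\<lambda>(a, X, b). a), Cod = (\<lambda>(a, X, b). b),
     Ident = (\<lambda>a. ho_class C W a [] a),
     Comp = (\<lambda>(b', Y, c) (a, X, b).
       (a, {zs. \<exists>xs \<in> X. \<exists>ys \<in> Y. zigzag_eq C W a c (xs @ ys) zs}, c))\<rparr>"

definition ho_map :: "('o, 'm) cat \<Rightarrow> 'm set \<Rightarrow> 'm \<Rightarrow> ('o, 'm) ho_arr" where
  "ho_map C W f = ho_class C W (Dom C f) [Fwd f] (Cod C f)"

subsection \<open>Replacements\<close>

definition cof_repl :: "('o, 'm) cat \<Rightarrow> 'm model \<Rightarrow> 'o \<Rightarrow> 'o \<times> 'm" where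
  "cof_repl C M X = (SOME (Q, q). cofibrant C M Q \<and> q \<in> Hom C Q X \<inter> (Weq M \<inter> Fib M))"

definition cof_repl_map :: "('o, 'm) cat \<Rightarrow> 'm model \<Rightarrow> 'm \<Rightarrow> 'm" where
  "cof_repl_map C M f =
     (let (Q, q) = cof_repl C M (Dom C f); (Q', q') = cof_repl C M (Cod C f)
      in SOME g. g \<in> Hom C Q Q' \<and> Comp C q' g = Comp C f q)"

definition fib_repl :: "('o, 'm) cat \<Rightarrow> 'm model \<Rightarrow> 'o \<Rightarrow> 'o \<times> 'm" where
  "fib_repl C M X = (SOME (R, r). fibrant C M R \<and> r \<in> Hom C X R \<inter> (Weq M \<inter> Cof M))"

subsection \<open>Injective model structures on functor categories and homotopy limits\<close>

definition levelwise ::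
  "('o, 'm) cat \<Rightarrow> ('p, 'q) cat \<Rightarrow> 'q set \<Rightarrow> ('o, 'm, 'p, 'q) ntrans set" where
  "levelwise D C K = {\<alpha> \<in> Arr (fun_cat D C). \<forall>a \<in> Obj D. NCmp \<alpha> a \<in> K}"

definition injective ::
  "('o, 'm) cat \<Rightarrow> ('p, 'q) cat \<Rightarrow> 'q model \<Rightarrow> ('o, 'm, 'p, 'q) ntrans model" where
  "injective D C M = \<lparr>Weq = levelwise D C (Weq M), Cof = levelwise D C (Cof M),
     Fib = rlp (fun_cat D C) (levelwise D C (Cof M \<inter> Weq M))\<rparr>"

text \<open>The homotopy limit is the right derived functor of the limit: the limit of an injectively
  fibrant replacement.  \<open>holim_map\<close> is the map from \<open>T\<close> to it induced by a cone from \<open>T\<close>.\<close>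

definition holim ::
  "('o, 'm) cat \<Rightarrow> ('p, 'q) cat \<Rightarrow> 'q model \<Rightarrow> ('o, 'm, 'p, 'q) functr \<Rightarrow> 'p \<times> ('o \<Rightarrow> 'q)" where
  "holim J C M G =
     (SOME (L, \<pi>). is_limit J C (fst (fib_repl (fun_cat J C) (injective J C M) G)) L \<pi>)"

definition holim_map ::
  "('o, 'm) cat \<Rightarrow> ('p, 'q) cat \<Rightarrow> 'q model \<Rightarrow> ('o, 'm, 'p, 'q) functr \<Rightarrow> 'p \<Rightarrow> ('o \<Rightarrow> 'q) \<Rightarrow> 'q"
  where
  "holim_map J C M G T \<tau> =
     (let (L, \<pi>) = holim J C M G; \<rho> = snd (fib_repl (fun_cat J C) (injective J C M) G)
      in THE h. h \<in> Hom C T L \<and> (\<forall>j \<in> Obj J. Comp C (\<pi> j) h = Comp C (NCmp \<rho> j) (\<tau> j)))"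

subsection \<open>Symmetric monoidal model categories\<close>

record ('o, 'm) monoidal =
  TenO :: "'o \<Rightarrow> 'o \<Rightarrow> 'o"  (infixl "\<otimes>\<index>" 70)
  TenA :: "'m \<Rightarrow> 'm \<Rightarrow> 'm"  (infixl "\<boxtimes>\<index>" 70)
  Unit :: "'o"  ("\<one>\<index>")
  Assoc :: "'o \<Rightarrow> 'o \<Rightarrow> 'o \<Rightarrow> 'm"  ("\<alpha>\<index>")
  LUnit :: "'o \<Rightarrow> 'm"  ("\<l>\<index>")
  RUnit :: "'o \<Rightarrow> 'm"  ("\<r>\<index>")
  Braid :: "'o \<Rightarrow> 'o \<Rightarrow> 'm"  ("\<sigma>\<index>")
  IHom :: "'o \<Rightarrow> 'o \<Rightarrow> 'o"
  Eval :: "'o \<Rightarrow> 'o \<Rightarrow> 'm"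

locale closed_symmetric_monoidal =
  fixes V :: "('o, 'm) monoidal" (structure) and C :: "('o, 'm) cat"
  assumes tensor_functor: "is_functor (prod_cat C C) C
      \<lparr>OMap = (\<lambda>(x, y). x \<otimes> y), AMap = (\<lambda>(f, g). f \<boxtimes> g)\<rparr>"
    and unit_Obj: "\<one> \<in> Obj C"
    and assoc_iso: "\<lbrakk>x \<in> Obj C; y \<in> Obj C; z \<in> Obj C\<rbrakk>
      \<Longrightarrow> is_iso C (\<alpha> x y z) \<and> \<alpha> x y z \<in> Hom C ((x \<otimes> y) \<otimes> z) (x \<otimes> (y \<otimes> z))"
    and lunit_iso: "x \<in> Obj C \<Longrightarrow> is_iso C (\<l> x) \<and> \<l> x \<in> Hom C (\<one> \<otimes> x) x"
    and runit_iso: "x \<in> Obj C \<Longrightarrow> is_iso C (\<r> x) \<and> \<r> x \<in> Hom C (x \<otimes> \<one>) x"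
    and braid_Hom: "\<lbrakk>x \<in> Obj C; y \<in> Obj C\<rbrakk> \<Longrightarrow> \<sigma> x y \<in> Hom C (x \<otimes> y) (y \<otimes> x)"
    and assoc_nat: "\<lbrakk>f \<in> Hom C x x'; g \<in> Hom C y y'; h \<in> Hom C z z'\<rbrakk>
      \<Longrightarrow> \<alpha> x' y' z' \<cdot>\<^bsub>C\<^esub> ((f \<boxtimes> g) \<boxtimes> h) = (f \<boxtimes> (g \<boxtimes> h)) \<cdot>\<^bsub>C\<^esub> \<alpha> x y z"
    and lunit_nat: "f \<in> Hom C x x' \<Longrightarrow> \<l> x' \<cdot>\<^bsub>C\<^esub> (Ident C \<one> \<boxtimes> f) = f \<cdot>\<^bsub>C\<^esub> \<l> x"
    and runit_nat: "f \<in> Hom C x x' \<Longrightarrow> \<r> x' \<cdot>\<^bsub>C\<^esub> (f \<boxtimes> Ident C \<one>) = f \<cdot>\<^bsub>C\<^esub> \<r> x"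
    and braid_nat: "\<lbrakk>f \<in> Hom C x x'; g \<in> Hom C y y'\<rbrakk>
      \<Longrightarrow> \<sigma> x' y' \<cdot>\<^bsub>C\<^esub> (f \<boxtimes> g) = (g \<boxtimes> f) \<cdot>\<^bsub>C\<^esub> \<sigma> x y"
    and pentagon: "\<lbrakk>w \<in> Obj C; x \<in> Obj C; y \<in> Obj C; z \<in> Obj C\<rbrakk>
      \<Longrightarrow> \<alpha> w x (y \<otimes> z) \<cdot>\<^bsub>C\<^esub> \<alpha> (w \<otimes> x) y z
          = (Ident C w \<boxtimes> \<alpha> x y z) \<cdot>\<^bsub>C\<^esub> (\<alpha> w (x \<otimes> y) z \<cdot>\<^bsub>C\<^esub> (\<alpha> w x y \<boxtimes> Ident C z))"
    and triangle: "\<lbrakk>x \<in> Obj C; y \<in> Obj C\<rbrakk>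
      \<Longrightarrow> (Ident C x \<boxtimes> \<l> y) \<cdot>\<^bsub>C\<^esub> \<alpha> x \<one> y = \<r> x \<boxtimes> Ident C y"
    and hexagon: "\<lbrakk>x \<in> Obj C; y \<in> Obj C; z \<in> Obj C\<rbrakk>
      \<Longrightarrow> \<alpha> y z x \<cdot>\<^bsub>C\<^esub> (\<sigma> x (y \<otimes> z) \<cdot>\<^bsub>C\<^esub> \<alpha> x y z)
          = (Ident C y \<boxtimes> \<sigma> x z) \<cdot>\<^bsub>C\<^esub> (\<alpha> y x z \<cdot>\<^bsub>C\<^esub> (\<sigma> x y \<boxtimes> Ident C z))"
    and symmetry: "\<lbrakk>x \<in> Obj C; y \<in> Obj C\<rbrakk> \<Longrightarrow> \<sigma> y x \<cdot>\<^bsub>C\<^esub> \<sigma> x y = Ident C (x \<otimes> y)"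
    and ihom_Obj: "\<lbrakk>x \<in> Obj C; y \<in> Obj C\<rbrakk> \<Longrightarrow> IHom V x y \<in> Obj C"
    and eval_Hom: "\<lbrakk>x \<in> Obj C; y \<in> Obj C\<rbrakk> \<Longrightarrow> Eval V x y \<in> Hom C (IHom V x y \<otimes> x) y"
    and closed: "\<lbrakk>k \<in> Obj C; x \<in> Obj C; y \<in> Obj C; f \<in> Hom C (k \<otimes> x) y\<rbrakk>
      \<Longrightarrow> \<exists>!g. g \<in> Hom C k (IHom V x y) \<and> Eval V x y \<cdot>\<^bsub>C\<^esub> (g \<boxtimes> Ident C x) = f"

text \<open>\<open>h\<close> below is the pushout-product of \<open>f\<close> and \<open>g\<close>.  The right adjoints required of a left
  Quillen bifunctor are provided by closedness.\<close>

definition left_quillen_tensor ::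
  "('o, 'm) cat \<Rightarrow> 'm model \<Rightarrow> ('o, 'm) monoidal \<Rightarrow> bool" where
  "left_quillen_tensor C M V \<longleftrightarrow>
     (\<forall>f \<in> Cof M. \<forall>g \<in> Cof M. \<forall>i j h.
        is_pushout C (f \<boxtimes>\<^bsub>V\<^esub> Ident C (Dom C g)) (Ident C (Dom C f) \<boxtimes>\<^bsub>V\<^esub> g) i j
        \<and> h \<in> Hom C (Cod C i) (Cod C f \<otimes>\<^bsub>V\<^esub> Cod C g)
        \<and> Comp C h i = Ident C (Cod C f) \<boxtimes>\<^bsub>V\<^esub> g
        \<and> Comp C h j = f \<boxtimes>\<^bsub>V\<^esub> Ident C (Cod C g) \<longrightarrow>
        h \<in> Cof M \<and> (f \<in> Weq M \<or> g \<in> Weq M \<longrightarrow> h \<in> Weq M))"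

definition symmetric_monoidal_model_category ::
  "'u itself \<Rightarrow> ('o, 'm) cat \<Rightarrow> 'm model \<Rightarrow> ('o, 'm) monoidal \<Rightarrow> bool" where
  "symmetric_monoidal_model_category U C M V \<longleftrightarrow> model_category U C M
     \<and> closed_symmetric_monoidal V C \<and> left_quillen_tensor C M V \<and> cofibrant C M (Unit V)"

text \<open>The map \<open>IHom x y \<rightarrow> IHom x' y'\<close> induced by \<open>f : x' \<rightarrow> x\<close> and \<open>g : y \<rightarrow> y'\<close>.\<close>

definition ihom_map ::
  "('o, 'm) cat \<Rightarrow> ('o, 'm) monoidal \<Rightarrow> 'm \<Rightarrow> 'm \<Rightarrow> 'm" where
  "ihom_map C V f g =
     (let x' = Dom C f; x = Cod C f; y = Dom C g; y' = Cod C g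
      in THE h. h \<in> Hom C (IHom V x y) (IHom V x' y')
           \<and> Comp C (Eval V x' y') (h \<boxtimes>\<^bsub>V\<^esub> Ident C x')
             = Comp C g (Comp C (Eval V x y) (Ident C (IHom V x y) \<boxtimes>\<^bsub>V\<^esub> f)))"

subsection \<open>Ends\<close>

definition is_wedge ::
  "('o, 'm) cat \<Rightarrow> ('p, 'q) cat \<Rightarrow> ('o \<times> 'o, 'm \<times> 'm, 'p, 'q) functr \<Rightarrow> 'p \<Rightarrow> ('o \<Rightarrow> 'q) \<Rightarrow> bool"
  where
  "is_wedge D C H E \<pi> \<longleftrightarrow> E \<in> Obj C \<and> (\<forall>d \<in> Obj D. \<pi> d \<in> Hom C E (OMap H (d, d)))
     \<and> (\<forall>f \<in> Arr D. Comp C (AMap H (Ident D (Dom D f), f)) (\<pi> (Dom D f))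
                    = Comp C (AMap H (f, Ident D (Cod D f))) (\<pi> (Cod D f)))"

definition is_end ::
  "('o, 'm) cat \<Rightarrow> ('p, 'q) cat \<Rightarrow> ('o \<times> 'o, 'm \<times> 'm, 'p, 'q) functr \<Rightarrow> 'p \<Rightarrow> ('o \<Rightarrow> 'q) \<Rightarrow> bool"
  where
  "is_end D C H E \<pi> \<longleftrightarrow> is_functor (prod_cat (op_cat D) D) C H \<and> is_wedge D C H E \<pi>
     \<and> (\<forall>K \<kappa>. is_wedge D C H K \<kappa> \<longrightarrow>
          (\<exists>!h. h \<in> Hom C K E \<and> (\<forall>d \<in> Obj D. Comp C (\<pi> d) h = \<kappa> d)))"

section \<open>Simplicial objects\<close>

text \<open>The object \<open>n\<close> of \<open>\<Delta>\<close> stands for the ordinal \<open>[n] = {0, ..., n}\<close>; an arrow \<open>(m, n, f)\<close> is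
  the monotone map \<open>f : [m] \<rightarrow> [n]\<close>.\<close>

type_synonym ordmap = "nat \<times> nat \<times> (nat \<Rightarrow> nat)"

definition simplex_cat :: "(nat, ordmap) cat"  ("\<Delta>") where
  "\<Delta> = \<lparr>
     Obj = UNIV,
     Arr = {(m, n, f). f \<in> {..m} \<rightarrow>\<^sub>E {..n} \<and> mono_on {..m} f},
     Dom = (\<lambda>(m, n, f). m), Cod = (\<lambda>(m, n, f). n),
     Ident = (\<lambda>n. (n, n, \<lambda>i \<in> {..n}. i)),
     Comp = (\<lambda>(n', p, g) (m, n, f). (m, p, compose {..m} g f))\<rparr>"

type_synonym ('o, 'm) sobj = "(nat, ordmap, 'o, 'm) functr"
type_synonym ('o, 'm) smap = "(nat, ordmap, 'o, 'm) ntrans"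

definition simp_cat :: "('o, 'm) cat \<Rightarrow> (('o, 'm) sobj, ('o, 'm) smap) cat" where
  "simp_cat C = fun_cat (op_cat \<Delta>) C"

definition simp_injective :: "('o, 'm) cat \<Rightarrow> 'm model \<Rightarrow> ('o, 'm) smap model" where
  "simp_injective C M = injective (op_cat \<Delta>) C M"

subsection \<open>Mapping objects\<close>

definition map_functor ::
  "('o, 'm) cat \<Rightarrow> ('o, 'm) monoidal \<Rightarrow> ('o, 'm) sobj \<Rightarrow> ('o, 'm) sobj
     \<Rightarrow> (nat \<times> nat, ordmap \<times> ordmap, 'o, 'm) functr" where
  "map_functor C V X Y = \<lparr>OMap = (\<lambda>(m, n). IHom V (OMap X m) (OMap Y n)),
     AMap = (\<lambda>(\<theta>, \<phi>). ihom_map C V (AMap X \<theta>) (AMap Y \<phi>))\<rparr>"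

definition Map ::
  "('o, 'm) cat \<Rightarrow> ('o, 'm) monoidal \<Rightarrow> ('o, 'm) sobj \<Rightarrow> ('o, 'm) sobj \<Rightarrow> 'o \<times> (nat \<Rightarrow> 'm)" where
  "Map C V X Y = (SOME (E, \<pi>). is_end (op_cat \<Delta>) C (map_functor C V X Y) E \<pi>)"

definition Map_precomp ::
  "('o, 'm) cat \<Rightarrow> ('o, 'm) monoidal \<Rightarrow> ('o, 'm) smap \<Rightarrow> ('o, 'm) sobj \<Rightarrow> 'm" where
  "Map_precomp C V f Z =
     (let (E, \<pi>) = Map C V (NSrc f) Z; (E', \<pi>') = Map C V (NTgt f) Z
      in THE h. h \<in> Hom C E' E
           \<and> (\<forall>n. Comp C (\<pi> n) h
                  = Comp C (ihom_map C V (NCmp f n) (Ident C (OMap Z n))) (\<pi>' n)))"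

definition RMap_precomp ::
  "('o, 'm) cat \<Rightarrow> 'm model \<Rightarrow> ('o, 'm) monoidal \<Rightarrow> ('o, 'm) smap \<Rightarrow> ('o, 'm) sobj
     \<Rightarrow> ('o, 'm) ho_arr" where
  "RMap_precomp C M V f Z = ho_map C (Weq M)
     (Map_precomp C V
        (cof_repl_map (simp_cat C) (simp_injective C M) f)
        (fst (fib_repl (simp_cat C) (simp_injective C M) Z)))"

definition is_local ::
  "('o, 'm) cat \<Rightarrow> 'm model \<Rightarrow> ('o, 'm) monoidal \<Rightarrow> ('o, 'm) smap set \<Rightarrow> ('o, 'm) sobj \<Rightarrow> bool"
  where
  "is_local C M V G Z \<longleftrightarrow> Z \<in> Obj (simp_cat C)
     \<and> (\<forall>g \<in> G. is_iso (ho_cat C (Weq M)) (RMap_precomp C M V g Z))"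

definition local_equivalences ::
  "('o, 'm) cat \<Rightarrow> 'm model \<Rightarrow> ('o, 'm) monoidal \<Rightarrow> ('o, 'm) smap set \<Rightarrow> ('o, 'm) smap set"
  where
  "local_equivalences C M V G = {f \<in> Arr (simp_cat C).
     \<forall>Z. is_local C M V G Z \<longrightarrow> is_iso (ho_cat C (Weq M)) (RMap_precomp C M V f Z)}"

subsection \<open>Simplicial sets\<close>

text \<open>\<open>Act D \<theta> x\<close> is the action \<open>\<theta>\<^sup>* x\<close> of \<open>\<theta> : [q] \<rightarrow> [p]\<close> on a \<open>p\<close>-simplex \<open>x\<close>.\<close>

record 'x sset =
  Simp :: "nat \<Rightarrow> 'x set"
  Act :: "ordmap \<Rightarrow> 'x \<Rightarrow> 'x"

definition std_simplex :: "nat \<Rightarrow> ordmap sset" where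
  "std_simplex n = \<lparr>Simp = (\<lambda>p. Hom \<Delta> p n), Act = (\<lambda>\<theta> x. Comp \<Delta> x \<theta>)\<rparr>"

text \<open>The union of the faces \<open>\<Delta>\<^sup>J\<close> of \<open>\<Delta>\<^sup>n\<close> over all \<open>J \<in> \<J>\<close>.\<close>

definition face_union :: "nat \<Rightarrow> nat set set \<Rightarrow> ordmap sset" where
  "face_union n \<J> = \<lparr>
     Simp = (\<lambda>p. {x \<in> Hom \<Delta> p n. \<exists>J \<in> \<J>. snd (snd x) ` {..p} \<subseteq> J}),
     Act = (\<lambda>\<theta> x. Comp \<Delta> x \<theta>)\<rparr>"

text \<open>The pair \<open>(D, n)\<close> stands for an inclusion of \<open>D\<close> into \<open>\<Delta>\<^sup>n\<close>.\<close>

definition S1 :: "(ordmap sset \<times> nat) set" where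
  "S1 = (\<lambda>n. (face_union n ((\<lambda>i. {i, i + 1}) ` {..<n}), n)) ` {2..}"

text \<open>The points \<open>v 0, ..., v n\<close> of the plane are the vertices of a convex polygon, in
  counterclockwise order, iff every triple of them is positively oriented.\<close>

definition convex_polygon :: "nat \<Rightarrow> (nat \<Rightarrow> complex) \<Rightarrow> bool" where
  "convex_polygon n v \<longleftrightarrow>
     (\<forall>i j k. i < j \<and> j < k \<and> k \<le> n \<longrightarrow> Im (cnj (v j - v i) * (v k - v i)) > 0)"

definition triangulates :: "nat \<Rightarrow> (nat \<Rightarrow> complex) \<Rightarrow> nat set set \<Rightarrow> bool" where
  "triangulates n v T \<longleftrightarrow> (\<forall>J \<in> T. J \<subseteq> {..n} \<and> card J = 3)
     \<and> (\<Union>J \<in> T. convex hull (v ` J)) = convex hull (v ` {..n})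
     \<and> (\<forall>J \<in> T. \<forall>K \<in> T.
          convex hull (v ` J) \<inter> convex hull (v ` K) = convex hull (v ` (J \<inter> K)))"

definition S2 :: "(ordmap sset \<times> nat) set" where
  "S2 = {(face_union n T, n) | n T. n \<ge> 3 \<and> (\<exists>v. convex_polygon n v \<and> triangulates n v T)}"

definition copower :: "('o, 'm) cat \<Rightarrow> ('o, 'm) monoidal \<Rightarrow> 'x set \<Rightarrow> 'o \<times> ('x \<Rightarrow> 'm)" where
  "copower C V A = (SOME (P, \<iota>). is_coproduct C A (\<lambda>_. Unit V) P \<iota>)"

definition copower_map ::
  "('o, 'm) cat \<Rightarrow> ('o, 'm) monoidal \<Rightarrow> 'x set \<Rightarrow> 'x set \<Rightarrow> ('x \<Rightarrow> 'x) \<Rightarrow> 'm" where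
  "copower_map C V A B \<phi> =
     (let (P, \<iota>) = copower C V A; (Q, \<kappa>) = copower C V B
      in THE h. h \<in> Hom C P Q \<and> (\<forall>a \<in> A. Comp C h (\<iota> a) = \<kappa> (\<phi> a)))"

definition free_sobj ::
  "('o, 'm) cat \<Rightarrow> ('o, 'm) monoidal \<Rightarrow> 'x sset \<Rightarrow> ('o, 'm) sobj" where
  "free_sobj C V D = \<lparr>
     OMap = (\<lambda>p. fst (copower C V (Simp D p))),
     AMap = (\<lambda>\<theta> \<in> Arr \<Delta>.
       copower_map C V (Simp D (Cod \<Delta> \<theta>)) (Simp D (Dom \<Delta> \<theta>)) (Act D \<theta>))\<rparr>"

definition free_incl ::
  "('o, 'm) cat \<Rightarrow> ('o, 'm) monoidal \<Rightarrow> 'x sset \<Rightarrow> 'x sset \<Rightarrow> ('o, 'm) smap" where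
  "free_incl C V D D' = \<lparr>
     NSrc = free_sobj C V D, NTgt = free_sobj C V D',
     NCmp = (\<lambda>p. copower_map C V (Simp D p) (Simp D' p) (\<lambda>x. x))\<rparr>"

definition free_incls ::
  "('o, 'm) cat \<Rightarrow> ('o, 'm) monoidal \<Rightarrow> (ordmap sset \<times> nat) set \<Rightarrow> ('o, 'm) smap set" where
  "free_incls C V S = (\<lambda>(D, n). free_incl C V D (std_simplex n)) ` S"

subsection \<open>Segal objects\<close>

text \<open>Objects are the simplices \<open>(p, x)\<close>, that is \<open>x : \<Delta>\<^sup>p \<rightarrow> D\<close>; the arrow \<open>(\<theta>, x)\<close> is
  \<open>\<theta> : (q, \<theta>\<^sup>* x) \<rightarrow> (p, x)\<close>.\<close>

definition simplices_cat :: "'x sset \<Rightarrow> (nat \<times> 'x, ordmap \<times> 'x) cat" where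
  "simplices_cat D = \<lparr>
     Obj = {(p, x). x \<in> Simp D p},
     Arr = {(\<theta>, x). \<theta> \<in> Arr \<Delta> \<and> x \<in> Simp D (Cod \<Delta> \<theta>)},
     Dom = (\<lambda>(\<theta>, x). (Dom \<Delta> \<theta>, Act D \<theta> x)), Cod = (\<lambda>(\<theta>, x). (Cod \<Delta> \<theta>, x)),
     Ident = (\<lambda>(p, x). (Ident \<Delta> p, x)),
     Comp = (\<lambda>(\<theta>', x') (\<theta>, x). (Comp \<Delta> \<theta>' \<theta>, x'))\<rparr>"

definition simplices_diagram ::
  "('o, 'm) sobj \<Rightarrow> 'x sset \<Rightarrow> (nat \<times> 'x, ordmap \<times> 'x, 'o, 'm) functr" where
  "simplices_diagram X D = \<lparr>
     OMap = (\<lambda>(p, x) \<in> Obj (simplices_cat D). OMap X p),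
     AMap = (\<lambda>(\<theta>, x) \<in> Arr (simplices_cat D). AMap X \<theta>)\<rparr>"

text \<open>A simplex of \<open>D \<subseteq> \<Delta>\<^sup>n\<close> is an arrow \<open>x : [p] \<rightarrow> [n]\<close>, so it induces \<open>X\<^sub>n \<rightarrow> X\<^sub>p\<close>.\<close>

definition segal_object ::
  "('o, 'm) cat \<Rightarrow> 'm model \<Rightarrow> (ordmap sset \<times> nat) set \<Rightarrow> ('o, 'm) sobj \<Rightarrow> bool" where
  "segal_object C M S X \<longleftrightarrow> X \<in> Obj (simp_cat C)
     \<and> (\<forall>(D, n) \<in> S. holim_map (op_cat (simplices_cat D)) C M (simplices_diagram X D)
          (OMap X n) (\<lambda>(p, x). AMap X x) \<in> Weq M)"

definition segal_model ::
  "'u itself \<Rightarrow> ('o, 'm) cat \<Rightarrow> 'm model \<Rightarrow> ('o, 'm) monoidal \<Rightarrow> (ordmap sset \<times> nat) set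
     \<Rightarrow> ('o, 'm) smap model \<Rightarrow> bool" where
  "segal_model U C M V S N \<longleftrightarrow> model_category U (simp_cat C) N
     \<and> Weq N = local_equivalences C M V (free_incls C V S)
     \<and> Cof N = Cof (simp_injective C M)
     \<and> (\<forall>X. fibrant (simp_cat C) N X
          \<longleftrightarrow> fibrant (simp_cat C) (simp_injective C M) X \<and> segal_object C M S X)"

end

theory Submission
  imports Defs
begin

text \<open>The model structures share their cofibrations, so everything reduces to the inclusions of the
  classes of weak equivalences.  A model structure is determined by its cofibrations and fibrant
  objects, and \<open>Seg2\<close>-fibrant objects are injectively fibrant; this gives
  \<open>Weq I \<subseteq> Weq Seg2\<close>.  For \<open>Weq Seg2 \<subseteq> Weq Seg1\<close> it suffices that the generators
  \<open>\<langle>\<Delta>\<^sup>T\<rangle> \<rightarrow> \<langle>\<Delta>\<^sup>n\<rangle>\<close> of \<open>Seg2\<close> lie in \<open>Weq Seg1\<close>, for then every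
  \<open>S1\<close>-local object is \<open>S2\<close>-local.  Now \<open>\<Delta>\<^sup>T\<close> is obtained from the spine of
  \<open>\<Delta>\<^sup>n\<close> by repeatedly gluing in a triangle along two of its edges, so
  \<open>\<langle>spine\<rangle> \<rightarrow> \<langle>\<Delta>\<^sup>T\<rangle>\<close> is a trivial cofibration of \<open>Seg1\<close>, and two-out-of-three applies.\<close>

section \<open>Categories and small colimits\<close>

text \<open>\<open>RMap_precomp\<close> is assembled from replacements, ends and maps picked by
  \<open>SOME\<close> and \<open>THE\<close>, so even its functoriality would be laborious. The
  argument touches it only formally: relations between classes of local objects are read off from
  the definitions, and everything else is lifting in a model category. This is why
  \<open>Weq I\<close> is compared with \<open>Weq Seg2\<close> through fibrant objects and not
  through mapping objects. The gluing avoids pushouts of simplicial objects as well. A map out of a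
  free simplicial object is a compatible family of maps out of the unit, so lifting against an
  inclusion of simplicial sets becomes extending a family (\<open>points_lift\<close>), and
  extending over a union is a definition by cases on simplices. The combinatorics of a triangulation
  must be extracted from its definition by convex hulls. Two facts suffice: edges of triangles never
  cross, and an edge {a, b} with a vertex in between belongs to a triangle {a, k, b} with a < k < b.
  The first makes pieces meet only in the expected faces, the second drives the induction.\<close>

lemma Hom_iff: "f \<in> Hom C a b \<longleftrightarrow> f \<in> Arr C \<and> Dom C f = a \<and> Cod C f = b"
  by (simp add: Hom_def)

lemma (in category) Hom_Obj: "f \<in> Hom C a b \<Longrightarrow> a \<in> Obj C" "f \<in> Hom C a b \<Longrightarrow> b \<in> Obj C"
  using Dom_Obj Cod_Obj by (auto simp: Hom_iff)

lemma op_cat_sel [simp]: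
  "Obj (op_cat C) = Obj C" "Arr (op_cat C) = Arr C" "Dom (op_cat C) = Cod C"
  "Cod (op_cat C) = Dom C" "Ident (op_cat C) = Ident C" "Comp (op_cat C) g f = Comp C f g"
  by (simp_all add: op_cat_def)

lemma Hom_op_cat [simp]: "Hom (op_cat C) a b = Hom C b a"
  by (auto simp: Hom_def)

lemma (in category) category_op: "category (op_cat C)"
  by unfold_locales
    (simp_all add: Dom_Obj Cod_Obj Ident_Hom Comp_Hom Comp_Ident_left Comp_Ident_right Comp_assoc)

lemma is_colimit_iff:
  "is_colimit J C F L \<iota> \<longleftrightarrow>
     L \<in> Obj C \<and> (\<forall>j \<in> Obj J. \<iota> j \<in> Hom C (OMap F j) L)
     \<and> (\<forall>u \<in> Arr J. Comp C (\<iota> (Cod J u)) (AMap F u) = \<iota> (Dom J u))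
     \<and> (\<forall>K \<kappa>. K \<in> Obj C \<and> (\<forall>j \<in> Obj J. \<kappa> j \<in> Hom C (OMap F j) K)
           \<and> (\<forall>u \<in> Arr J. Comp C (\<kappa> (Cod J u)) (AMap F u) = \<kappa> (Dom J u))
         \<longrightarrow> (\<exists>!h. h \<in> Hom C L K \<and> (\<forall>j \<in> Obj J. Comp C h (\<iota> j) = \<kappa> j)))"
  by (simp add: is_colimit_def is_limit_def is_cone_def)

lemma colimit_universal:
  assumes "is_colimit J C F L \<iota>" "K \<in> Obj C"
    and "\<And>j. j \<in> Obj J \<Longrightarrow> \<kappa> j \<in> Hom C (OMap F j) K"
    and "\<And>u. u \<in> Arr J \<Longrightarrow> Comp C (\<kappa> (Cod J u)) (AMap F u) = \<kappa> (Dom J u)"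
  shows "\<exists>!h. h \<in> Hom C L K \<and> (\<forall>j \<in> Obj J. Comp C h (\<iota> j) = \<kappa> j)"
  using assms(1)[unfolded is_colimit_iff, THEN conjunct2, THEN conjunct2, THEN conjunct2,
      rule_format, of K \<kappa>] assms(2-4) by simp

text \<open>\<open>has_small_colimits\<close> speaks only of shapes whose objects and arrows live in
  the type of the universe. Smallness gives injections \<open>e\<close> and \<open>m\<close> into
  that type; \<open>J'\<close> is the copy of \<open>J\<close> on the codes, and a colimit cocone
  over \<open>J'\<close> is reindexed along \<open>e\<close>.\<close>

lemma small_colimit_exists:
  fixes J :: "('a, 'b) cat"
  assumes colim: "has_small_colimits (U :: 'u itself) C"
    and so: "small U (Obj J)" and sa: "small U (Arr J)" and F: "is_functor J C F"
  shows "\<exists>L \<iota>. is_colimit J C F L \<iota>"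
proof -
  interpret J: category J using F by (simp add: is_functor_def)
  obtain e :: "'a \<Rightarrow> 'u" where e: "inj_on e (Obj J)"
    using ordLess_imp_ordLeq[OF so[unfolded small_def]] unfolding card_of_ordLeq[symmetric] by blast
  obtain m :: "'b \<Rightarrow> 'u" where m: "inj_on m (Arr J)"
    using ordLess_imp_ordLeq[OF sa[unfolded small_def]] unfolding card_of_ordLeq[symmetric] by blast
  define e' where "e' = inv_into (Obj J) e"
  define m' where "m' = inv_into (Arr J) m"
  have e' [simp]: "e' (e a) = a" if "a \<in> Obj J" for a
    using that e by (simp add: e'_def)
  have m' [simp]: "m' (m f) = f" if "f \<in> Arr J" for f
    using that m by (simp add: m'_def)
  note [simp] = J.Dom_Obj J.Cod_Obj
  define J' :: "('u, 'u) cat" where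
    "J' = \<lparr>Obj = e ` Obj J, Arr = m ` Arr J, Dom = \<lambda>f. e (Dom J (m' f)),
       Cod = \<lambda>f. e (Cod J (m' f)), Ident = \<lambda>a. m (Ident J (e' a)),
       Comp = \<lambda>g f. m (Comp J (m' g) (m' f))\<rparr>"
  define F' where "F' = \<lparr>OMap = OMap F \<circ> e', AMap = AMap F \<circ> m'\<rparr>"
  have HomE: "\<exists>a' b' g. a' \<in> Obj J \<and> b' \<in> Obj J \<and> a = e a' \<and> b = e b' \<and> g \<in> Hom J a' b' \<and> f = m g"
    if f: "f \<in> Hom J' a b" for f a b
  proof -
    obtain g where "g \<in> Arr J" "f = m g" "a = e (Dom J g)" "b = e (Cod J g)"
      using f by (auto simp: J'_def Hom_iff)
    moreover from this have "g \<in> Hom J (Dom J g) (Cod J g)" by (simp add: Hom_iff)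
    ultimately show ?thesis using J.Dom_Obj J.Cod_Obj by blast
  qed
  have ArrI: "g \<in> Arr J" if "g \<in> Hom J a b" for g a b
    using that by (simp add: Hom_iff)
  have cat: "category J'"
  proof
    fix f assume "f \<in> Arr J'"
    then show "Dom J' f \<in> Obj J'" "Cod J' f \<in> Obj J'" by (auto simp: J'_def)
  next
    fix a assume "a \<in> Obj J'"
    then show "Ident J' a \<in> Hom J' a a"
      using J.Ident_Hom by (auto simp: J'_def Hom_iff)
  next
    fix f g a b c assume "f \<in> Hom J' a b" "g \<in> Hom J' b c"
    then show "Comp J' g f \<in> Hom J' a c"
      using J.Comp_Hom e by (auto simp: J'_def Hom_iff inj_on_eq_iff)
  next
    fix f a b assume "f \<in> Hom J' a b"
    then obtain a' b' g where *: "a' \<in> Obj J" "b' \<in> Obj J" "a = e a'" "b = e b'" "g \<in> Hom J a' b'" "f = m g"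
      using HomE by blast
    have I: "Ident J a' \<in> Arr J" "Ident J b' \<in> Arr J" using J.Ident_Hom * by (auto simp: Hom_iff)
    show "Comp J' (Ident J' b) f = f" "Comp J' f (Ident J' a) = f"
      using * I ArrI[OF *(5)] J.Comp_Ident_left J.Comp_Ident_right by (auto simp: J'_def)
  next
    fix f g h a b c d assume f: "f \<in> Hom J' a b" and g: "g \<in> Hom J' b c" and h: "h \<in> Hom J' c d"
    obtain f' where f': "f' \<in> Arr J" "f = m f'" "e (Dom J f') = a" "e (Cod J f') = b"
      using f by (auto simp: J'_def Hom_iff)
    obtain g' where g': "g' \<in> Arr J" "g = m g'" "e (Dom J g') = b" "e (Cod J g') = c"
      using g by (auto simp: J'_def Hom_iff)
    obtain h' where h': "h' \<in> Arr J" "h = m h'" "e (Dom J h') = c" "e (Cod J h') = d"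
      using h by (auto simp: J'_def Hom_iff)
    \<comment> \<open>Composability in \<open>J'\<close> only equates codes of objects; injectivity
      of \<open>e\<close> turns this into composability in \<open>J\<close>.\<close>
    have "Cod J f' = Dom J g'" "Cod J g' = Dom J h'"
      using f' g' h' e by (metis J.Dom_Obj J.Cod_Obj inj_on_eq_iff)+
    then have H: "f' \<in> Hom J (Dom J f') (Dom J g')" "g' \<in> Hom J (Dom J g') (Dom J h')"
      "h' \<in> Hom J (Dom J h') (Cod J h')"
      using f' g' h' by (auto simp: Hom_iff)
    then have "Comp J h' g' \<in> Arr J" "Comp J g' f' \<in> Arr J"
      using J.Comp_Hom by (blast intro: ArrI)+
    then show "Comp J' (Comp J' h g) f = Comp J' h (Comp J' g f)"
      using f' g' h' J.Comp_assoc[OF H] by (simp add: J'_def)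
  qed
  have fun': "is_functor J' C F'"
    unfolding is_functor_def
  proof (intro conjI ballI impI)
    show "category J'" "category C" using cat F by (simp_all add: is_functor_def)
    show "OMap F' a \<in> Obj C" if "a \<in> Obj J'" for a
      using that F by (auto simp: J'_def F'_def is_functor_def)
    show "AMap F' f \<in> Hom C (OMap F' (Dom J' f)) (OMap F' (Cod J' f))" if "f \<in> Arr J'" for f
      using that F by (auto simp: J'_def F'_def is_functor_def)
    show "AMap F' (Ident J' a) = Ident C (OMap F' a)" if "a \<in> Obj J'" for a
      using that F J.Ident_Hom by (auto simp: J'_def F'_def is_functor_def Hom_iff)
    fix f g assume fg: "f \<in> Arr J'" "g \<in> Arr J'" "Cod J' f = Dom J' g"
    then obtain f' g' where *: "f' \<in> Arr J" "g' \<in> Arr J" "f = m f'" "g = m g'" "Cod J f' = Dom J g'"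
      using e by (auto simp: J'_def inj_on_eq_iff)
    then have "Comp J g' f' \<in> Arr J" using J.Comp_Hom by (metis Hom_iff)
    then show "AMap F' (Comp J' g f) = Comp C (AMap F' g) (AMap F' f)"
      using * F by (simp add: J'_def F'_def is_functor_def)
  qed
  have "small U (Obj J')" "small U (Arr J')"
    using ordLeq_ordLess_trans[OF card_of_image so[unfolded small_def]]
      ordLeq_ordLess_trans[OF card_of_image sa[unfolded small_def]]
    by (simp_all add: J'_def small_def)
  then obtain L \<iota> where L: "is_colimit J' C F' L \<iota>"
    using colim cat fun' unfolding has_small_colimits_def by meson
  have "is_colimit J C F L (\<iota> \<circ> e)"
    unfolding is_colimit_iff
  proof (intro conjI allI impI ballI)
    show "L \<in> Obj C" using L by (simp add: is_colimit_iff)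
    show "(\<iota> \<circ> e) j \<in> Hom C (OMap F j) L" if "j \<in> Obj J" for j
      using L that by (auto simp: is_colimit_iff J'_def F'_def)
    show "Comp C ((\<iota> \<circ> e) (Cod J u)) (AMap F u) = (\<iota> \<circ> e) (Dom J u)" if "u \<in> Arr J" for u
      using L that by (auto simp: is_colimit_iff J'_def F'_def)
    fix K \<kappa> assume K: "K \<in> Obj C \<and> (\<forall>j \<in> Obj J. \<kappa> j \<in> Hom C (OMap F j) K)
           \<and> (\<forall>u \<in> Arr J. Comp C (\<kappa> (Cod J u)) (AMap F u) = \<kappa> (Dom J u))"
    have "\<exists>!h. h \<in> Hom C L K \<and> (\<forall>j \<in> Obj J'. Comp C h (\<iota> j) = (\<kappa> \<circ> e') j)"
      by (rule colimit_universal[OF L]) (use K in \<open>auto simp: J'_def F'_def\<close>)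
    then show "\<exists>!h. h \<in> Hom C L K \<and> (\<forall>j \<in> Obj J. Comp C h ((\<iota> \<circ> e) j) = \<kappa> j)"
      by (simp add: J'_def)
  qed
  then show ?thesis by blast
qed

lemma universe_infinite: "universe (U :: 'u itself) \<Longrightarrow> infinite (UNIV :: 'u set)"
  unfolding universe_def using infinite_iff_natLeq_ordLeq ordLess_imp_ordLeq by blast

lemma finite_small: "universe (U :: 'u itself) \<Longrightarrow> finite A \<Longrightarrow> small U A"
  using universe_infinite unfolding small_def
  by (intro finite_ordLess_infinite card_of_Well_order) (auto simp: Field_card_of)

lemma category_poset_cat:
  assumes "refl_on I P" "P \<subseteq> I \<times> I" "trans P"
  shows "category (poset_cat I P)"
  using assms by unfold_locales (auto simp: poset_cat_def Hom_iff refl_on_def dest: transD)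

lemma is_pushout_iff:
  assumes "f \<in> Hom C a b" "g \<in> Hom C a c" "i \<in> Hom C b d" "j \<in> Hom C c d"
  shows "is_pushout C f g i j \<longleftrightarrow> Comp C i f = Comp C j g
    \<and> (\<forall>x. \<forall>u \<in> Hom C b x. \<forall>v \<in> Hom C c x. Comp C u f = Comp C v g \<longrightarrow>
          (\<exists>!h. h \<in> Hom C d x \<and> Comp C h i = u \<and> Comp C h j = v))"
proof -
  have "f \<in> Arr C" "Dom C f = a" "Cod C f = b" "g \<in> Arr C" "Dom C g = a" "Cod C g = c"
    "i \<in> Arr C" "Dom C i = b" "Cod C i = d" "j \<in> Arr C" "Dom C j = c" "Cod C j = d"
    using assms by (simp_all add: Hom_iff)
  then show ?thesis by (simp add: is_pushout_def)
qed

text \<open>A pushout is a colimit over the poset with 0 below 1 and 2, once the redundant leg at 0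
  is dropped.\<close>

lemma pushout_exists:
  assumes U: "universe U" and colim: "has_small_colimits U C" and cat: "category C"
    and f: "f \<in> Hom C a b" and g: "g \<in> Hom C a c"
  shows "\<exists>i j. is_pushout C f g i j"
proof -
  interpret category C by (rule cat)
  define P where "P = {(0 :: nat, 0 :: nat), (1, 1), (2, 2), (0, 1), (0, 2)}"
  define J where "J = poset_cat {0, 1, 2} P"
  define F where "F = \<lparr>OMap = (\<lambda>i. if i = 0 then a else if i = (1 :: nat) then b else c),
    AMap = (\<lambda>(i, j). if (i, j) = (0 :: nat, 1 :: nat) then f else if (i, j) = (0, 2) then g
      else Ident C (if i = 0 then a else if i = 1 then b else c))\<rparr>"
  have objs: "a \<in> Obj C" "b \<in> Obj C" "c \<in> Obj C"
    using f g Hom_Obj by blast+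
  have sel: "Obj J = {0, 1, 2}" "Arr J = P" "Dom J = fst" "Cod J = snd"
    "Ident J = (\<lambda>i. (i, i))" "Comp J = (\<lambda>g f. (fst f, snd g))"
    by (simp_all add: J_def poset_cat_def)
  have "category J"
    unfolding J_def by (rule category_poset_cat) (auto simp: P_def refl_on_def trans_def)
  then have F: "is_functor J C F"
    unfolding is_functor_def sel
    using cat objs f g Ident_Hom Comp_Ident_left[OF f] Comp_Ident_right[OF f]
      Comp_Ident_left[OF g] Comp_Ident_right[OF g] Comp_Ident_left[OF Ident_Hom]
    by (auto simp: P_def F_def)
  obtain L \<iota> where L: "is_colimit J C F L \<iota>"
    using small_colimit_exists[OF colim finite_small[OF U] finite_small[OF U] F]
    by (auto simp: sel P_def)
  have \<iota>: "\<iota> 0 \<in> Hom C a L" "\<iota> 1 \<in> Hom C b L" "\<iota> 2 \<in> Hom C c L"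
      "Comp C (\<iota> 1) f = \<iota> 0" "Comp C (\<iota> 2) g = \<iota> 0"
    using L unfolding is_colimit_iff sel by (auto simp: F_def P_def)
  have "\<exists>!h. h \<in> Hom C L x \<and> Comp C h (\<iota> 1) = u \<and> Comp C h (\<iota> 2) = v"
    if u: "u \<in> Hom C b x" and v: "v \<in> Hom C c x" and uv: "Comp C u f = Comp C v g" for x u v
  proof -
    define \<kappa> where "\<kappa> = (\<lambda>i :: nat. if i = 0 then Comp C u f else if i = 1 then u else v)"
    have "\<exists>!h. h \<in> Hom C L x \<and> (\<forall>j \<in> {0, 1, 2}. Comp C h (\<iota> j) = \<kappa> j)"
      unfolding sel(1)[symmetric]
    proof (rule colimit_universal[OF L Hom_Obj(2)[OF u]])
      show "\<kappa> j \<in> Hom C (OMap F j) x" if "j \<in> Obj J" for j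
        using that u v Comp_Hom[OF f u] by (auto simp: sel F_def \<kappa>_def)
      show "Comp C (\<kappa> (Cod J k)) (AMap F k) = \<kappa> (Dom J k)" if "k \<in> Arr J" for k
        using that uv Comp_Ident_right[OF u] Comp_Ident_right[OF v] Comp_Ident_right[OF Comp_Hom[OF f u]]
        by (auto simp: sel F_def P_def \<kappa>_def)
    qed
    \<comment> \<open>The leg at 0 factors through the leg at 1, so agreement on the legs 1 and 2
      already gives agreement on all three; uniqueness carries over.\<close>
    moreover have "Comp C h (\<iota> 0) = \<kappa> 0" if "h \<in> Hom C L x" "Comp C h (\<iota> 1) = u" for h
      using Comp_assoc[OF f \<iota>(2) that(1)] that \<iota>(4) by (simp add: \<kappa>_def)
    then have "(h \<in> Hom C L x \<and> (\<forall>j \<in> {0, 1, 2}. Comp C h (\<iota> j) = \<kappa> j))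
        \<longleftrightarrow> (h \<in> Hom C L x \<and> Comp C h (\<iota> 1) = u \<and> Comp C h (\<iota> 2) = v)" for h
      by (auto simp: \<kappa>_def)
    ultimately show ?thesis by simp
  qed
  then have "is_pushout C f g (\<iota> 1) (\<iota> 2)"
    unfolding is_pushout_iff[OF f g \<iota>(2,3)] using \<iota>(4,5) by simp
  then show ?thesis by blast
qed

lemma terminal_exists:
  assumes "universe (U :: 'u itself)" "has_small_limits U C" "category C"
  shows "\<exists>t. is_terminal C t"
proof -
  define J :: "('u, 'u) cat" where "J = discrete_cat {}"
  \<comment> \<open>Any value serves here: on the empty shape every \<open>F\<close> is a functor
    and every object a cone, and the limit is terminal.\<close>
  define F :: "('u, 'u, 'a, 'b) functr" where "F = undefined"
  have "category J" by unfold_locales (auto simp: J_def discrete_cat_def Hom_iff)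
  then have "is_functor J C F" using assms by (simp add: is_functor_def J_def discrete_cat_def)
  then obtain L \<pi> where "is_limit J C F L \<pi>"
    using assms finite_small[of U] unfolding has_small_limits_def
    by (metis J_def discrete_cat_def cat.select_convs(1,2) finite.emptyI)
  then have "is_terminal C L"
    by (auto simp: is_limit_def is_cone_def J_def discrete_cat_def is_terminal_def)
  then show ?thesis by blast
qed

section \<open>Model categories\<close>

lemma has_liftD:
  assumes "has_lift C i p" "i \<in> Hom C a b" "p \<in> Hom C x y" "u \<in> Hom C a x" "v \<in> Hom C b y"
    "Comp C p u = Comp C v i"
  obtains h where "h \<in> Hom C b x" "Comp C h i = u" "Comp C p h = v"
proof -
  have "Dom C i = a" "Cod C i = b" "Dom C p = x" "Cod C p = y"
    using assms(2,3) by (simp_all add: Hom_iff)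
  then show ?thesis
    using assms(1)[unfolded has_lift_def, rule_format, of u v] assms(4-6) that by auto
qed

lemma has_liftI:
  assumes "i \<in> Hom C a b" "p \<in> Hom C x y"
    and "\<And>u v. \<lbrakk>u \<in> Hom C a x; v \<in> Hom C b y; Comp C p u = Comp C v i\<rbrakk>
      \<Longrightarrow> \<exists>h \<in> Hom C b x. Comp C h i = u \<and> Comp C p h = v"
  shows "has_lift C i p"
  using assms unfolding has_lift_def by (auto simp: Hom_iff)

lemma is_retractI:
  assumes "f \<in> Hom C a b" "g \<in> Hom C c d" "s \<in> Hom C a c" "r \<in> Hom C c a"
    "s' \<in> Hom C b d" "r' \<in> Hom C d b" "Comp C r s = Ident C a" "Comp C r' s' = Ident C b"
    "Comp C g s = Comp C s' f" "Comp C f r = Comp C r' g"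
  shows "is_retract C f g"
  using assms unfolding is_retract_def
  by (intro conjI bexI[of _ s] bexI[of _ r] bexI[of _ s'] bexI[of _ r']) (simp_all add: Hom_iff)

section \<open>The retract argument and closure properties of lifting\<close>

context category
begin

text \<open>The square with the identity on top and \<open>q\<close> at the bottom has a lift
  \<open>h\<close>, which retracts \<open>i\<close> and satisfies \<open>f \<cdot> h = q\<close>;
  thus \<open>f\<close> is a retract of \<open>q\<close> over its codomain. The companion
  \<open>retract_argument_right\<close> is the dual.\<close>

lemma retract_argument_left:
  assumes i: "i \<in> Hom C a c" and q: "q \<in> Hom C c b" and f: "f = q \<cdot> i" and lift: "has_lift C i f"
  shows "is_retract C f q"
proof -
  have fH: "f \<in> Hom C a b" using Comp_Hom[OF i q] f by simp
  have a: "a \<in> Obj C" and b: "b \<in> Obj C" using fH Hom_Obj by blast+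
  obtain h where h: "h \<in> Hom C c a" "h \<cdot> i = Ident C a" "f \<cdot> h = q"
    using has_liftD[OF lift i fH Ident_Hom[OF a] q] f Comp_Ident_right[OF fH] by metis
  show ?thesis
  proof (rule is_retractI[OF fH q i h(1) Ident_Hom[OF b] Ident_Hom[OF b]])
  qed (use h f Comp_Ident_left[OF Ident_Hom[OF b]] Comp_Ident_left[OF fH] Comp_Ident_left[OF q] in simp_all)
qed

lemma retract_argument_right:
  assumes i: "i \<in> Hom C a c" and q: "q \<in> Hom C c b" and f: "f = q \<cdot> i" and lift: "has_lift C f q"
  shows "is_retract C f i"
proof -
  have fH: "f \<in> Hom C a b" using Comp_Hom[OF i q] f by simp
  have a: "a \<in> Obj C" and b: "b \<in> Obj C" using fH Hom_Obj by blast+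
  obtain h where h: "h \<in> Hom C b c" "h \<cdot> f = i" "q \<cdot> h = Ident C b"
    using has_liftD[OF lift fH q i Ident_Hom[OF b]] f Comp_Ident_left[OF fH] by metis
  show ?thesis
  proof (rule is_retractI[OF fH i Ident_Hom[OF a] Ident_Hom[OF a] h(1) q])
  qed (use h f Comp_Ident_left[OF Ident_Hom[OF a]] Comp_Ident_right[OF fH] Comp_Ident_right[OF i] in simp_all)
qed

text \<open>Precomposing the square with the pushout square gives a problem for \<open>f\<close>;
  its solution and the given map \<open>u\<close> induce \<open>h\<close>. That
  \<open>p \<cdot> h = v\<close> follows from the uniqueness part of the universal property.\<close>

lemma has_lift_pushout:
  assumes po: "is_pushout C f g i j" and p: "p \<in> Arr C" and lift: "has_lift C f p"
  shows "has_lift C j p"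
proof (rule has_liftI)
  define a b c d where "a = Dom C f" and "b = Cod C f" and "c = Cod C g" and "d = Cod C i"
  have f: "f \<in> Hom C a b" and g: "g \<in> Hom C a c" and i: "i \<in> Hom C b d" and j: "j \<in> Hom C c d"
    and sq: "i \<cdot> f = j \<cdot> g"
    using po by (auto simp: is_pushout_def Hom_iff a_def b_def c_def d_def)
  have univ: "\<exists>!h. h \<in> Hom C d x \<and> h \<cdot> i = u \<and> h \<cdot> j = v"
    if "u \<in> Hom C b x" "v \<in> Hom C c x" "u \<cdot> f = v \<cdot> g" for x u v
    using po that unfolding is_pushout_def b_def c_def d_def by blast
  show "j \<in> Hom C c d" by (rule j)
  show pH: "p \<in> Hom C (Dom C p) (Cod C p)" using p by (simp add: Hom_iff)
  fix u v assume u: "u \<in> Hom C c (Dom C p)" and v: "v \<in> Hom C d (Cod C p)" and e: "p \<cdot> u = v \<cdot> j"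
  have "p \<cdot> (u \<cdot> g) = (v \<cdot> i) \<cdot> f"
    using e sq Comp_assoc[OF g u pH] Comp_assoc[OF g j v] Comp_assoc[OF f i v] by simp
  then obtain k where k: "k \<in> Hom C b (Dom C p)" "k \<cdot> f = u \<cdot> g" "p \<cdot> k = v \<cdot> i"
    using has_liftD[OF lift f pH Comp_Hom[OF g u] Comp_Hom[OF i v]] by metis
  obtain h where h: "h \<in> Hom C d (Dom C p)" "h \<cdot> i = k" "h \<cdot> j = u"
    using univ[OF k(1) u k(2)] by blast
  have "(p \<cdot> h) \<cdot> i = v \<cdot> i" "(p \<cdot> h) \<cdot> j = v \<cdot> j"
    using h k e Comp_assoc[OF i h(1) pH] Comp_assoc[OF j h(1) pH] by simp_all
  moreover have "(v \<cdot> i) \<cdot> f = (v \<cdot> j) \<cdot> g"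
    using sq Comp_assoc[OF g j v] Comp_assoc[OF f i v] by simp
  ultimately have "p \<cdot> h = v"
    using univ[OF Comp_Hom[OF i v] Comp_Hom[OF j v]] v Comp_Hom[OF h(1) pH] by blast
  then show "\<exists>h \<in> Hom C d (Dom C p). h \<cdot> j = u \<and> p \<cdot> h = v" using h by blast
qed

lemma has_lift_comp_left:
  assumes i: "i \<in> Hom C a b" and j: "j \<in> Hom C b c" and p: "p \<in> Arr C"
    and li: "has_lift C i p" and lj: "has_lift C j p"
  shows "has_lift C (j \<cdot> i) p"
proof (rule has_liftI)
  show "j \<cdot> i \<in> Hom C a c" by (rule Comp_Hom[OF i j])
  show pH: "p \<in> Hom C (Dom C p) (Cod C p)" using p by (simp add: Hom_iff)
  fix u v assume u: "u \<in> Hom C a (Dom C p)" and v: "v \<in> Hom C c (Cod C p)" and e: "p \<cdot> u = v \<cdot> (j \<cdot> i)"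
  then obtain k where k: "k \<in> Hom C b (Dom C p)" "k \<cdot> i = u" "p \<cdot> k = v \<cdot> j"
    using has_liftD[OF li i pH u Comp_Hom[OF j v]] Comp_assoc[OF i j v] by metis
  then obtain h where h: "h \<in> Hom C c (Dom C p)" "h \<cdot> j = k" "p \<cdot> h = v"
    using has_liftD[OF lj j pH k(1) v] by metis
  then show "\<exists>h \<in> Hom C c (Dom C p). h \<cdot> (j \<cdot> i) = u \<and> p \<cdot> h = v"
    using k Comp_assoc[OF i j h(1)] by auto
qed

lemma has_lift_comp_right:
  assumes p: "p \<in> Hom C x y" and q: "q \<in> Hom C y z" and i: "i \<in> Arr C"
    and lp: "has_lift C i p" and lq: "has_lift C i q"
  shows "has_lift C i (q \<cdot> p)"
proof (rule has_liftI)
  show "q \<cdot> p \<in> Hom C x z" by (rule Comp_Hom[OF p q])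
  show iH: "i \<in> Hom C (Dom C i) (Cod C i)" using i by (simp add: Hom_iff)
  fix u v assume u: "u \<in> Hom C (Dom C i) x" and v: "v \<in> Hom C (Cod C i) z" and e: "(q \<cdot> p) \<cdot> u = v \<cdot> i"
  then obtain k where k: "k \<in> Hom C (Cod C i) y" "k \<cdot> i = p \<cdot> u" "q \<cdot> k = v"
    using has_liftD[OF lq iH q Comp_Hom[OF u p] v] Comp_assoc[OF u p q] by metis
  then obtain h where h: "h \<in> Hom C (Cod C i) x" "h \<cdot> i = u" "p \<cdot> h = k"
    using has_liftD[OF lp iH p u k(1)] by metis
  then show "\<exists>h \<in> Hom C (Cod C i) x. h \<cdot> i = u \<and> (q \<cdot> p) \<cdot> h = v"
    using k Comp_assoc[OF h(1) p q] by auto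
qed

lemma has_lift_Ident:
  assumes a: "a \<in> Obj C" and p: "p \<in> Arr C"
  shows "has_lift C (Ident C a) p"
proof (rule has_liftI)
  show "Ident C a \<in> Hom C a a" using Ident_Hom[OF a] .
  show "p \<in> Hom C (Dom C p) (Cod C p)" using p by (simp add: Hom_iff)
  fix u v assume u: "u \<in> Hom C a (Dom C p)" and v: "v \<in> Hom C a (Cod C p)" and e: "p \<cdot> u = v \<cdot> Ident C a"
  then show "\<exists>h \<in> Hom C a (Dom C p). h \<cdot> Ident C a = u \<and> p \<cdot> h = v"
    using Comp_Ident_right[OF u] Comp_Ident_right[OF v] by auto
qed

end

sublocale model_category \<subseteq> category C
  by (rule category)

section \<open>Classes determined by lifting, and relative homotopies\<close>

context model_category
begin

text \<open>The axioms demand lifting but not that lifting characterizes a class. The converse is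
  the retract argument: factor the map, lift against one factor, and use closure under retracts. The
  next three characterizations follow the same scheme.\<close>

lemma Fib_iff: "p \<in> Fib M \<longleftrightarrow> p \<in> Arr C \<and> (\<forall>i \<in> Cof M \<inter> Weq M. has_lift C i p)"
proof (intro iffI conjI ballI)
  assume *: "p \<in> Arr C \<and> (\<forall>i \<in> Cof M \<inter> Weq M. has_lift C i p)"
  then have "p \<in> Hom C (Dom C p) (Cod C p)" by (simp add: Hom_iff)
  then obtain c i q where i: "i \<in> Hom C (Dom C p) c" "i \<in> Cof M \<inter> Weq M"
      and q: "q \<in> Hom C c (Cod C p)" "q \<in> Fib M" "p = q \<cdot> i"
    using factorization(1) by blast
  have "is_retract C p q" using retract_argument_left[OF i(1) q(1,3)] i(2) * by blast
  then show "p \<in> Fib M" using retracts(3) q(2) by blast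
qed (use classes lifting in blast)+

lemma trivial_fibration_iff:
  "p \<in> Fib M \<inter> Weq M \<longleftrightarrow> p \<in> Arr C \<and> (\<forall>i \<in> Cof M. has_lift C i p)"
proof (intro iffI conjI ballI)
  assume *: "p \<in> Arr C \<and> (\<forall>i \<in> Cof M. has_lift C i p)"
  then have "p \<in> Hom C (Dom C p) (Cod C p)" by (simp add: Hom_iff)
  then obtain c i q where i: "i \<in> Hom C (Dom C p) c" "i \<in> Cof M"
      and q: "q \<in> Hom C c (Cod C p)" "q \<in> Fib M \<inter> Weq M" "p = q \<cdot> i"
    using factorization(2) by blast
  have "is_retract C p q" using retract_argument_left[OF i(1) q(1,3)] i(2) * by blast
  then show "p \<in> Fib M \<inter> Weq M" using retracts(1,3) q(2) by blast
qed (use classes lifting in blast)+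

lemma trivial_cofibration_iff:
  "i \<in> Cof M \<inter> Weq M \<longleftrightarrow> i \<in> Arr C \<and> (\<forall>p \<in> Fib M. has_lift C i p)"
proof (intro iffI conjI ballI)
  assume *: "i \<in> Arr C \<and> (\<forall>p \<in> Fib M. has_lift C i p)"
  then have "i \<in> Hom C (Dom C i) (Cod C i)" by (simp add: Hom_iff)
  then obtain c j q where j: "j \<in> Hom C (Dom C i) c" "j \<in> Cof M \<inter> Weq M"
      and q: "q \<in> Hom C c (Cod C i)" "q \<in> Fib M" "i = q \<cdot> j"
    using factorization(1) by blast
  have "is_retract C i j" using retract_argument_right[OF j(1) q(1,3)] q(2) * by blast
  then show "i \<in> Cof M \<inter> Weq M" using retracts(1,2) j(2) by blast
qed (use classes lifting in blast)+

lemma Cof_iff: "i \<in> Cof M \<longleftrightarrow> i \<in> Arr C \<and> (\<forall>p \<in> Fib M \<inter> Weq M. has_lift C i p)"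
proof (intro iffI conjI ballI)
  assume *: "i \<in> Arr C \<and> (\<forall>p \<in> Fib M \<inter> Weq M. has_lift C i p)"
  then have "i \<in> Hom C (Dom C i) (Cod C i)" by (simp add: Hom_iff)
  then obtain c j q where j: "j \<in> Hom C (Dom C i) c" "j \<in> Cof M"
      and q: "q \<in> Hom C c (Cod C i)" "q \<in> Fib M \<inter> Weq M" "i = q \<cdot> j"
    using factorization(2) by blast
  have "is_retract C i j" using retract_argument_right[OF j(1) q(1,3)] q(2) * by blast
  then show "i \<in> Cof M" using retracts(2) j(2) by blast
qed (use classes lifting in blast)+

text \<open>An identity lifts against every arrow, hence is a trivial cofibration; the axioms do not
  list this.\<close>

lemma Ident_Weq: "a \<in> Obj C \<Longrightarrow> Ident C a \<in> Weq M"
  using trivial_cofibration_iff[of "Ident C a"] has_lift_Ident[of a] classes(3) Ident_Hom[of a]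
  unfolding Hom_iff by blast

lemma Cof_Comp:
  assumes i: "i \<in> Hom C a b" "i \<in> Cof M" and j: "j \<in> Hom C b c" "j \<in> Cof M"
  shows "j \<cdot> i \<in> Cof M"
  using i(2) j(2) has_lift_comp_left[OF i(1) j(1)] Comp_Hom[OF i(1) j(1)] classes(3)
  unfolding Cof_iff Hom_iff by blast

lemma Fib_Comp:
  assumes p: "p \<in> Hom C x y" "p \<in> Fib M" and q: "q \<in> Hom C y z" "q \<in> Fib M"
  shows "q \<cdot> p \<in> Fib M"
  using p(2) q(2) has_lift_comp_right[OF p(1) q(1)] Comp_Hom[OF p(1) q(1)] classes(2)
  unfolding Fib_iff Hom_iff by blast

text \<open>Extending into a fibrant \<open>Z\<close> is lifting against its fibration to a terminal
  object, where every square commutes.\<close>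

lemma trivial_cofibration_extend:
  assumes i: "i \<in> Hom C a b" "i \<in> Cof M \<inter> Weq M" and Z: "fibrant C M Z" and u: "u \<in> Hom C a Z"
  obtains h where "h \<in> Hom C b Z" "h \<cdot> i = u"
proof -
  obtain t z where t: "is_terminal C t" and z: "z \<in> Hom C Z t" "z \<in> Fib M"
    using Z by (auto simp: fibrant_def)
  obtain v where v: "v \<in> Hom C b t" using t Hom_Obj[OF i(1)] by (auto simp: is_terminal_def)
  have "z \<cdot> u = v \<cdot> i"
    using t Comp_Hom[OF u z(1)] Comp_Hom[OF i(1) v] Hom_Obj[OF i(1)]
    unfolding is_terminal_def by blast
  then show ?thesis
    using has_liftD[OF lifting(1)[OF i(2) z(2)] i(1) z(1) u v] that by metis
qed

text \<open>The object \<open>c\<close> is a cylinder on \<open>b\<close> relative to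
  \<open>a\<close>: glue two copies of \<open>b\<close> along \<open>i\<close> and factor the
  codiagonal \<open>n\<close> as a cofibration \<open>d\<close> followed by a trivial fibration
  \<open>q\<close>. Then \<open>s\<close> and \<open>t\<close> are the two ends and \<open>h\<close>
  is a homotopy from \<open>f\<close> to \<open>g\<close>.\<close>

lemma relative_homotopy:
  assumes U: "universe U" and i: "i \<in> Hom C a b" "i \<in> Cof M \<inter> Weq M"
    and Z: "fibrant C M Z" and f: "f \<in> Hom C b Z" and g: "g \<in> Hom C b Z" and fg: "f \<cdot> i = g \<cdot> i"
  obtains c s t q h where "s \<in> Hom C b c" "s \<in> Cof M" "t \<in> Hom C b c" "s \<cdot> i = t \<cdot> i"
    "q \<in> Hom C c b" "q \<in> Fib M \<inter> Weq M" "q \<cdot> s = Ident C b" "q \<cdot> t = Ident C b"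
    "h \<in> Hom C c Z" "h \<cdot> s = f" "h \<cdot> t = g"
proof -
  obtain k l where po: "is_pushout C i i k l"
    using pushout_exists[OF U colimits category i(1) i(1)] by blast
  define w where "w = Cod C k"
  have k: "k \<in> Hom C b w" and l: "l \<in> Hom C b w" and kl: "k \<cdot> i = l \<cdot> i"
    using po i(1) by (auto simp: is_pushout_def Hom_iff w_def)
  have univ: "\<exists>!h. h \<in> Hom C w x \<and> h \<cdot> k = u \<and> h \<cdot> l = v"
    if "u \<in> Hom C b x" "v \<in> Hom C b x" "u \<cdot> i = v \<cdot> i" for x u v
    using po[unfolded is_pushout_iff[OF i(1) i(1) k l]] that by blast
  \<comment> \<open>\<open>has_lift_pushout\<close> concerns the second leg; with the legs swapped
    it shows that \<open>k\<close> is a trivial cofibration.\<close>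
  have po': "is_pushout C i i l k"
    unfolding is_pushout_iff[OF i(1) i(1) l k]
  proof (intro conjI allI ballI impI)
    fix x u v assume "u \<in> Hom C b x" "v \<in> Hom C b x" "u \<cdot> i = v \<cdot> i"
    then show "\<exists>!h. h \<in> Hom C w x \<and> h \<cdot> l = u \<and> h \<cdot> k = v"
      using univ[of v x u] by (simp add: conj_commute conj_left_commute)
  qed (simp add: kl)
  have k': "k \<in> Cof M \<inter> Weq M"
    using has_lift_pushout[OF po'] i(2) k classes(3) unfolding trivial_cofibration_iff Hom_iff by blast
  have b: "b \<in> Obj C" using f Hom_Obj by blast
  obtain n where n: "n \<in> Hom C w b" "n \<cdot> k = Ident C b" "n \<cdot> l = Ident C b"
    using univ[OF Ident_Hom[OF b] Ident_Hom[OF b]] by blast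
  obtain c d q where d: "d \<in> Hom C w c" "d \<in> Cof M" and q: "q \<in> Hom C c b" "q \<in> Fib M \<inter> Weq M"
      and n': "n = q \<cdot> d"
    using factorization(2)[OF n(1)] by blast
  define s t where "s = d \<cdot> k" and "t = d \<cdot> l"
  have s: "s \<in> Hom C b c" and t: "t \<in> Hom C b c"
    using Comp_Hom k l d unfolding s_def t_def by blast+
  have qs: "q \<cdot> s = Ident C b" "q \<cdot> t = Ident C b"
    using n n' Comp_assoc[OF k d(1) q(1)] Comp_assoc[OF l d(1) q(1)] by (simp_all add: s_def t_def)
  \<comment> \<open>Two-out-of-three is used twice: \<open>q\<close> and the identity
    \<open>q \<cdot> s\<close> give \<open>s\<close>, then \<open>k\<close> and \<open>s\<close>
    give \<open>d\<close>. So \<open>d\<close> is a trivial cofibration and the map glued from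
    \<open>f\<close> and \<open>g\<close> extends over the cylinder.\<close>
  have "s \<in> Weq M" using two_of_three(3)[OF s q(1)] q(2) qs Ident_Weq[OF b] by auto
  then have "d \<in> Weq M" using two_of_three(2)[OF k d(1)] k' by (simp add: s_def)
  moreover obtain e where e: "e \<in> Hom C w Z" "e \<cdot> k = f" "e \<cdot> l = g"
    using univ[OF f g fg] by blast
  ultimately obtain h where h: "h \<in> Hom C c Z" "h \<cdot> d = e"
    using trivial_cofibration_extend[OF d(1) _ Z e(1)] d(2) by blast
  have "h \<cdot> s = f" "h \<cdot> t = g"
    using h e Comp_assoc[OF k d(1) h(1)] Comp_assoc[OF l d(1) h(1)] by (simp_all add: s_def t_def)
  moreover have "s \<in> Cof M" using Cof_Comp[OF k _ d] k' by (simp add: s_def)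
  moreover have "s \<cdot> i = t \<cdot> i"
    using kl Comp_assoc[OF i(1) k d(1)] Comp_assoc[OF i(1) l d(1)] by (simp add: s_def t_def)
  ultimately show ?thesis using that s t q qs h(1) by blast
qed

end

text \<open>An \<open>M\<close>-trivial cofibration lifts up to relative homotopy, hence strictly, against an
  \<open>N\<close>-fibration between \<open>N\<close>-fibrant objects.  Apply this to the \<open>N\<close>-fibration \<open>p\<close> obtained by
  factoring \<open>i\<close> followed by an \<open>N\<close>-fibrant replacement \<open>j\<close> of its codomain: the lift provides a
  homotopy inverse of \<open>p\<close>.\<close>

lemma Weq_mono_of_fibrant:
  assumes U: "universe U" and M: "model_category U C M" and N: "model_category U C N"
    and Cof: "Cof M = Cof N" and fib: "\<And>Z. fibrant C N Z \<Longrightarrow> fibrant C M Z"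
  shows "Weq M \<subseteq> Weq N"
proof -
  interpret M: model_category U C M by (rule M)
  interpret N: model_category U C N by (rule N)
  note assoc = M.Comp_assoc
  \<comment> \<open>Trivial fibrations depend on the cofibrations alone. A cylinder built in
    \<open>M\<close> therefore has an \<open>N\<close>-trivial projection too.\<close>
  have TF: "Fib M \<inter> Weq M = Fib N \<inter> Weq N"
    using M.trivial_fibration_iff N.trivial_fibration_iff Cof by blast
  have step: "i \<in> Weq N" if iH: "i \<in> Hom C a b" and i: "i \<in> Cof M \<inter> Weq M" for i a b
  proof -
    have a: "a \<in> Obj C" and b: "b \<in> Obj C" using iH M.Hom_Obj by blast+
    obtain e where e: "is_terminal C e"
      using terminal_exists[OF U M.limits M.category] by blast
    obtain z where "z \<in> Hom C b e" using e b by (auto simp: is_terminal_def)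
    then obtain b' j y where j: "j \<in> Hom C b b'" "j \<in> Cof N \<inter> Weq N" and y: "y \<in> Hom C b' e" "y \<in> Fib N"
      using N.factorization(1) by blast
    have fb': "fibrant C N b'" using e y by (auto simp: fibrant_def)
    have b': "b' \<in> Obj C" using j(1) M.Hom_Obj by blast
    have "Comp C j i \<in> Hom C a b'" using M.Comp_Hom[OF iH j(1)] .
    then obtain a' k p where k: "k \<in> Hom C a a'" "k \<in> Cof N \<inter> Weq N" and p: "p \<in> Hom C a' b'" "p \<in> Fib N"
        and pk: "Comp C j i = Comp C p k"
      using N.factorization(1) by blast
    have a': "a' \<in> Obj C" using k(1) M.Hom_Obj by blast
    have fa': "fibrant C N a'"
      using e N.Fib_Comp[OF p y] M.Comp_Hom[OF p(1) y(1)] by (auto simp: fibrant_def)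
    obtain r where r: "r \<in> Hom C b a'" "Comp C r i = k"
      using M.trivial_cofibration_extend[OF iH i fib[OF fa'] k(1)] by blast
    have "Comp C (Comp C p r) i = Comp C j i"
      using assoc[OF iH r(1) p(1)] r pk by simp
    then obtain c s t q h where st: "s \<in> Hom C b c" "s \<in> Cof M" "t \<in> Hom C b c" "Comp C s i = Comp C t i"
      and q: "q \<in> Hom C c b" "q \<in> Fib M \<inter> Weq M" "Comp C q s = Ident C b" "Comp C q t = Ident C b"
      and h: "h \<in> Hom C c b'" "Comp C h s = Comp C p r" "Comp C h t = j"
      using M.relative_homotopy[OF U iH i fib[OF fb'] M.Comp_Hom[OF r(1) p(1)] j(1)] by metis
    \<comment> \<open>The start \<open>s\<close> of the \<open>M\<close>-cylinder is an
      \<open>N\<close>-trivial cofibration, so the homotopy from \<open>p\<close> after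
      \<open>r\<close> to \<open>j\<close> lifts through the \<open>N\<close>-fibration
      \<open>p\<close>, starting at \<open>r\<close>. The far end of the lifted homotopy is the
      strict lift \<open>r'\<close>.\<close>
    have "s \<in> Weq N" using N.two_of_three(3)[OF st(1) q(1)] q TF N.Ident_Weq[OF b] by auto
    then obtain l where l: "l \<in> Hom C c a'" "Comp C l s = r" "Comp C p l = h"
      using has_liftD[OF N.lifting(1)[OF _ p(2)] st(1) p(1) r(1) h(1)] st(2) Cof h(2) by (metis IntI)
    define r' where "r' = Comp C l t"
    have r': "r' \<in> Hom C b a'" "Comp C p r' = j" "Comp C r' i = k"
      using M.Comp_Hom[OF st(3) l(1)] assoc[OF st(3) l(1) p(1)] h l r st(4)
        assoc[OF iH st(3) l(1)] assoc[OF iH st(1) l(1)] by (simp_all add: r'_def)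
    \<comment> \<open>As \<open>j\<close> is an \<open>N\<close>-trivial cofibration,
      \<open>r'\<close> extends along it to a section \<open>s'\<close> of \<open>p\<close>. On
      \<open>k\<close>, the composite of \<open>p\<close> and \<open>s'\<close> agrees with the
      identity, so it is homotopic to the identity and hence in \<open>Weq N\<close>.\<close>
    obtain s' where s': "s' \<in> Hom C b' a'" "Comp C s' j = r'" "Comp C p s' = Ident C b'"
      using has_liftD[OF N.lifting(1)[OF j(2) p(2)] j(1) p(1) r'(1) M.Ident_Hom[OF b']]
        r'(2) M.Comp_Ident_left[OF j(1)] by metis
    have sp: "Comp C s' p \<in> Hom C a' a'" using M.Comp_Hom[OF p(1) s'(1)] .
    have "Comp C (Comp C s' p) k = Comp C (Ident C a') k"
      using assoc[OF k(1) p(1) s'(1)] assoc[OF iH j(1) s'(1)] pk s' r' M.Comp_Ident_left[OF k(1)] by simp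
    then obtain c s t q h where st: "s \<in> Hom C a' c" "t \<in> Hom C a' c"
      and q: "q \<in> Hom C c a'" "q \<in> Fib N \<inter> Weq N" "Comp C q s = Ident C a'" "Comp C q t = Ident C a'"
      and h: "h \<in> Hom C c a'" "Comp C h s = Comp C s' p" "Comp C h t = Ident C a'"
      using N.relative_homotopy[OF U k fa' sp M.Ident_Hom[OF a']] by metis
    have s: "s \<in> Weq N" and t: "t \<in> Weq N"
      using N.two_of_three(3)[OF st(1) q(1)] N.two_of_three(3)[OF st(2) q(1)] q N.Ident_Weq[OF a'] by auto
    have "h \<in> Weq N" using N.two_of_three(2)[OF st(2) h(1)] t h N.Ident_Weq[OF a'] by auto
    then have "Comp C s' p \<in> Weq N" using N.two_of_three(1)[OF st(1) h(1)] s h by auto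
    \<comment> \<open>Identities on the domain together with \<open>s'\<close> and \<open>p\<close>
      on the codomain exhibit the retract; all that is needed is that \<open>s'\<close> is a section
      of \<open>p\<close>.\<close>
    moreover have "is_retract C p (Comp C s' p)"
    proof (rule is_retractI[OF p(1) sp M.Ident_Hom[OF a'] M.Ident_Hom[OF a'] s'(1) p(1)])
      show "Comp C p (Ident C a') = Comp C p (Comp C s' p)"
        using M.Comp_Ident_right[OF p(1)] assoc[OF p(1) s'(1) p(1)] s'(3) M.Comp_Ident_left[OF p(1)] by simp
    qed (use s'(3) M.Comp_Ident_left[OF M.Ident_Hom[OF a']] M.Comp_Ident_right[OF sp] in simp_all)
    ultimately have "p \<in> Weq N" using N.retracts(1) by blast
    then have "Comp C j i \<in> Weq N" using N.two_of_three(1)[OF k(1) p(1)] k(2) pk by simp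
    then show ?thesis using N.two_of_three(3)[OF iH j(1)] j(2) by blast
  qed
  show ?thesis
  proof
    fix f assume f: "f \<in> Weq M"
    then have fH: "f \<in> Hom C (Dom C f) (Cod C f)" using M.classes by (auto simp: Hom_iff)
    then obtain c i p where i: "i \<in> Hom C (Dom C f) c" "i \<in> Cof M" and p: "p \<in> Hom C c (Cod C f)" "p \<in> Fib M \<inter> Weq M"
        and fp: "f = Comp C p i"
      using M.factorization(2) by blast
    have "i \<in> Weq M" using M.two_of_three(3)[OF i(1) p(1)] p f fp by blast
    then show "f \<in> Weq N"
      using N.two_of_three(1)[OF i(1) p(1)] step[OF i(1)] i p TF fp by blast
  qed
qed

text \<open>More trivial cofibrations leave fewer maps with the right lifting property.\<close>

lemma Fib_antimono:
  assumes M: "model_category U C M" and N: "model_category U C N"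
    and "Cof M \<subseteq> Cof N" "Weq M \<subseteq> Weq N"
  shows "Fib N \<subseteq> Fib M"
proof
  fix p assume "p \<in> Fib N"
  then show "p \<in> Fib M"
    unfolding model_category.Fib_iff[OF M] model_category.Fib_iff[OF N] using assms(3,4) by blast
qed

lemma comp_id_functor [simp]: "comp_functor id_functor F = F" "comp_functor F id_functor = F"
  by (simp_all add: comp_functor_def id_functor_def o_def)

lemma id_quillen_adjunction:
  assumes M: "model_category U C M" and N: "model_category U C N"
    and "Cof M \<subseteq> Cof N" "Weq M \<subseteq> Weq N"
  shows "quillen_adjunction U C M C N id_functor id_functor"
proof -
  interpret model_category U C M by (rule M)
  have "is_functor C C id_functor"
    using category by (auto simp: is_functor_def id_functor_def Hom_iff)
  moreover have "is_nat_trans C C id_functor id_functor (Ident C)"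
    using calculation(1) Ident_Hom Comp_Ident_left Comp_Ident_right
    by (auto simp: is_nat_trans_def id_functor_def Hom_iff)
  ultimately have "is_adjunction C C id_functor id_functor (Ident C) (Ident C)"
    unfolding is_adjunction_def comp_id_functor
    using Comp_Ident_left[OF Ident_Hom] by (simp add: id_functor_def)
  then show ?thesis
    using assms by (auto simp: quillen_adjunction_def id_functor_def)
qed

section \<open>Triangulations of convex polygons\<close>

text \<open>Twice the signed area of the triangle p, q, r, positive when it is traversed
  counterclockwise; the same expression as in \<open>convex_polygon\<close>.\<close>

definition orient :: "complex \<Rightarrow> complex \<Rightarrow> complex \<Rightarrow> real" where
  "orient p q r = Im (cnj (q - p) * (r - p))"

lemma orient_perm:
  "orient q r p = orient p q r" "orient r p q = orient p q r"
  "orient q p r = - orient p q r" "orient p r q = - orient p q r" "orient r q p = - orient p q r"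
  by (simp_all add: orient_def algebra_simps)

lemma orient_self [simp]: "orient p q p = 0" "orient p q q = 0"
  by (simp_all add: orient_def algebra_simps)

lemma orient_affine:
  assumes "s + t = 1"
  shows "orient p q (s *\<^sub>R x + t *\<^sub>R y) = s * orient p q x + t * orient p q y"
proof -
  have "s = 1 - t" using assms by simp
  show ?thesis unfolding \<open>s = 1 - t\<close> by (simp add: orient_def algebra_simps)
qed

lemma orient_convex_hull_le:
  assumes "z \<in> convex hull S" "\<And>x. x \<in> S \<Longrightarrow> orient p q x \<le> 0"
  shows "orient p q z \<le> 0"
proof -
  have "convex {z. orient p q z \<le> 0}"
  proof (rule convexI, clarsimp)
    fix x y :: complex and s t :: real
    assume "orient p q x \<le> 0" "orient p q y \<le> 0" "0 \<le> s" "0 \<le> t" "s + t = 1"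
    then show "orient p q (s *\<^sub>R x + t *\<^sub>R y) \<le> 0"
      by (simp add: orient_affine add_nonpos_nonpos mult_nonneg_nonpos)
  qed
  then have "convex hull S \<subseteq> {z. orient p q z \<le> 0}"
    using assms(2) by (intro hull_minimal) auto
  then show ?thesis using assms(1) by auto
qed

lemma orient_convex_hull_ge:
  assumes "z \<in> convex hull S" "\<And>x. x \<in> S \<Longrightarrow> orient p q x \<ge> 0"
  shows "orient p q z \<ge> 0"
  using orient_convex_hull_le[of z S q p] assms by (simp add: orient_perm(3)[of q p])

text \<open>The diagonals of a convex quadrilateral meet. The crossing point has explicit weights:
  each end of a diagonal is weighted by the area of the triangle on the other three
  vertices.\<close>

lemma orient_crossing:
  assumes "orient a b c > 0" "orient a b d > 0" "orient a c d > 0" "orient b c d > 0"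
  obtains s t where "0 < s" "s < 1" "0 < t" "t < 1"
    "s *\<^sub>R a + (1 - s) *\<^sub>R c = t *\<^sub>R b + (1 - t) *\<^sub>R d"
proof -
  \<comment> \<open>Twice the area of the quadrilateral, here cut along bd; cutting along ac gives
    the same value, so both sides of the vector identity below can be normalized by
    \<open>m\<close>.\<close>
  define m where "m = orient b c d + orient a b d"
  have m: "m = orient a c d + orient a b c" "m > 0"
    using assms by (simp_all add: m_def orient_def algebra_simps)
  have "orient b c d *\<^sub>R a + orient a b d *\<^sub>R c = orient a c d *\<^sub>R b + orient a b c *\<^sub>R d"
    by (simp add: complex_eq_iff orient_def algebra_simps)
  then have "(1 / m) *\<^sub>R (orient b c d *\<^sub>R a + orient a b d *\<^sub>R c)
      = (1 / m) *\<^sub>R (orient a c d *\<^sub>R b + orient a b c *\<^sub>R d)"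
    by simp
  moreover have "1 - orient b c d / m = orient a b d / m" "1 - orient a c d / m = orient a b c / m"
    using m by (simp_all add: field_simps m_def)
  ultimately show ?thesis
    using that[of "orient b c d / m" "orient a c d / m"] assms m
    by (simp add: m_def scaleR_add_right)
qed

lemma convex_polygon_orient:
  "\<lbrakk>convex_polygon n v; i < j; j < k; k \<le> n\<rbrakk> \<Longrightarrow> orient (v i) (v j) (v k) > 0"
  unfolding convex_polygon_def orient_def by blast

lemma convex_polygon_orient_neq_0:
  assumes "convex_polygon n v" "i \<le> n" "j \<le> n" "k \<le> n" "i \<noteq> j" "i \<noteq> k" "j \<noteq> k"
  shows "orient (v i) (v j) (v k) \<noteq> 0"
proof -
  note o = convex_polygon_orient[OF assms(1)]
  consider "i < j" "j < k" | "i < k" "k < j" | "j < i" "i < k" | "j < k" "k < i" | "k < i" "i < j" | "k < j" "j < i"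
    using assms by linarith
  then show ?thesis
    using o[of i j k] o[of i k j] o[of j i k] o[of j k i] o[of k i j] o[of k j i] assms(2-4)
      orient_perm[of "v i" "v j" "v k"]
    by cases linarith+
qed

lemma card_3_obtain:
  assumes "card J = 3" "x \<in> J" "y \<in> J" "x \<noteq> y"
  obtains e where "J = {x, y, e}" "e \<noteq> x" "e \<noteq> y"
proof -
  have "finite J" using assms(1) by (simp add: card_ge_0_finite)
  then have "card (J - {x, y}) = 1" using assms by (subst card_Diff_subset) auto
  then obtain e where "J - {x, y} = {e}" by (auto simp: card_1_singleton_iff)
  then show ?thesis using that[of e] assms by blast
qed

text \<open>If ac and bd crossed at \<open>q\<close>, then \<open>q\<close> would lie in both
  triangles and so in the hull of their common vertices. Being interior to the edge ac of
  \<open>J\<close>, it forces a and c to be common; then \<open>K\<close> has four vertices.\<close>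

lemma triangulates_noncrossing:
  assumes poly: "convex_polygon n v" and T: "triangulates n v T"
    and J: "J \<in> T" "a \<in> J" "c \<in> J" and K: "K \<in> T" "b \<in> K" "d \<in> K"
    and ord: "a < b" "b < c" "c < d"
  shows False
proof -
  have sub: "J \<subseteq> {..n}" "card J = 3" "K \<subseteq> {..n}" "card K = 3"
    using T J(1) K(1) by (auto simp: triangulates_def)
  have "d \<le> n" using sub K by auto
  then obtain s t where st: "0 < s" "s < 1" "0 < t" "t < 1"
      and eq: "s *\<^sub>R v a + (1 - s) *\<^sub>R v c = t *\<^sub>R v b + (1 - t) *\<^sub>R v d"
    using orient_crossing[of "v a" "v b" "v c" "v d"] convex_polygon_orient[OF poly] ord by auto
  define q where "q = s *\<^sub>R v a + (1 - s) *\<^sub>R v c"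
  have "q \<in> convex hull (v ` J)"
    unfolding q_def using st J by (intro convexD[OF convex_convex_hull]) (auto intro: hull_inc)
  moreover have "q \<in> convex hull (v ` K)"
    unfolding q_def eq using st K by (intro convexD[OF convex_convex_hull]) (auto intro: hull_inc)
  ultimately have q: "q \<in> convex hull (v ` (J \<inter> K))"
    using T J(1) K(1) unfolding triangulates_def by blast
  have vertex: "x \<in> J \<inter> K"
    if xy: "x \<in> J" "y \<in> J" "x \<noteq> y" and r: "0 < r" "r < 1" and q': "q = r *\<^sub>R v x + (1 - r) *\<^sub>R v y" for x y r
  proof (rule ccontr)
    assume x: "x \<notin> J \<inter> K"
    obtain e where e: "J = {x, y, e}" "e \<noteq> x" "e \<noteq> y"
      using card_3_obtain[OF sub(2) xy] by blast
    \<comment> \<open>Without \<open>x\<close>, the common vertices lie on the line through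
      \<open>v y\<close> and \<open>v e\<close>. So does \<open>q\<close>, and then also
      \<open>v x\<close>, because \<open>q\<close> lies strictly between \<open>v x\<close> and
      \<open>v y\<close>; but no three vertices are collinear.\<close>
    have "orient (v y) (v e) z = 0" if "z \<in> v ` (J \<inter> K)" for z
      using that e x by auto
    then have "orient (v y) (v e) q = 0"
      using orient_convex_hull_le[OF q] orient_convex_hull_ge[OF q] by (metis order.antisym order.refl)
    then have "orient (v y) (v e) (v x) = 0"
      using r by (simp add: q' orient_affine)
    then show False
      using convex_polygon_orient_neq_0[OF poly, of y e x] e sub xy by auto
  qed
  have "a \<in> K" using vertex[of a c s] J st ord by (auto simp: q_def)
  moreover have "c \<in> K" using vertex[of c a "1 - s"] J st ord by (auto simp: q_def add.commute)
  ultimately have "{a, b, c, d} \<subseteq> K" using K by auto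
  moreover have "finite K" using sub(3) finite_subset by blast
  ultimately have "card {a, b, c, d} \<le> 3" using sub(4) card_mono by metis
  then show False using ord by auto
qed

text \<open>Step from the midpoint \<open>m\<close> of the edge a little into the polygon, on the
  side of the vertices between a and b. The new point lies in a triangle \<open>K\<close> that
  contains \<open>m\<close> as well, and such a \<open>K\<close> must have both a and b as
  vertices.\<close>

lemma triangulates_triangle_below:
  assumes poly: "convex_polygon n v" and T: "triangulates n v T"
    and ab: "Suc a < b" "b \<le> n"
    and edge: "(a = 0 \<and> b = n) \<or> (\<exists>K \<in> T. a \<in> K \<and> b \<in> K)"
  obtains k where "a < k" "k < b" "{a, k, b} \<in> T"
proof -
  define m where "m = (1 / 2) *\<^sub>R v a + (1 / 2) *\<^sub>R v b"
  define f where "f = (\<lambda>t. t *\<^sub>R v (Suc a) + (1 - t) *\<^sub>R m)"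
  \<comment> \<open>The vertices strictly between a and b are exactly those on the negative side of
    the line from \<open>v a\<close> to \<open>v b\<close>. One of them is \<open>Suc a\<close>,
    towards which \<open>f\<close> moves.\<close>
  have pos: "orient (v a) (v b) (v k) < 0 \<longleftrightarrow> a < k \<and> k < b" if "k \<le> n" for k
  proof -
    note o = convex_polygon_orient[OF poly]
    consider "k < a" | "k = a" | "a < k \<and> k < b" | "k = b" | "b < k" by linarith
    then show ?thesis
      using o[of k a b] o[of a k b] o[of a b k] ab that
        orient_perm[of "v a" "v b" "v k"]
      by cases auto
  qed
  have hull: "v k \<in> convex hull (v ` {..n})" if "k \<le> n" for k
    using that by (auto intro: hull_inc)
  have mh: "m \<in> convex hull (v ` {..n})"
    unfolding m_def using ab by (intro convexD[OF convex_convex_hull] hull) auto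
  have fh: "f t \<in> convex hull (v ` {..n})" if "0 \<le> t" "t \<le> 1" for t
    unfolding f_def using ab that by (intro convexD[OF convex_convex_hull] hull mh) auto
  have Tsub: "J \<subseteq> {..n}" "card J = 3" "finite J" if "J \<in> T" for J
    using T that finite_subset[of J "{..n}"] by (auto simp: triangulates_def)
  have "finite T" using Tsub(1) by (intro finite_subset[of T "Pow {..n}"]) auto
  \<comment> \<open>The triangles missing \<open>m\<close> form a finite union of compact sets, so
    its complement is a neighbourhood of \<open>m\<close> and contains \<open>f t\<close> for small
    t > 0.\<close>
  define B where "B = (\<Union>J \<in> {J \<in> T. m \<notin> convex hull (v ` J)}. convex hull (v ` J))"
  have "closed B"
    unfolding B_def using \<open>finite T\<close> Tsub(3)
    by (intro closed_UN) (auto intro!: compact_imp_closed finite_imp_compact_convex_hull)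
  moreover have "m \<notin> B" by (auto simp: B_def)
  moreover have "(f \<longlongrightarrow> f 0) (at_right 0)"
    unfolding f_def by (auto intro!: tendsto_eq_intros)
  ultimately have "\<forall>\<^sub>F t in at_right 0. f t \<in> - B"
    using topological_tendstoD[of f "f 0" "at_right 0" "- B"] by (auto simp: f_def open_Compl)
  moreover have "\<forall>\<^sub>F t in at_right (0 :: real). t \<in> {0<..<1}"
    by (intro eventually_at_right_real) simp
  ultimately have "\<forall>\<^sub>F t in at_right 0. f t \<in> - B \<and> t \<in> {0<..<1}"
    by (rule eventually_conj)
  then obtain t where t: "f t \<notin> B" "0 < t" "t < 1"
    using eventually_happens'[of "at_right (0 :: real)"] by fastforce
  then obtain K where K: "K \<in> T" "f t \<in> convex hull (v ` K)"
    using fh[of t] T unfolding triangulates_def by (metis UN_E less_imp_le)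
  then have mK: "m \<in> convex hull (v ` K)" using t(1) by (auto simp: B_def)
  have "orient (v a) (v b) m = 0" by (simp add: m_def orient_affine)
  then have "orient (v a) (v b) (f t) < 0"
    using t ab pos[of "Suc a"] by (simp add: f_def orient_affine mult_pos_neg)
  then obtain k where k: "k \<in> K" "orient (v a) (v b) (v k) < 0"
    using orient_convex_hull_ge[OF K(2), of "v a" "v b"] by force
  then have akb: "a < k" "k < b" using pos Tsub(1)[OF K(1)] by auto
  \<comment> \<open>A vertex of \<open>K\<close> beyond a or b would, together with
    \<open>k\<close>, span an edge crossing ab. If ab is the edge from 0 to n, there is no such
    vertex.\<close>
  have range: "a \<le> y \<and> y \<le> b" if y: "y \<in> K" for y
  proof (rule ccontr)
    assume "\<not> (a \<le> y \<and> y \<le> b)"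
    then consider "y < a" | "b < y" by linarith
    then show False
    proof cases
      case 1
      then obtain J where "J \<in> T" "a \<in> J" "b \<in> J" using edge by auto
      then show False using triangulates_noncrossing[OF poly T K(1) y k(1)] 1 akb by blast
    next
      case 2
      then obtain J where "J \<in> T" "a \<in> J" "b \<in> J" using edge Tsub(1)[OF K(1)] y by auto
      then show False using triangulates_noncrossing[OF poly T _ _ _ K(1) k(1) y] 2 akb by blast
    qed
  qed
  have mid: "orient p q m = (orient p q (v a) + orient p q (v b)) / 2" for p q
    by (simp add: m_def orient_affine)
  have fin: "finite K" "K \<noteq> {}" using Tsub(3) K k by auto
  \<comment> \<open>Otherwise the line from the least vertex \<open>j\<close> of \<open>K\<close> to
    b separates: \<open>K\<close> lies on its closed negative side, while \<open>v a\<close>, and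
    with it the midpoint \<open>m\<close>, lies strictly on the other. For b the greatest vertex of
    \<open>K\<close> plays this part.\<close>
  have "a \<in> K"
  proof (rule ccontr)
    assume a: "a \<notin> K"
    define j where "j = Min K"
    have j: "j \<in> K" "\<And>y. y \<in> K \<Longrightarrow> j \<le> y" using fin by (auto simp: j_def)
    then have jab: "a < j" "j < b" using a range[of j] j(2)[OF k(1)] akb by (auto simp: le_less)
    have "orient (v j) (v b) (v y) \<le> 0" if "y \<in> K" for y
    proof -
      have "y = j \<or> y = b \<or> (j < y \<and> y < b)" using j(2)[OF that] range[OF that] by auto
      then show ?thesis
        using convex_polygon_orient[OF poly, of j y b] ab
          orient_perm(4)[of "v j" "v b" "v y"]
        by auto
    qed
    then have "orient (v j) (v b) m \<le> 0" using orient_convex_hull_le[OF mK] by blast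
    moreover have "orient (v j) (v b) (v a) > 0"
      using convex_polygon_orient[OF poly, of a j b] orient_perm(1)[of "v j" "v b" "v a"] jab ab by simp
    ultimately show False by (simp add: mid)
  qed
  moreover have "b \<in> K"
  proof (rule ccontr)
    assume b: "b \<notin> K"
    define j where "j = Max K"
    have j: "j \<in> K" "\<And>y. y \<in> K \<Longrightarrow> y \<le> j" using fin by (auto simp: j_def)
    then have jab: "a < j" "j < b" using b range[of j] j(2)[OF k(1)] akb by (auto simp: le_less)
    have "orient (v a) (v j) (v y) \<le> 0" if "y \<in> K" for y
    proof -
      have "y = j \<or> y = a \<or> (a < y \<and> y < j)" using j(2)[OF that] range[OF that] by auto
      then show ?thesis
        using convex_polygon_orient[OF poly, of a y j] ab jab
          orient_perm(4)[of "v a" "v j" "v y"]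
        by auto
    qed
    then have "orient (v a) (v j) m \<le> 0" using orient_convex_hull_le[OF mK] by blast
    moreover have "orient (v a) (v j) (v b) > 0"
      using convex_polygon_orient[OF poly, of a j b] jab ab by simp
    ultimately show False by (simp add: mid)
  qed
  ultimately have "{a, k, b} \<subseteq> K" using k by auto
  moreover have "card {a, k, b} = 3" using akb by simp
  ultimately have "{a, k, b} = K" using Tsub[OF K(1)] by (metis card_subset_eq)
  then show ?thesis using that akb K(1) by blast
qed

section \<open>The simplex category\<close>

lemma simplex_cat_sel [simp]:
  "Obj \<Delta> = UNIV" "Dom \<Delta> (m, n, f) = m" "Cod \<Delta> (m, n, f) = n"
  "Ident \<Delta> n = (n, n, \<lambda>i \<in> {..n}. i)"
  "Comp \<Delta> (n', p, g) (m, n, f) = (m, p, compose {..m} g f)"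
  by (simp_all add: simplex_cat_def)

lemma Hom_simplex_cat:
  "Hom \<Delta> p n = {(p, n, f) | f. f \<in> {..p} \<rightarrow>\<^sub>E {..n} \<and> mono_on {..p} f}"
  by (auto simp: Hom_def simplex_cat_def)

lemma Arr_simplex_cat: "\<theta> \<in> Arr \<Delta> \<longleftrightarrow> \<theta> \<in> Hom \<Delta> (Dom \<Delta> \<theta>) (Cod \<Delta> \<theta>)"
  by (simp add: Hom_iff)

lemma category_simplex_cat: "category \<Delta>"
proof
  fix f a b assume "f \<in> Hom \<Delta> a b"
  then show "Comp \<Delta> (Ident \<Delta> b) f = f" "Comp \<Delta> f (Ident \<Delta> a) = f"
    by (auto simp: Hom_simplex_cat compose_def fun_eq_iff PiE_def extensional_def Pi_def)
next
  fix f g h a b c d assume "f \<in> Hom \<Delta> a b" "g \<in> Hom \<Delta> b c" "h \<in> Hom \<Delta> c d"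
  then show "Comp \<Delta> (Comp \<Delta> h g) f = Comp \<Delta> h (Comp \<Delta> g f)"
    by (auto simp: Hom_simplex_cat compose_def fun_eq_iff PiE_def Pi_def)
next
  fix f g a b c assume "f \<in> Hom \<Delta> a b" "g \<in> Hom \<Delta> b c"
  then show "Comp \<Delta> g f \<in> Hom \<Delta> a c"
    by (auto simp: Hom_simplex_cat compose_def PiE_def Pi_def mono_on_def)
next
  fix a show "Ident \<Delta> a \<in> Hom \<Delta> a a"
    by (auto simp: Hom_simplex_cat mono_on_def)
qed simp_all

interpretation simplex_cat: category \<Delta>
  by (rule category_simplex_cat)

lemma finite_Hom_simplex_cat: "finite (Hom \<Delta> p n)"
proof -
  have "finite ({..p} \<rightarrow>\<^sub>E {..n})" by (simp add: finite_PiE)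
  moreover have "Hom \<Delta> p n \<subseteq> (\<lambda>f. (p, n, f)) ` ({..p} \<rightarrow>\<^sub>E {..n})"
    by (auto simp: Hom_simplex_cat)
  ultimately show ?thesis by (meson finite_imageI finite_subset)
qed

section \<open>Maps of simplicial objects\<close>

lemma Obj_simp_cat: "X \<in> Obj (simp_cat C) \<longleftrightarrow> is_functor (op_cat \<Delta>) C X \<and> AMap X \<in> extensional (Arr \<Delta>)"
  by (simp add: simp_cat_def fun_cat_def fun_cat_obj_def)

lemma Hom_simp_cat:
  "\<xi> \<in> Hom (simp_cat C) X Y \<longleftrightarrow> NSrc \<xi> = X \<and> NTgt \<xi> = Y
     \<and> X \<in> Obj (simp_cat C) \<and> Y \<in> Obj (simp_cat C)
     \<and> (\<forall>p. NCmp \<xi> p \<in> Hom C (OMap X p) (OMap Y p))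
     \<and> (\<forall>q p. \<forall>\<theta> \<in> Hom \<Delta> q p. Comp C (AMap Y \<theta>) (NCmp \<xi> p) = Comp C (NCmp \<xi> q) (AMap X \<theta>))"
proof -
  have "(\<forall>\<theta> \<in> Arr \<Delta>. Comp C (AMap Y \<theta>) (NCmp \<xi> (Cod \<Delta> \<theta>)) = Comp C (NCmp \<xi> (Dom \<Delta> \<theta>)) (AMap X \<theta>))
      \<longleftrightarrow> (\<forall>q p. \<forall>\<theta> \<in> Hom \<Delta> q p. Comp C (AMap Y \<theta>) (NCmp \<xi> p) = Comp C (NCmp \<xi> q) (AMap X \<theta>))"
    unfolding Ball_def Hom_iff by blast
  then show ?thesis
    by (auto simp: Hom_iff[of \<xi>] simp_cat_def fun_cat_def fun_cat_obj_def is_nat_trans_def)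
qed

lemma simp_cat_sel [simp]: "Dom (simp_cat C) \<xi> = NSrc \<xi>" "Cod (simp_cat C) \<xi> = NTgt \<xi>"
  by (simp_all add: simp_cat_def fun_cat_def)

lemma NCmp_Comp [simp]: "NCmp (Comp (simp_cat C) \<zeta> \<xi>) p = Comp C (NCmp \<zeta> p) (NCmp \<xi> p)"
  by (simp add: simp_cat_def fun_cat_def)

lemma simp_obj_Hom:
  assumes "X \<in> Obj (simp_cat C)" "\<theta> \<in> Hom \<Delta> q p"
  shows "AMap X \<theta> \<in> Hom C (OMap X p) (OMap X q)"
  using assms by (auto simp: Obj_simp_cat is_functor_def Hom_iff)

section \<open>Simplicial objects generated by simplicial sets\<close>

text \<open>Finiteness in each degree makes the coproducts of units small, so that
  \<open>copower\<close> picks an actual coproduct.\<close>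

locale finite_simplicial_set =
  fixes D :: "'x sset"
  assumes Act_Simp: "\<lbrakk>\<theta> \<in> Hom \<Delta> q p; x \<in> Simp D p\<rbrakk> \<Longrightarrow> Act D \<theta> x \<in> Simp D q"
    and Act_Ident: "x \<in> Simp D p \<Longrightarrow> Act D (Ident \<Delta> p) x = x"
    and Act_Comp: "\<lbrakk>\<theta> \<in> Hom \<Delta> q p; \<phi> \<in> Hom \<Delta> r q; x \<in> Simp D p\<rbrakk>
      \<Longrightarrow> Act D (Comp \<Delta> \<theta> \<phi>) x = Act D \<phi> (Act D \<theta> x)"
    and finite_Simp: "finite (Simp D p)"

definition sub_sset :: "'x sset \<Rightarrow> 'x sset \<Rightarrow> bool" where
  "sub_sset D D' \<longleftrightarrow> Act D = Act D' \<and> (\<forall>p. Simp D p \<subseteq> Simp D' p)"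

text \<open>A map from \<open>free_sobj C V D\<close> to \<open>X\<close> amounts to a map \<open>Unit V \<rightarrow> X\<^sub>p\<close> for every \<open>p\<close>-simplex of
  \<open>D\<close>, compatibly with the simplicial structure.\<close>

definition points ::
  "('o, 'm) cat \<Rightarrow> ('o, 'm) monoidal \<Rightarrow> 'x sset \<Rightarrow> ('o, 'm) sobj \<Rightarrow> (nat \<Rightarrow> 'x \<Rightarrow> 'm) set" where
  "points C V D X = {u. \<forall>p. \<forall>x \<in> Simp D p. u p x \<in> Hom C (Unit V) (OMap X p)
     \<and> (\<forall>q. \<forall>\<theta> \<in> Hom \<Delta> q p. Comp C (AMap X \<theta>) (u p x) = u q (Act D \<theta> x))}"

text \<open>The lifting property of the inclusion of free objects against \<open>f\<close>,
  transposed to families of points: a family over \<open>D\<close> with a prescribed image over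
  \<open>D'\<close> extends to \<open>D'\<close>.\<close>

definition points_lift ::
  "('o, 'm) cat \<Rightarrow> ('o, 'm) monoidal \<Rightarrow> 'x sset \<Rightarrow> 'x sset \<Rightarrow> ('o, 'm) smap \<Rightarrow> bool" where
  "points_lift C V D D' f \<longleftrightarrow>
     (\<forall>u \<in> points C V D (NSrc f). \<forall>w \<in> points C V D' (NTgt f).
        (\<forall>p. \<forall>x \<in> Simp D p. Comp C (NCmp f p) (u p x) = w p x) \<longrightarrow>
        (\<exists>h \<in> points C V D' (NSrc f). (\<forall>p. \<forall>x \<in> Simp D p. h p x = u p x)
           \<and> (\<forall>p. \<forall>x \<in> Simp D' p. Comp C (NCmp f p) (h p x) = w p x)))"

abbreviation generator ::
  "('o, 'm) cat \<Rightarrow> ('o, 'm) monoidal \<Rightarrow> 'x sset \<Rightarrow> nat \<Rightarrow> 'x \<Rightarrow> 'm" where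
  "generator C V D p \<equiv> snd (copower C V (Simp D p))"

section \<open>Copowers of the unit and free simplicial objects\<close>

locale copower_category = category C for U :: "'u itself" and C :: "('o, 'm) cat" (structure) +
  fixes V :: "('o, 'm) monoidal"
  assumes universe: "universe U"
    and colimits: "has_small_colimits U C"
    and Unit_Obj: "Unit V \<in> Obj C"
begin

lemma is_coproduct_iff:
  "is_coproduct C A X P \<iota> \<longleftrightarrow> P \<in> Obj C \<and> (\<forall>a \<in> A. \<iota> a \<in> Hom C (X a) P)
     \<and> (\<forall>K \<kappa>. K \<in> Obj C \<and> (\<forall>a \<in> A. \<kappa> a \<in> Hom C (X a) K)
         \<longrightarrow> (\<exists>!h. h \<in> Hom C P K \<and> (\<forall>a \<in> A. h \<cdot> \<iota> a = \<kappa> a)))"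
proof -
  have *: "(\<forall>a \<in> A. \<kappa> a \<in> Hom C (X a) K) \<and> (\<forall>a \<in> A. \<kappa> a \<cdot> Ident C (X a) = \<kappa> a)
      \<longleftrightarrow> (\<forall>a \<in> A. \<kappa> a \<in> Hom C (X a) K)" for K \<kappa>
    using Comp_Ident_right by blast
  show ?thesis
    unfolding is_coproduct_def is_colimit_iff
    by (simp add: discrete_cat_def * flip: conj_assoc)
qed

lemma copower_coproduct:
  assumes "finite A"
  shows "is_coproduct C A (\<lambda>_. Unit V) (fst (copower C V A)) (snd (copower C V A))"
proof -
  have "category (discrete_cat A)" by unfold_locales (auto simp: discrete_cat_def Hom_iff)
  then have "is_functor (discrete_cat A) C \<lparr>OMap = \<lambda>_. Unit V, AMap = \<lambda>_. Ident C (Unit V)\<rparr>"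
    using category_axioms Unit_Obj Ident_Hom[OF Unit_Obj] Comp_Ident_left[OF Ident_Hom[OF Unit_Obj]]
    by (simp add: is_functor_def discrete_cat_def)
  moreover have "small U (Obj (discrete_cat A))" "small U (Arr (discrete_cat A))"
    using finite_small[OF universe assms] by (simp_all add: discrete_cat_def)
  ultimately have "\<exists>P \<iota>. is_coproduct C A (\<lambda>_. Unit V) P \<iota>"
    using small_colimit_exists[OF colimits] unfolding is_coproduct_def by blast
  then have "\<exists>x. case x of (P, \<iota>) \<Rightarrow> is_coproduct C A (\<lambda>_. Unit V) P \<iota>" by auto
  then show ?thesis using someI_ex unfolding copower_def by (metis (lifting) case_prod_beta)
qed

lemma copower_Obj: "finite A \<Longrightarrow> fst (copower C V A) \<in> Obj C"
  using copower_coproduct[of A] by (simp add: is_coproduct_iff)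

lemma copower_Hom: "\<lbrakk>finite A; a \<in> A\<rbrakk> \<Longrightarrow> snd (copower C V A) a \<in> Hom C (Unit V) (fst (copower C V A))"
  using copower_coproduct[of A] by (simp add: is_coproduct_iff)

lemma copower_universal:
  assumes "finite A" "X \<in> Obj C" "\<And>a. a \<in> A \<Longrightarrow> \<kappa> a \<in> Hom C (Unit V) X"
  shows "\<exists>!h. h \<in> Hom C (fst (copower C V A)) X \<and> (\<forall>a \<in> A. h \<cdot> snd (copower C V A) a = \<kappa> a)"
  using copower_coproduct[OF assms(1), unfolded is_coproduct_iff, THEN conjunct2, THEN conjunct2,
      rule_format, of X \<kappa>] assms by simp

lemma copower_ext:
  assumes A: "finite A" and h: "h \<in> Hom C (fst (copower C V A)) X" and k: "k \<in> Hom C (fst (copower C V A)) X"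
    and eq: "\<And>a. a \<in> A \<Longrightarrow> h \<cdot> snd (copower C V A) a = k \<cdot> snd (copower C V A) a"
  shows "h = k"
  using copower_universal[OF A Hom_Obj(2)[OF h], of "\<lambda>a. k \<cdot> snd (copower C V A) a"]
    Comp_Hom[OF copower_Hom[OF A] k] h k eq by blast

lemma copower_map:
  assumes A: "finite A" and B: "finite B" and \<phi>: "\<And>a. a \<in> A \<Longrightarrow> \<phi> a \<in> B"
  shows "copower_map C V A B \<phi> \<in> Hom C (fst (copower C V A)) (fst (copower C V B))"
    and "a \<in> A \<Longrightarrow> copower_map C V A B \<phi> \<cdot> snd (copower C V A) a = snd (copower C V B) (\<phi> a)"
proof -
  have "\<exists>!h. h \<in> Hom C (fst (copower C V A)) (fst (copower C V B))
      \<and> (\<forall>a \<in> A. h \<cdot> snd (copower C V A) a = snd (copower C V B) (\<phi> a))"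
    by (rule copower_universal[OF A copower_Obj[OF B] copower_Hom[OF B \<phi>]])
  from theI'[OF this] show "copower_map C V A B \<phi> \<in> Hom C (fst (copower C V A)) (fst (copower C V B))"
    "a \<in> A \<Longrightarrow> copower_map C V A B \<phi> \<cdot> snd (copower C V A) a = snd (copower C V B) (\<phi> a)"
    by (simp_all add: copower_map_def case_prod_beta)
qed

lemma generator_Hom:
  assumes "finite_simplicial_set D" "x \<in> Simp D p"
  shows "generator C V D p x \<in> Hom C (Unit V) (OMap (free_sobj C V D) p)"
  using copower_Hom[OF finite_simplicial_set.finite_Simp[OF assms(1)] assms(2)]
  by (simp add: free_sobj_def)

lemma free_sobj_AMap:
  assumes D: "finite_simplicial_set D" and \<theta>: "\<theta> \<in> Hom \<Delta> q p"
  shows "AMap (free_sobj C V D) \<theta> \<in> Hom C (OMap (free_sobj C V D) p) (OMap (free_sobj C V D) q)"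
    and "x \<in> Simp D p \<Longrightarrow> AMap (free_sobj C V D) \<theta> \<cdot> generator C V D p x = generator C V D q (Act D \<theta> x)"
proof -
  interpret D: finite_simplicial_set D by (rule D)
  have sel: "\<theta> \<in> Arr \<Delta>" "Dom \<Delta> \<theta> = q" "Cod \<Delta> \<theta> = p" using \<theta> by (simp_all add: Hom_iff)
  note cm = copower_map[OF D.finite_Simp D.finite_Simp D.Act_Simp[OF \<theta>]]
  show "AMap (free_sobj C V D) \<theta> \<in> Hom C (OMap (free_sobj C V D) p) (OMap (free_sobj C V D) q)"
    using cm(1) sel by (simp add: free_sobj_def)
  show "x \<in> Simp D p \<Longrightarrow> AMap (free_sobj C V D) \<theta> \<cdot> generator C V D p x = generator C V D q (Act D \<theta> x)"
    using cm(2) sel by (simp add: free_sobj_def)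
qed

lemma free_sobj_ext:
  assumes D: "finite_simplicial_set D"
    and h: "h \<in> Hom C (OMap (free_sobj C V D) p) X" and k: "k \<in> Hom C (OMap (free_sobj C V D) p) X"
    and eq: "\<And>x. x \<in> Simp D p \<Longrightarrow> h \<cdot> generator C V D p x = k \<cdot> generator C V D p x"
  shows "h = k"
  by (rule copower_ext[OF finite_simplicial_set.finite_Simp[OF D]])
    (use h k eq in \<open>simp_all add: free_sobj_def\<close>)

lemma free_sobj_Obj:
  assumes D: "finite_simplicial_set D"
  shows "free_sobj C V D \<in> Obj (simp_cat C)"
proof -
  interpret D: finite_simplicial_set D by (rule D)
  note gen = generator_Hom[OF D] and AM = free_sobj_AMap[OF D]
  have objs: "OMap (free_sobj C V D) p \<in> Obj C" for p
    using copower_Obj[OF D.finite_Simp] by (simp add: free_sobj_def)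
  have "is_functor (op_cat \<Delta>) C (free_sobj C V D)"
    unfolding is_functor_def
  proof (intro conjI ballI impI)
    show "category (op_cat \<Delta>)" "category C"
      by (rule simplex_cat.category_op, rule category_axioms)
    show "OMap (free_sobj C V D) a \<in> Obj C" for a by (rule objs)
    show "AMap (free_sobj C V D) f \<in> Hom C (OMap (free_sobj C V D) (Dom (op_cat \<Delta>) f))
        (OMap (free_sobj C V D) (Cod (op_cat \<Delta>) f))" if "f \<in> Arr (op_cat \<Delta>)" for f
      using AM(1)[of f] that by (simp add: Arr_simplex_cat)
    show "AMap (free_sobj C V D) (Ident (op_cat \<Delta>) a) = Ident C (OMap (free_sobj C V D) a)" for a
    proof (rule free_sobj_ext[OF D])
      have I: "Ident \<Delta> a \<in> Hom \<Delta> a a" using simplex_cat.Ident_Hom[of a] by simp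
      then show "AMap (free_sobj C V D) (Ident (op_cat \<Delta>) a)
          \<in> Hom C (OMap (free_sobj C V D) a) (OMap (free_sobj C V D) a)"
        using AM(1)[OF I] by simp
      show "Ident C (OMap (free_sobj C V D) a) \<in> Hom C (OMap (free_sobj C V D) a) (OMap (free_sobj C V D) a)"
        by (rule Ident_Hom[OF objs])
      fix x assume "x \<in> Simp D a"
      then show "AMap (free_sobj C V D) (Ident (op_cat \<Delta>) a) \<cdot> generator C V D a x
          = Ident C (OMap (free_sobj C V D) a) \<cdot> generator C V D a x"
        using AM(2)[OF I] D.Act_Ident Comp_Ident_left[OF gen] by simp
    qed
    fix f g assume "f \<in> Arr (op_cat \<Delta>)" "g \<in> Arr (op_cat \<Delta>)" "Cod (op_cat \<Delta>) f = Dom (op_cat \<Delta>) g"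
    then obtain a b c where f: "f \<in> Hom \<Delta> b a" and g: "g \<in> Hom \<Delta> c b"
      by (simp add: Hom_iff)
    show "AMap (free_sobj C V D) (Comp (op_cat \<Delta>) g f) = AMap (free_sobj C V D) g \<cdot> AMap (free_sobj C V D) f"
    proof (rule free_sobj_ext[OF D])
      have fg: "Comp \<Delta> f g \<in> Hom \<Delta> c a" by (rule simplex_cat.Comp_Hom[OF g f])
      show "AMap (free_sobj C V D) (Comp (op_cat \<Delta>) g f)
          \<in> Hom C (OMap (free_sobj C V D) a) (OMap (free_sobj C V D) c)"
        using AM(1)[OF fg] by simp
      show "AMap (free_sobj C V D) g \<cdot> AMap (free_sobj C V D) f
          \<in> Hom C (OMap (free_sobj C V D) a) (OMap (free_sobj C V D) c)"
        by (rule Comp_Hom[OF AM(1)[OF f] AM(1)[OF g]])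
      fix x assume x: "x \<in> Simp D a"
      show "AMap (free_sobj C V D) (Comp (op_cat \<Delta>) g f) \<cdot> generator C V D a x
          = (AMap (free_sobj C V D) g \<cdot> AMap (free_sobj C V D) f) \<cdot> generator C V D a x"
        using AM(2)[OF fg x] AM(2)[OF f x] AM(2)[OF g D.Act_Simp[OF f x]] D.Act_Comp[OF f g x]
          Comp_assoc[OF gen[OF x] AM(1)[OF f] AM(1)[OF g]] by simp
    qed
  qed
  then show ?thesis by (simp add: Obj_simp_cat) (simp add: free_sobj_def)
qed

lemma free_Hom_ext:
  assumes D: "finite_simplicial_set D"
    and \<xi>: "\<xi> \<in> Hom (simp_cat C) (free_sobj C V D) X" and \<zeta>: "\<zeta> \<in> Hom (simp_cat C) (free_sobj C V D) X"
    and eq: "\<And>p x. x \<in> Simp D p \<Longrightarrow> NCmp \<xi> p \<cdot> generator C V D p x = NCmp \<zeta> p \<cdot> generator C V D p x"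
  shows "\<xi> = \<zeta>"
proof -
  have "NCmp \<xi> p \<in> Hom C (OMap (free_sobj C V D) p) (OMap X p)"
    "NCmp \<zeta> p \<in> Hom C (OMap (free_sobj C V D) p) (OMap X p)" for p
    using \<xi> \<zeta> by (simp_all add: Hom_simp_cat)
  then have "NCmp \<xi> p = NCmp \<zeta> p" for p
    by (rule free_sobj_ext[OF D _ _ eq])
  then have "NCmp \<xi> = NCmp \<zeta>" by (rule ext)
  then show ?thesis using \<xi> \<zeta> by (simp add: Hom_simp_cat)
qed

lemma points_of_Hom:
  assumes D: "finite_simplicial_set D" and \<xi>: "\<xi> \<in> Hom (simp_cat C) (free_sobj C V D) X"
  shows "(\<lambda>p x. NCmp \<xi> p \<cdot> generator C V D p x) \<in> points C V D X"
  unfolding points_def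
proof (intro CollectI allI ballI conjI)
  note gen = generator_Hom[OF D] and AM = free_sobj_AMap[OF D]
  fix p x assume x: "x \<in> Simp D p"
  have \<xi>p: "NCmp \<xi> p \<in> Hom C (OMap (free_sobj C V D) p) (OMap X p)" for p
    using \<xi> by (simp add: Hom_simp_cat)
  have X: "X \<in> Obj (simp_cat C)" using \<xi> by (simp add: Hom_simp_cat)
  show "NCmp \<xi> p \<cdot> generator C V D p x \<in> Hom C (Unit V) (OMap X p)"
    by (rule Comp_Hom[OF gen[OF x] \<xi>p])
  fix q \<theta> assume \<theta>: "\<theta> \<in> Hom \<Delta> q p"
  have "AMap X \<theta> \<cdot> NCmp \<xi> p = NCmp \<xi> q \<cdot> AMap (free_sobj C V D) \<theta>"
    using \<xi> \<theta> by (auto simp: Hom_simp_cat)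
  then show "AMap X \<theta> \<cdot> (NCmp \<xi> p \<cdot> generator C V D p x) = NCmp \<xi> q \<cdot> generator C V D q (Act D \<theta> x)"
    using Comp_assoc[OF gen[OF x] \<xi>p simp_obj_Hom[OF X \<theta>]] Comp_assoc[OF gen[OF x] AM(1)[OF \<theta>] \<xi>p]
      AM(2)[OF \<theta> x] by simp
qed

text \<open>Each degree is induced from the coproduct; naturality is checked on the generators,
  where it is the compatibility of the family \<open>u\<close>.\<close>

lemma Hom_of_points:
  assumes D: "finite_simplicial_set D" and X: "X \<in> Obj (simp_cat C)" and u: "u \<in> points C V D X"
  obtains \<xi> where "\<xi> \<in> Hom (simp_cat C) (free_sobj C V D) X"
    "\<And>p x. x \<in> Simp D p \<Longrightarrow> NCmp \<xi> p \<cdot> generator C V D p x = u p x"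
proof -
  interpret D: finite_simplicial_set D by (rule D)
  note gen = generator_Hom[OF D] and AM = free_sobj_AMap[OF D]
  have uH: "u p x \<in> Hom C (Unit V) (OMap X p)" if "x \<in> Simp D p" for p x
    using u that by (simp add: points_def)
  have "OMap X p \<in> Obj C" for p using X by (simp add: Obj_simp_cat is_functor_def)
  then have "\<exists>h. h \<in> Hom C (OMap (free_sobj C V D) p) (OMap X p)
      \<and> (\<forall>x \<in> Simp D p. h \<cdot> generator C V D p x = u p x)" for p
    using copower_universal[OF D.finite_Simp, of "OMap X p" p "u p"] uH by (auto simp: free_sobj_def)
  then obtain k where k: "\<And>p. k p \<in> Hom C (OMap (free_sobj C V D) p) (OMap X p)"
      "\<And>p x. x \<in> Simp D p \<Longrightarrow> k p \<cdot> generator C V D p x = u p x"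
    by metis
  have "AMap X \<theta> \<cdot> k p = k q \<cdot> AMap (free_sobj C V D) \<theta>" if \<theta>: "\<theta> \<in> Hom \<Delta> q p" for q p \<theta>
  proof (rule free_sobj_ext[OF D])
    show "AMap X \<theta> \<cdot> k p \<in> Hom C (OMap (free_sobj C V D) p) (OMap X q)"
      by (rule Comp_Hom[OF k(1) simp_obj_Hom[OF X \<theta>]])
    show "k q \<cdot> AMap (free_sobj C V D) \<theta> \<in> Hom C (OMap (free_sobj C V D) p) (OMap X q)"
      by (rule Comp_Hom[OF AM(1)[OF \<theta>] k(1)])
    fix x assume x: "x \<in> Simp D p"
    have "AMap X \<theta> \<cdot> u p x = u q (Act D \<theta> x)" using u x \<theta> by (auto simp: points_def)
    then show "(AMap X \<theta> \<cdot> k p) \<cdot> generator C V D p x = (k q \<cdot> AMap (free_sobj C V D) \<theta>) \<cdot> generator C V D p x"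
      using Comp_assoc[OF gen[OF x] k(1) simp_obj_Hom[OF X \<theta>]] Comp_assoc[OF gen[OF x] AM(1)[OF \<theta>] k(1)]
        AM(2)[OF \<theta> x] k(2)[OF x] k(2)[OF D.Act_Simp[OF \<theta> x]] by simp
  qed
  then have "\<lparr>NSrc = free_sobj C V D, NTgt = X, NCmp = k\<rparr> \<in> Hom (simp_cat C) (free_sobj C V D) X"
    using free_sobj_Obj[OF D] X k(1) by (simp add: Hom_simp_cat)
  then show ?thesis using that k(2) by force
qed

lemma free_incl_generator:
  assumes D: "finite_simplicial_set D" and D': "finite_simplicial_set D'" and s: "sub_sset D D'"
    and x: "x \<in> Simp D p"
  shows "NCmp (free_incl C V D D') p \<cdot> generator C V D p x = generator C V D' p x"
  using copower_map(2)[of "Simp D p" "Simp D' p" "\<lambda>x. x"] s x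
  by (auto simp: free_incl_def sub_sset_def finite_simplicial_set.finite_Simp[OF D]
      finite_simplicial_set.finite_Simp[OF D'])

lemma free_incl_Hom:
  assumes D: "finite_simplicial_set D" and D': "finite_simplicial_set D'" and s: "sub_sset D D'"
  shows "free_incl C V D D' \<in> Hom (simp_cat C) (free_sobj C V D) (free_sobj C V D')"
proof -
  interpret D: finite_simplicial_set D by (rule D)
  interpret D': finite_simplicial_set D' by (rule D')
  note gen = generator_Hom[OF D] and AM = free_sobj_AMap[OF D] and AM' = free_sobj_AMap[OF D']
    and eq = free_incl_generator[OF D D' s]
  have sub: "x \<in> Simp D' p" if "x \<in> Simp D p" for x p using s that by (auto simp: sub_sset_def)
  have k: "NCmp (free_incl C V D D') p \<in> Hom C (OMap (free_sobj C V D) p) (OMap (free_sobj C V D') p)" for p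
    using copower_map(1)[OF D.finite_Simp D'.finite_Simp sub] by (simp add: free_incl_def free_sobj_def)
  have "AMap (free_sobj C V D') \<theta> \<cdot> NCmp (free_incl C V D D') p
      = NCmp (free_incl C V D D') q \<cdot> AMap (free_sobj C V D) \<theta>" if \<theta>: "\<theta> \<in> Hom \<Delta> q p" for q p \<theta>
  proof (rule free_sobj_ext[OF D])
    show "AMap (free_sobj C V D') \<theta> \<cdot> NCmp (free_incl C V D D') p
        \<in> Hom C (OMap (free_sobj C V D) p) (OMap (free_sobj C V D') q)"
      by (rule Comp_Hom[OF k AM'(1)[OF \<theta>]])
    show "NCmp (free_incl C V D D') q \<cdot> AMap (free_sobj C V D) \<theta>
        \<in> Hom C (OMap (free_sobj C V D) p) (OMap (free_sobj C V D') q)"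
      by (rule Comp_Hom[OF AM(1)[OF \<theta>] k])
    fix x assume x: "x \<in> Simp D p"
    have "Act D \<theta> x = Act D' \<theta> x" using s by (simp add: sub_sset_def)
    then show "(AMap (free_sobj C V D') \<theta> \<cdot> NCmp (free_incl C V D D') p) \<cdot> generator C V D p x
        = (NCmp (free_incl C V D D') q \<cdot> AMap (free_sobj C V D) \<theta>) \<cdot> generator C V D p x"
      using Comp_assoc[OF gen[OF x] k AM'(1)[OF \<theta>]] Comp_assoc[OF gen[OF x] AM(1)[OF \<theta>] k]
        AM(2)[OF \<theta> x] AM'(2)[OF \<theta> sub[OF x]] eq[OF x] eq[OF D.Act_Simp[OF \<theta> x]] by simp
  qed
  then show ?thesis
    using free_sobj_Obj[OF D] free_sobj_Obj[OF D'] k by (simp add: Hom_simp_cat) (simp add: free_incl_def)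
qed

lemma free_incl_Comp:
  assumes cat: "category (simp_cat C)"
    and D: "finite_simplicial_set D" and D': "finite_simplicial_set D'" and D'': "finite_simplicial_set D''"
    and s: "sub_sset D D'" and s': "sub_sset D' D''"
  shows "Comp (simp_cat C) (free_incl C V D' D'') (free_incl C V D D') = free_incl C V D D''"
proof -
  interpret S: category "simp_cat C" by (rule cat)
  have s'': "sub_sset D D''" using s s' unfolding sub_sset_def by fastforce
  note i = free_incl_Hom[OF D D' s] and j = free_incl_Hom[OF D' D'' s']
  show ?thesis
  proof (rule free_Hom_ext[OF D S.Comp_Hom[OF i j] free_incl_Hom[OF D D'' s'']])
    fix p x assume x: "x \<in> Simp D p"
    have x': "x \<in> Simp D' p" using s x by (auto simp: sub_sset_def)
    have "NCmp (free_incl C V D D') p \<in> Hom C (OMap (free_sobj C V D) p) (OMap (free_sobj C V D') p)"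
      "NCmp (free_incl C V D' D'') p \<in> Hom C (OMap (free_sobj C V D') p) (OMap (free_sobj C V D'') p)"
      using i j by (simp_all add: Hom_simp_cat)
    from Comp_assoc[OF generator_Hom[OF D x] this]
    show "NCmp (Comp (simp_cat C) (free_incl C V D' D'') (free_incl C V D D')) p \<cdot> generator C V D p x
        = NCmp (free_incl C V D D'') p \<cdot> generator C V D p x"
      by (simp add: free_incl_generator[OF D D' s x] free_incl_generator[OF D' D'' s' x']
          free_incl_generator[OF D D'' s'' x])
  qed
qed

text \<open>Maps out of free objects are determined by their values on generators, so squares and
  lifts translate into families. Both directions are needed: one to exploit the generator for n = 2,
  the other to conclude for the inclusion of a spine into a triangulation.\<close>

lemma has_lift_free_incl_iff:
  assumes cat: "category (simp_cat C)"
    and D: "finite_simplicial_set D" and D': "finite_simplicial_set D'" and s: "sub_sset D D'"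
    and f: "f \<in> Arr (simp_cat C)"
  shows "has_lift (simp_cat C) (free_incl C V D D') f \<longleftrightarrow> points_lift C V D D' f"
proof -
  interpret S: category "simp_cat C" by (rule cat)
  define X Y where "X = NSrc f" and "Y = NTgt f"
  have fH: "f \<in> Hom (simp_cat C) X Y" using f by (simp add: Hom_iff X_def Y_def)
  then have X: "X \<in> Obj (simp_cat C)" and Y: "Y \<in> Obj (simp_cat C)"
    and fp: "\<And>p. NCmp f p \<in> Hom C (OMap X p) (OMap Y p)"
    by (simp_all add: Hom_simp_cat)
  note i = free_incl_Hom[OF D D' s]
  have ip: "NCmp (free_incl C V D D') p \<in> Hom C (OMap (free_sobj C V D) p) (OMap (free_sobj C V D') p)" for p
    using i by (simp add: Hom_simp_cat)
  note ig = free_incl_generator[OF D D' s]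
  have NH: "NCmp \<xi> p \<in> Hom C (OMap A p) (OMap B p)" if "\<xi> \<in> Hom (simp_cat C) A B" for \<xi> A B p
    using that by (simp add: Hom_simp_cat)
  have sub: "x \<in> Simp D' p" if "x \<in> Simp D p" for x p using s that by (auto simp: sub_sset_def)
  have incl: "NCmp (Comp (simp_cat C) \<zeta> (free_incl C V D D')) p \<cdot> generator C V D p x
      = NCmp \<zeta> p \<cdot> generator C V D' p x"
    if "\<zeta> \<in> Hom (simp_cat C) (free_sobj C V D') Z" "x \<in> Simp D p" for \<zeta> Z p x
    using Comp_assoc[OF generator_Hom[OF D that(2)] ip NH[OF that(1)]] ig[OF that(2)] by simp
  have post: "NCmp (Comp (simp_cat C) f \<xi>) p \<cdot> generator C V E p x = NCmp f p \<cdot> (NCmp \<xi> p \<cdot> generator C V E p x)"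
    if "finite_simplicial_set E" "\<xi> \<in> Hom (simp_cat C) (free_sobj C V E) X" "x \<in> Simp E p" for E \<xi> p x
    using Comp_assoc[OF generator_Hom[OF that(1,3)] NH[OF that(2)] fp] by simp
  show ?thesis
  proof
    assume lift: "has_lift (simp_cat C) (free_incl C V D D') f"
    show "points_lift C V D D' f"
      unfolding points_lift_def X_def[symmetric] Y_def[symmetric]
    proof (intro ballI impI)
      fix u w assume u: "u \<in> points C V D X" and w: "w \<in> points C V D' Y"
        and uw: "\<forall>p. \<forall>x \<in> Simp D p. NCmp f p \<cdot> u p x = w p x"
      obtain \<xi> where \<xi>: "\<xi> \<in> Hom (simp_cat C) (free_sobj C V D) X"
          "\<And>p x. x \<in> Simp D p \<Longrightarrow> NCmp \<xi> p \<cdot> generator C V D p x = u p x"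
        using Hom_of_points[OF D X u] by blast
      obtain \<zeta> where \<zeta>: "\<zeta> \<in> Hom (simp_cat C) (free_sobj C V D') Y"
          "\<And>p x. x \<in> Simp D' p \<Longrightarrow> NCmp \<zeta> p \<cdot> generator C V D' p x = w p x"
        using Hom_of_points[OF D' Y w] by blast
      have "Comp (simp_cat C) f \<xi> = Comp (simp_cat C) \<zeta> (free_incl C V D D')"
        by (rule free_Hom_ext[OF D S.Comp_Hom[OF \<xi>(1) fH] S.Comp_Hom[OF i \<zeta>(1)]])
          (simp only: post[OF D \<xi>(1)] incl[OF \<zeta>(1)] \<xi>(2) \<zeta>(2) sub uw)
      then obtain h where h: "h \<in> Hom (simp_cat C) (free_sobj C V D') X"
          "Comp (simp_cat C) h (free_incl C V D D') = \<xi>" "Comp (simp_cat C) f h = \<zeta>"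
        using has_liftD[OF lift i fH \<xi>(1) \<zeta>(1)] by blast
      show "\<exists>h \<in> points C V D' X. (\<forall>p. \<forall>x \<in> Simp D p. h p x = u p x)
          \<and> (\<forall>p. \<forall>x \<in> Simp D' p. NCmp f p \<cdot> h p x = w p x)"
      proof (intro bexI conjI allI ballI)
        show "(\<lambda>p x. NCmp h p \<cdot> generator C V D' p x) \<in> points C V D' X"
          by (rule points_of_Hom[OF D' h(1)])
        show "NCmp h p \<cdot> generator C V D' p x = u p x" if "x \<in> Simp D p" for p x
          using incl[OF h(1) that] \<xi>(2)[OF that] by (simp only: h(2))
        show "NCmp f p \<cdot> NCmp h p \<cdot> generator C V D' p x = w p x" if "x \<in> Simp D' p" for p x
          using post[OF D' h(1) that] \<zeta>(2)[OF that] by (simp only: h(3))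
      qed
    qed
  next
    assume lift: "points_lift C V D D' f"
    show "has_lift (simp_cat C) (free_incl C V D D') f"
    proof (rule has_liftI[OF i fH])
      fix \<xi> \<zeta> assume \<xi>: "\<xi> \<in> Hom (simp_cat C) (free_sobj C V D) X"
        and \<zeta>: "\<zeta> \<in> Hom (simp_cat C) (free_sobj C V D') Y"
        and sq: "Comp (simp_cat C) f \<xi> = Comp (simp_cat C) \<zeta> (free_incl C V D D')"
      have c: "NCmp f p \<cdot> (NCmp \<xi> p \<cdot> generator C V D p x) = NCmp \<zeta> p \<cdot> generator C V D' p x"
        if "x \<in> Simp D p" for p x
        using post[OF D \<xi> that] incl[OF \<zeta> that] by (simp only: sq)
      obtain w where w: "w \<in> points C V D' X"
          "\<And>p x. x \<in> Simp D p \<Longrightarrow> w p x = NCmp \<xi> p \<cdot> generator C V D p x"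
          "\<And>p x. x \<in> Simp D' p \<Longrightarrow> NCmp f p \<cdot> w p x = NCmp \<zeta> p \<cdot> generator C V D' p x"
        using lift[unfolded points_lift_def X_def[symmetric] Y_def[symmetric], rule_format,
            OF points_of_Hom[OF D \<xi>] points_of_Hom[OF D' \<zeta>] c] by blast
      obtain h where h: "h \<in> Hom (simp_cat C) (free_sobj C V D') X"
          "\<And>p x. x \<in> Simp D' p \<Longrightarrow> NCmp h p \<cdot> generator C V D' p x = w p x"
        using Hom_of_points[OF D' X w(1)] by blast
      have "Comp (simp_cat C) h (free_incl C V D D') = \<xi>"
        by (rule free_Hom_ext[OF D S.Comp_Hom[OF i h(1)] \<xi>])
          (simp only: incl[OF h(1)] h(2) sub w(2))
      moreover have "Comp (simp_cat C) f h = \<zeta>"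
        by (rule free_Hom_ext[OF D' S.Comp_Hom[OF h(1) fH] \<zeta>])
          (simp only: post[OF D' h(1)] h(2) w(3))
      ultimately show "\<exists>h \<in> Hom (simp_cat C) (free_sobj C V D') X.
          Comp (simp_cat C) h (free_incl C V D D') = \<xi> \<and> Comp (simp_cat C) f h = \<zeta>"
        using h(1) by blast
    qed
  qed
qed

end

section \<open>Lifting against inclusions of simplicial sets\<close>

lemma points_sub:
  assumes "sub_sset D D'" "u \<in> points C V D' X"
  shows "u \<in> points C V D X"
proof -
  have sub: "x \<in> Simp D' p" if "x \<in> Simp D p" for p x
    using assms(1) that by (auto simp: sub_sset_def)
  show ?thesis
    using assms sub unfolding points_def sub_sset_def by auto
qed

lemma points_lift_refl:
  assumes "Act D = Act D'" "\<And>p. Simp D p = Simp D' p"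
  shows "points_lift C V D D' f"
proof -
  have "points C V D X = points C V D' X" for X
    using assms by (simp add: points_def)
  then show ?thesis using assms unfolding points_lift_def by auto
qed

lemma points_lift_trans:
  assumes s: "sub_sset D D'" "sub_sset D' D''"
    and l: "points_lift C V D D' f" "points_lift C V D' D'' f"
  shows "points_lift C V D D'' f"
  unfolding points_lift_def
proof (intro ballI impI)
  have sub: "x \<in> Simp D' p" if "x \<in> Simp D p" for p x
    using s(1) that by (auto simp: sub_sset_def)
  fix u w assume u: "u \<in> points C V D (NSrc f)" and w: "w \<in> points C V D'' (NTgt f)"
    and uw: "\<forall>p. \<forall>x \<in> Simp D p. Comp C (NCmp f p) (u p x) = w p x"
  obtain h where h: "h \<in> points C V D' (NSrc f)" "\<forall>p. \<forall>x \<in> Simp D p. h p x = u p x"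
      "\<forall>p. \<forall>x \<in> Simp D' p. Comp C (NCmp f p) (h p x) = w p x"
    using l(1)[unfolded points_lift_def, rule_format, OF u points_sub[OF s(2) w]] uw by metis
  obtain k where k: "k \<in> points C V D'' (NSrc f)" "\<forall>p. \<forall>x \<in> Simp D' p. k p x = h p x"
      "\<forall>p. \<forall>x \<in> Simp D'' p. Comp C (NCmp f p) (k p x) = w p x"
    using l(2)[unfolded points_lift_def, rule_format, OF h(1) w] h(3) by metis
  show "\<exists>k \<in> points C V D'' (NSrc f). (\<forall>p. \<forall>x \<in> Simp D p. k p x = u p x)
      \<and> (\<forall>p. \<forall>x \<in> Simp D'' p. Comp C (NCmp f p) (k p x) = w p x)"
    using h(2) k sub by (intro bexI[of _ k]) auto
qed

text \<open>\<open>D3\<close> is the union of \<open>D1\<close> and \<open>D2\<close> with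
  intersection \<open>D0\<close>, hence their pushout. The extension keeps \<open>u\<close> on
  \<open>D1\<close> and uses the lift on \<open>D2\<close>.\<close>

lemma points_lift_pushout:
  assumes D1: "finite_simplicial_set D1" and D2: "finite_simplicial_set D2"
    and act: "Act D0 = Act D3" "Act D1 = Act D3" "Act D2 = Act D3"
    and int: "\<And>p. Simp D0 p = Simp D1 p \<inter> Simp D2 p"
    and un: "\<And>p. Simp D3 p = Simp D1 p \<union> Simp D2 p"
    and lift: "points_lift C V D0 D2 f"
  shows "points_lift C V D1 D3 f"
  unfolding points_lift_def
proof (intro ballI impI)
  fix u w assume u: "u \<in> points C V D1 (NSrc f)" and w: "w \<in> points C V D3 (NTgt f)"
    and uw: "\<forall>p. \<forall>x \<in> Simp D1 p. Comp C (NCmp f p) (u p x) = w p x"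
  have "u \<in> points C V D0 (NSrc f)" "w \<in> points C V D2 (NTgt f)"
    using points_sub[OF _ u, of D0] points_sub[OF _ w, of D2] by (auto simp: sub_sset_def act int un)
  then obtain h where h: "h \<in> points C V D2 (NSrc f)" "\<forall>p. \<forall>x \<in> Simp D0 p. h p x = u p x"
      "\<forall>p. \<forall>x \<in> Simp D2 p. Comp C (NCmp f p) (h p x) = w p x"
    using lift[unfolded points_lift_def, rule_format, of u w] uw by (metis Int_iff int)
  define k where "k = (\<lambda>p x. if x \<in> Simp D1 p then u p x else h p x)"
  \<comment> \<open>The lift restricts to \<open>u\<close> on the intersection, so the choice of
    case there does not matter.\<close>
  have k2: "k p x = h p x" if "x \<in> Simp D2 p" for p x
    using that h(2) int by (auto simp: k_def)
  have A1: "Act D3 \<theta> x \<in> Simp D1 q" if "\<theta> \<in> Hom \<Delta> q p" "x \<in> Simp D1 p" for \<theta> q p x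
    using finite_simplicial_set.Act_Simp[OF D1 that] by (simp add: act)
  have A2: "Act D3 \<theta> x \<in> Simp D2 q" if "\<theta> \<in> Hom \<Delta> q p" "x \<in> Simp D2 p" for \<theta> q p x
    using finite_simplicial_set.Act_Simp[OF D2 that] by (simp add: act)
  have "k \<in> points C V D3 (NSrc f)"
    unfolding points_def
  proof (intro CollectI allI ballI conjI)
    fix p x assume "x \<in> Simp D3 p"
    then consider "x \<in> Simp D1 p" | "x \<in> Simp D2 p" by (auto simp: un)
    then have "k p x \<in> Hom C (Unit V) (OMap (NSrc f) p)
        \<and> (\<forall>q. \<forall>\<theta> \<in> Hom \<Delta> q p. Comp C (AMap (NSrc f) \<theta>) (k p x) = k q (Act D3 \<theta> x))"
    proof cases
      case 1
      then show ?thesis using u A1 by (auto simp: points_def k_def act)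
    next
      case 2
      then show ?thesis using h(1) A2 by (auto simp: points_def k2 act)
    qed
    then show "k p x \<in> Hom C (Unit V) (OMap (NSrc f) p)"
      "\<And>q \<theta>. \<theta> \<in> Hom \<Delta> q p \<Longrightarrow> Comp C (AMap (NSrc f) \<theta>) (k p x) = k q (Act D3 \<theta> x)"
      by blast+
  qed
  moreover have "Comp C (NCmp f p) (k p x) = w p x" if "x \<in> Simp D3 p" for p x
    using that uw h(3) by (auto simp: un k_def)
  ultimately show "\<exists>k \<in> points C V D3 (NSrc f). (\<forall>p. \<forall>x \<in> Simp D1 p. k p x = u p x)
      \<and> (\<forall>p. \<forall>x \<in> Simp D3 p. Comp C (NCmp f p) (k p x) = w p x)"
    by (intro bexI[of _ k]) (auto simp: k_def)
qed

text \<open>Transport along an isomorphism \<open>g\<close> from \<open>D'\<close> to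
  \<open>E'\<close> that carries \<open>D\<close> onto \<open>E\<close>; it moves lifting from the
  standard triangle to a triangle inside a larger simplex.\<close>

lemma points_lift_iso:
  assumes D': "finite_simplicial_set D'"
    and s: "sub_sset D D'" and t: "sub_sset E E'"
    and bij: "\<And>p. bij_betw (g p) (Simp D' p) (Simp E' p)"
    and mem: "\<And>p x. x \<in> Simp D' p \<Longrightarrow> g p x \<in> Simp E p \<longleftrightarrow> x \<in> Simp D p"
    and act: "\<And>q p \<theta> x. \<lbrakk>\<theta> \<in> Hom \<Delta> q p; x \<in> Simp D' p\<rbrakk> \<Longrightarrow> g q (Act D' \<theta> x) = Act E' \<theta> (g p x)"
    and lift: "points_lift C V D D' f"
  shows "points_lift C V E E' f"
  unfolding points_lift_def
proof (intro ballI impI)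
  interpret D': finite_simplicial_set D' by (rule D')
  have subD: "x \<in> Simp D' p" if "x \<in> Simp D p" for p x using s that by (auto simp: sub_sset_def)
  have subE: "x \<in> Simp E' p" if "x \<in> Simp E p" for p x using t that by (auto simp: sub_sset_def)
  have actD: "Act D = Act D'" and actE: "Act E = Act E'" using s t by (auto simp: sub_sset_def)
  have gE': "g p x \<in> Simp E' p" if "x \<in> Simp D' p" for p x using bij that by (auto simp: bij_betw_def)
  define g' where "g' = (\<lambda>p. inv_into (Simp D' p) (g p))"
  have g'D': "g' p y \<in> Simp D' p" and gg': "g p (g' p y) = y" if "y \<in> Simp E' p" for p y
    using bij that by (auto simp: g'_def bij_betw_def inv_into_into f_inv_into_f)
  have g'g: "g' p (g p x) = x" if "x \<in> Simp D' p" for p x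
    using bij that by (auto simp: g'_def bij_betw_def)
  have act': "g' q (Act E' \<theta> y) = Act D' \<theta> (g' p y)" if "\<theta> \<in> Hom \<Delta> q p" "y \<in> Simp E' p" for q p \<theta> y
    using act[OF that(1) g'D'[OF that(2)]] g'g[OF D'.Act_Simp[OF that(1) g'D'[OF that(2)]]] gg'[OF that(2)]
    by simp
  fix u w assume u: "u \<in> points C V E (NSrc f)" and w: "w \<in> points C V E' (NTgt f)"
    and uw: "\<forall>p. \<forall>x \<in> Simp E p. Comp C (NCmp f p) (u p x) = w p x"
  have "(\<lambda>p x. u p (g p x)) \<in> points C V D (NSrc f)"
    using u act mem subD unfolding points_def by (fastforce simp: actD actE)
  moreover have "(\<lambda>p x. w p (g p x)) \<in> points C V D' (NTgt f)"
    using w act gE' unfolding points_def by fastforce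
  ultimately obtain h where h: "h \<in> points C V D' (NSrc f)" "\<forall>p. \<forall>x \<in> Simp D p. h p x = u p (g p x)"
      "\<forall>p. \<forall>x \<in> Simp D' p. Comp C (NCmp f p) (h p x) = w p (g p x)"
    using lift[unfolded points_lift_def, rule_format, of "\<lambda>p x. u p (g p x)" "\<lambda>p x. w p (g p x)"]
      uw mem subD by blast
  have "(\<lambda>p y. h p (g' p y)) \<in> points C V E' (NSrc f)"
    using h(1) act' g'D' unfolding points_def by fastforce
  moreover have "h p (g' p y) = u p y" if "y \<in> Simp E p" for p y
    using h(2) mem[OF g'D'[OF subE[OF that]]] gg'[OF subE[OF that]] that by simp
  moreover have "Comp C (NCmp f p) (h p (g' p y)) = w p y" if "y \<in> Simp E' p" for p y
    using h(3) g'D'[OF that] gg'[OF that] by simp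
  ultimately show "\<exists>k \<in> points C V E' (NSrc f). (\<forall>p. \<forall>x \<in> Simp E p. k p x = u p x)
      \<and> (\<forall>p. \<forall>x \<in> Simp E' p. Comp C (NCmp f p) (k p x) = w p x)"
    by (intro bexI[of _ "\<lambda>p y. h p (g' p y)"]) auto
qed

section \<open>Triangulations as iterated gluings of triangles\<close>

text \<open>A simplex lies in a union of faces iff its vertex set lies in one of them, so relations
  between such unions reduce to statements about finite sets of vertices.\<close>

abbreviation in_face :: "nat set set \<Rightarrow> nat set \<Rightarrow> bool" where
  "in_face \<J> S \<equiv> \<exists>J \<in> \<J>. S \<subseteq> J"

abbreviation vertices :: "nat \<Rightarrow> ordmap \<Rightarrow> nat set" where
  "vertices p x \<equiv> snd (snd x) ` {..p}"

lemma Simp_face_union: "x \<in> Simp (face_union n \<J>) p \<longleftrightarrow> x \<in> Hom \<Delta> p n \<and> in_face \<J> (vertices p x)"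
  by (simp add: face_union_def)

lemma Act_face_union: "Act (face_union n \<J>) = (\<lambda>\<theta> x. Comp \<Delta> x \<theta>)"
  by (simp add: face_union_def)

lemma finite_simplicial_set_face_union: "finite_simplicial_set (face_union n \<J>)"
proof
  fix \<theta> q p x assume \<theta>: "\<theta> \<in> Hom \<Delta> q p" and x: "x \<in> Simp (face_union n \<J>) p"
  have "Comp \<Delta> x \<theta> \<in> Hom \<Delta> q n"
    using simplex_cat.Comp_Hom[OF \<theta>] x by (simp add: Simp_face_union)
  moreover have "vertices q (Comp \<Delta> x \<theta>) \<subseteq> vertices p x"
    using \<theta> x by (auto simp: Simp_face_union Hom_simplex_cat compose_def)
  ultimately show "Act (face_union n \<J>) \<theta> x \<in> Simp (face_union n \<J>) q"
    using x unfolding Simp_face_union Act_face_union by blast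
next
  fix x p assume "x \<in> Simp (face_union n \<J>) p"
  then show "Act (face_union n \<J>) (Ident \<Delta> p) x = x"
    using simplex_cat.Comp_Ident_right[of x p n] by (simp add: Simp_face_union Act_face_union del: simplex_cat_sel)
next
  fix \<theta> q p \<phi> r x
  assume H: "\<theta> \<in> Hom \<Delta> q p" "\<phi> \<in> Hom \<Delta> r q" and x: "x \<in> Simp (face_union n \<J>) p"
  show "Act (face_union n \<J>) (Comp \<Delta> \<theta> \<phi>) x = Act (face_union n \<J>) \<phi> (Act (face_union n \<J>) \<theta> x)"
    using simplex_cat.Comp_assoc[OF H(2,1), of x n] x by (simp add: Simp_face_union Act_face_union)
next
  fix p show "finite (Simp (face_union n \<J>) p)"
    by (rule finite_subset[OF _ finite_Hom_simplex_cat[of p n]]) (auto simp: Simp_face_union)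
qed

lemma std_simplex_eq_face_union: "std_simplex n = face_union n {{..n}}"
proof -
  have "Hom \<Delta> p n = {x \<in> Hom \<Delta> p n. vertices p x \<subseteq> {..n}}" for p
    by (auto simp: Hom_simplex_cat)
  then show ?thesis by (auto simp: std_simplex_def face_union_def)
qed

lemma vertices_not_empty: "vertices p x \<noteq> {}"
  by simp

lemma sub_sset_face_union:
  assumes "\<And>J. J \<in> \<J> \<Longrightarrow> in_face \<K> J"
  shows "sub_sset (face_union n \<J>) (face_union n \<K>)"
  unfolding sub_sset_def Act_face_union
proof (intro conjI allI subsetI)
  fix p x assume x: "x \<in> Simp (face_union n \<J>) p"
  then obtain J where "J \<in> \<J>" "vertices p x \<subseteq> J" by (auto simp: Simp_face_union)
  moreover from this assms obtain K where "K \<in> \<K>" "J \<subseteq> K" by blast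
  ultimately have "in_face \<K> (vertices p x)" by (meson order.trans)
  then show "x \<in> Simp (face_union n \<K>) p" using x by (simp add: Simp_face_union)
qed simp

lemma points_lift_face_union_eq:
  assumes "\<And>S. in_face \<J> S \<longleftrightarrow> in_face \<K> S"
  shows "points_lift C V (face_union n \<J>) (face_union n \<K>) f"
  using assms by (intro points_lift_refl) (auto simp: Act_face_union Simp_face_union)

text \<open>The union and intersection conditions are tested on vertex sets. Only nonempty
  \<open>S\<close> occur, since every simplex has a vertex.\<close>

lemma points_lift_face_union_pushout:
  assumes "points_lift C V (face_union n \<J>0) (face_union n \<J>2) f"
    and "\<And>S. S \<noteq> {} \<Longrightarrow> in_face \<J>0 S \<longleftrightarrow> in_face \<J>1 S \<and> in_face \<J>2 S"
    and "\<And>S. S \<noteq> {} \<Longrightarrow> in_face \<J>3 S \<longleftrightarrow> in_face \<J>1 S \<or> in_face \<J>2 S"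
  shows "points_lift C V (face_union n \<J>1) (face_union n \<J>3) f"
  using assms(2,3)[OF vertices_not_empty]
  by (intro points_lift_pushout[OF finite_simplicial_set_face_union finite_simplicial_set_face_union _ _ _ _ _ assms(1)])
    (auto simp: Act_face_union set_eq_iff Simp_face_union)

text \<open>The path of edges from a to b; \<open>spine 0 n\<close> is the family of faces in
  \<open>S1\<close>, and general endpoints are needed for the induction on sub-polygons.\<close>

definition spine :: "nat \<Rightarrow> nat \<Rightarrow> nat set set" where
  "spine a b = (\<lambda>i. {i, i + 1}) ` {a..<b}"

text \<open>Composition with the injection \<open>e\<close> sending 0, 1, 2 to a, k, b identifies
  the standard triangle with the face on {a, k, b} and its spine with the edges ak and kb.\<close>

lemma points_lift_triangle:
  assumes lift: "points_lift C V (face_union 2 (spine 0 2)) (std_simplex 2) f"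
    and abc: "a < k" "k < b" "b \<le> n"
  shows "points_lift C V (face_union n {{a, k}, {k, b}}) (face_union n {{a, k, b}}) f"
proof -
  define e where "e = (\<lambda>i \<in> {..2 :: nat}. if i = 0 then a else if i = 1 then k else b)"
  \<comment> \<open>Inverse of \<open>e\<close> on {a, k, b}; the value 2 elsewhere is a
    default.\<close>
  define r where "r = (\<lambda>i. if i = a then 0 else if i = k then 1 else 2 :: nat)"
  have e [simp]: "e 0 = a" "e (Suc 0) = k" "e 2 = b" by (auto simp: e_def)
  have le2: "i \<le> 2 \<longleftrightarrow> i = 0 \<or> i = Suc 0 \<or> i = 2" for i :: nat by auto
  have eH: "(2, n, e) \<in> Hom \<Delta> 2 n"
    using abc by (auto simp: Hom_simplex_cat le2 mono_on_def PiE_iff extensional_def e_def)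
  have re: "r (e i) = i" if "i \<le> 2" for i using that abc by (auto simp: le2 r_def)
  have er: "e (r y) = y" "r y \<le> 2" if "y \<in> {a, k, b}" for y using that abc by (auto simp: r_def)
  have rm: "r y \<le> r z" if "y \<in> {a, k, b}" "z \<in> {a, k, b}" "y \<le> z" for y z
    using that abc by (auto simp: r_def)
  define g where "g = (\<lambda>p :: nat. Comp \<Delta> (2, n, e))"
  define D D' E E' where "D = face_union 2 (spine 0 2)" and "D' = std_simplex 2"
    and "E = face_union n {{a, k}, {k, b}}" and "E' = face_union n {{a, k, b}}"
  have D': "Simp D' p = Hom \<Delta> p 2" for p by (simp add: D'_def std_simplex_def)
  have sp: "spine 0 2 = {{0, 1}, {1, 2}}"
    by (auto simp: spine_def numeral_2_eq_2 atLeast0LessThan lessThan_Suc)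
  have vert: "vertices p (g p x) = e ` vertices p x" if "x \<in> Hom \<Delta> p 2" for p x
    using that by (auto simp: g_def Hom_simplex_cat compose_def image_image)
  have gH: "g p x \<in> Hom \<Delta> p n" if "x \<in> Hom \<Delta> p 2" for p x
    using simplex_cat.Comp_Hom[OF that eH] by (simp only: g_def)
  have v2: "vertices p x \<subseteq> {..2}" if "x \<in> Hom \<Delta> p 2" for p x
    using that by (auto simp: Hom_simplex_cat)
  have bij: "bij_betw (g p) (Simp D' p) (Simp E' p)" for p
    unfolding D'
  proof (rule bij_betw_byWitness[where f' = "\<lambda>(m, n, h). (m, 2, \<lambda>i \<in> {..m}. r (h i))"])
    show "\<forall>x \<in> Hom \<Delta> p 2. (\<lambda>(m, n, h). (m, 2, \<lambda>i \<in> {..m}. r (h i))) (g p x) = x"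
      using re by (auto simp: g_def Hom_simplex_cat compose_def PiE_iff extensional_def fun_eq_iff)
    show "\<forall>y \<in> Simp E' p. g p ((\<lambda>(m, n, h). (m, 2, \<lambda>i \<in> {..m}. r (h i))) y) = y"
      using er by (auto simp: g_def E'_def Simp_face_union Hom_simplex_cat compose_def PiE_iff extensional_def
          fun_eq_iff image_subset_iff)
    show "g p ` Hom \<Delta> p 2 \<subseteq> Simp E' p"
    proof (rule image_subsetI)
      fix x assume x: "x \<in> Hom \<Delta> p 2"
      have "e ` vertices p x \<subseteq> e ` {..2}" using v2[OF x] by (rule image_mono)
      also have "e ` {..2} \<subseteq> {a, k, b}" by (auto simp: le2)
      finally show "g p x \<in> Simp E' p" using vert[OF x] gH[OF x] by (simp add: E'_def Simp_face_union)
    qed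
    show "(\<lambda>(m, n, h). (m, 2, \<lambda>i \<in> {..m}. r (h i))) ` Simp E' p \<subseteq> Hom \<Delta> p 2"
      using er(2) rm by (auto simp: E'_def Simp_face_union Hom_simplex_cat mono_on_def image_subset_iff)
  qed
  have mem: "g p x \<in> Simp E p \<longleftrightarrow> x \<in> Simp D p" if "x \<in> Simp D' p" for p x
  proof -
    have x: "x \<in> Hom \<Delta> p 2" using that by (simp add: D')
    have "e ` vertices p x \<subseteq> {a, k} \<longleftrightarrow> vertices p x \<subseteq> {0, 1}"
      "e ` vertices p x \<subseteq> {k, b} \<longleftrightarrow> vertices p x \<subseteq> {1, 2}"
      using v2[OF x] abc by (fastforce simp: le2 subset_iff)+
    then show ?thesis using vert[OF x] gH[OF x] x by (simp add: E_def D_def Simp_face_union sp)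
  qed
  have act: "g q (Act D' \<theta> x) = Act E' \<theta> (g p x)" if "\<theta> \<in> Hom \<Delta> q p" "x \<in> Simp D' p" for q p \<theta> x
    using simplex_cat.Comp_assoc[OF that(1) that(2)[unfolded D'] eH]
    by (simp only: g_def D'_def E'_def Act_face_union std_simplex_eq_face_union)
  have "points_lift C V E E' f"
  proof (rule points_lift_iso[OF _ _ _ bij mem act])
    show "finite_simplicial_set D'"
      unfolding D'_def std_simplex_eq_face_union by (rule finite_simplicial_set_face_union)
    show "sub_sset D D'"
      unfolding D_def D'_def std_simplex_eq_face_union sp by (rule sub_sset_face_union) auto
    show "sub_sset E E'" unfolding E_def E'_def by (rule sub_sset_face_union) auto
    show "points_lift C V D D' f" using lift by (simp only: D_def D'_def)
  qed
  then show ?thesis by (simp only: E_def E'_def)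
qed

text \<open>A triangle with vertices x < k < y has x = a and y = b, since its edge xy must cross
  neither ak nor kb. A third vertex other than k would again produce a crossing.\<close>

lemma triangulates_split:
  assumes poly: "convex_polygon n v" and T: "triangulates n v T"
    and akb: "{a, k, b} \<in> T" "a < k" "k < b"
    and K: "K \<in> T" "K \<subseteq> {a..b}"
  shows "K \<subseteq> {a..k} \<or> K \<subseteq> {k..b} \<or> K = {a, k, b}"
proof (rule ccontr)
  assume *: "\<not> ?thesis"
  note cross = triangulates_noncrossing[OF poly T]
  obtain x y where x: "x \<in> K" "x < k" and y: "y \<in> K" "k < y"
    using * K(2) by fastforce
  have "a \<le> x" "y \<le> b" using x y K(2) by auto
  have "x = a"
    using cross[OF akb(1) _ _ K(1) x(1) y(1), of a k] x y \<open>a \<le> x\<close> by fastforce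
  moreover have "y = b"
    using cross[OF K(1) x(1) y(1) akb(1), of k b] x y \<open>y \<le> b\<close> by fastforce
  moreover have card: "card K = 3" using T K(1) by (simp add: triangulates_def)
  ultimately obtain z where z: "K = {a, b, z}" "z \<noteq> a" "z \<noteq> b"
    using card_3_obtain[OF card x(1) y(1)] x y by auto
  then have "a < z" "z < b" "z \<noteq> k" using * K(2) by auto
  then consider "z < k" | "k < z" by linarith
  then show False
  proof cases
    case 1
    then show False
      using cross[OF akb(1) _ _ K(1), of a k z b] z \<open>a < z\<close> akb by auto
  next
    case 2
    then show False
      using cross[OF K(1) _ _ akb(1), of a z k b] z \<open>z < b\<close> akb by auto
  qed
qed

text \<open>Cutting the polygon on the vertices \<open>a, ..., b\<close> along the triangle on its edge \<open>{a, b}\<close>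
  leaves two smaller polygons, so that the triangulation arises from the spine by gluing in one
  triangle along two of its edges at a time.\<close>

lemma points_lift_spine_triangulation:
  assumes lift: "points_lift C V (face_union 2 (spine 0 2)) (std_simplex 2) f"
    and poly: "convex_polygon n v" and T: "triangulates n v T"
    and ab: "a < b" "b \<le> n"
    and edge: "b = Suc a \<or> (a = 0 \<and> b = n) \<or> (\<exists>K \<in> T. a \<in> K \<and> b \<in> K)"
  shows "points_lift C V (face_union n (spine a b))
      (face_union n (insert {a, b} {J \<in> T. J \<subseteq> {a..b}})) f
    \<and> (\<forall>J \<in> spine a b. in_face (insert {a, b} {J \<in> T. J \<subseteq> {a..b}}) J)"
  using ab edge
proof (induction "b - a" arbitrary: a b rule: less_induct)
  case less
  \<comment> \<open>The edge {a, b} is added by hand: for b = Suc a no triangle fits between the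
    endpoints, and in general this is the edge along which the next triangle is glued.\<close>
  define B where "B = (\<lambda>a b. insert {a, b} {J \<in> T. J \<subseteq> {a..b}})"
  have Tcard: "card J = 3" if "J \<in> T" for J using T that by (simp add: triangulates_def)
  have Brange: "J \<subseteq> {a..b}" if "J \<in> B a b" "a < b" for J a b using that by (auto simp: B_def)
  have "points_lift C V (face_union n (spine a b)) (face_union n (B a b)) f
      \<and> (\<forall>J \<in> spine a b. in_face (B a b) J)"
  proof (cases "b = Suc a")
    case True
    have "\<not> J \<subseteq> {a..b}" if "J \<in> T" for J
      using card_mono[of "{a..b}" J] Tcard[OF that] True by auto
    then have "spine a b = B a b" using True by (auto simp: spine_def B_def)
    then show ?thesis
      by (auto intro: points_lift_face_union_eq)
  next
    case False
    then obtain k where k: "a < k" "k < b" "{a, k, b} \<in> T"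
      using triangulates_triangle_below[OF poly T, of a b] less.prems by auto
    have edge: "\<exists>K \<in> T. a \<in> K \<and> k \<in> K" "\<exists>K \<in> T. k \<in> K \<and> b \<in> K"
      by (rule bexI[OF _ k(3)], simp)+
    have L: "points_lift C V (face_union n (spine a k)) (face_union n (B a k)) f"
        "\<And>J. J \<in> spine a k \<Longrightarrow> in_face (B a k) J"
      using less.hyps[of k a] less.prems(2) k(1,2) edge(1) unfolding B_def by auto
    have R: "points_lift C V (face_union n (spine k b)) (face_union n (B k b)) f"
        "\<And>J. J \<in> spine k b \<Longrightarrow> in_face (B k b) J"
      using less.hyps[of b k] less.prems(2) k(1,2) edge(2) unfolding B_def by auto
    have spine: "spine a b = spine a k \<union> spine k b"
      unfolding spine_def image_Un[symmetric] using k by (simp add: ivl_disj_un_two(3) less_imp_le)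
    have kspine: "{k} \<subseteq> {k - 1, k - 1 + 1} \<and> {k - 1, k - 1 + 1} \<in> spine a k"
        "{k} \<subseteq> {k, k + 1} \<and> {k, k + 1} \<in> spine k b"
      using k by (auto simp: spine_def)
    have range: "S \<subseteq> {a..k}" if "in_face (spine a k) S \<or> in_face (B a k) S" for S
      using that L(2) Brange[of _ a k] k(1) by blast
    have range': "S \<subseteq> {k..b}" if "in_face (spine k b) S \<or> in_face (B k b) S" for S
      using that R(2) Brange[of _ k b] k(2) by blast
    have meet: "S = {k}" if "S \<noteq> {}" "S \<subseteq> {a..k}" "S \<subseteq> {k..b}" for S
      using that by fastforce
    have LB: "in_face (spine a k) S \<Longrightarrow> in_face (B a k) S" for S using L(2) by (meson order.trans)
    have RB: "in_face (spine k b) S \<Longrightarrow> in_face (B k b) S" for S using R(2) by (meson order.trans)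
    have k1: "in_face (spine a k) S" if "in_face (spine k b) S \<or> in_face (B k b) S" "in_face (B a k) S" "S \<noteq> {}" for S
      using meet[OF that(3) range range'] that(1,2) kspine(1) by blast
    have k2: "in_face (spine k b) S" if "in_face (B a k) S" "in_face (B k b) S" "S \<noteq> {}" for S
      using meet[OF that(3) range range'] that(1,2) kspine(2) by blast
    \<comment> \<open>Read \<open>A\<close> as the spine of one half, \<open>A''\<close> as that
      half triangulated and \<open>A'\<close> as the other half: the halves meet only in k, which
      lies on the spine. The two equivalences are then the conditions for the pushouts in
      \<open>step1\<close> and \<open>step2\<close>.\<close>
    have logic: "A \<longleftrightarrow> (A \<or> A') \<and> A''" "A'' \<or> A' \<longleftrightarrow> (A \<or> A') \<or> A''"
      if "A \<Longrightarrow> A''" "A' \<Longrightarrow> A'' \<Longrightarrow> A" for A A' A''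
      using that by blast+
    have step1: "points_lift C V (face_union n (spine a b)) (face_union n (B a k \<union> spine k b)) f"
    proof (rule points_lift_face_union_pushout[OF L(1)])
      fix S :: "nat set" assume S: "S \<noteq> {}"
      show "in_face (spine a k) S \<longleftrightarrow> in_face (spine a b) S \<and> in_face (B a k) S"
        unfolding spine bex_Un by (rule logic(1)[OF LB k1[OF disjI1 _ S]])
      show "in_face (B a k \<union> spine k b) S \<longleftrightarrow> in_face (spine a b) S \<or> in_face (B a k) S"
        unfolding spine bex_Un by (rule logic(2)[OF LB k1[OF disjI1 _ S]])
    qed
    have step2: "points_lift C V (face_union n (spine k b \<union> B a k)) (face_union n (B k b \<union> B a k)) f"
    proof (rule points_lift_face_union_pushout[OF R(1)])
      fix S :: "nat set" assume S: "S \<noteq> {}"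
      show "in_face (spine k b) S \<longleftrightarrow> in_face (spine k b \<union> B a k) S \<and> in_face (B k b) S"
        unfolding bex_Un by (rule logic(1)[OF RB k2[OF _ _ S]])
      show "in_face (B k b \<union> B a k) S \<longleftrightarrow> in_face (spine k b \<union> B a k) S \<or> in_face (B k b) S"
        unfolding bex_Un by (rule logic(2)[OF RB k2[OF _ _ S]])
    qed
    \<comment> \<open>Each triangle between a and b is {a, k, b} or lies on one side of k, and the
      edge {a, b} is a face of {a, k, b}.\<close>
    have Bab: "in_face (B a b) S \<longleftrightarrow> in_face (B a k \<union> B k b) S \<or> in_face {{a, k, b}} S" for S
    proof
      have "{a, k, b} \<subseteq> {a..b}" using k by auto
      then have akb: "{a, k, b} \<in> B a b" using k by (simp add: B_def)
      show "in_face (B a b) S" if "in_face (B a k \<union> B k b) S \<or> in_face {{a, k, b}} S"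
      proof -
        have "in_face (B a b) J" if "J \<in> B a k \<union> B k b \<union> {{a, k, b}}" for J
        proof (cases "J \<in> T")
          case True
          then have "J \<subseteq> {a..b}" using that k Brange[of J a k] Brange[of J k b] by fastforce
          then show ?thesis using True by (auto simp: B_def)
        next
          case False
          then have "J \<subseteq> {a, k, b}" using that by (auto simp: B_def)
          then show ?thesis using akb by blast
        qed
        then show ?thesis using that by (meson UnI1 UnI2 order.trans)
      qed
      show "in_face (B a k \<union> B k b) S \<or> in_face {{a, k, b}} S" if S: "in_face (B a b) S"
      proof -
        obtain J where J: "J \<in> B a b" "S \<subseteq> J" using S by (rule bexE)
        have "J \<subseteq> {a, k, b} \<or> J \<in> B a k \<union> B k b"
          using J(1) triangulates_split[OF poly T k(3,1,2), of J] by (auto simp: B_def)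
        then show ?thesis
        proof
          assume "J \<subseteq> {a, k, b}"
          then have "in_face {{a, k, b}} S" using J(2) by simp
          then show ?thesis by (rule disjI2)
        next
          assume "J \<in> B a k \<union> B k b"
          with J(2) have "in_face (B a k \<union> B k b) S" by (rule bexI)
          then show ?thesis by (rule disjI1)
        qed
      qed
    qed
    \<comment> \<open>Both halves are now triangulated. The triangle {a, k, b} meets them exactly in
      the edges ak and kb, so it is glued in along its spine.\<close>
    have step3: "points_lift C V (face_union n (B a k \<union> B k b)) (face_union n (B a b)) f"
    proof (rule points_lift_face_union_pushout[OF points_lift_triangle[OF lift k(1,2) less.prems(2)] _ Bab])
      fix S :: "nat set" assume S: "S \<noteq> {}"
      have edges: "{a, k} \<in> B a k" "{k, b} \<in> B k b" by (auto simp: B_def)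
      have caps: "{a..k} \<inter> {a, k, b} = {a, k}" "{k..b} \<inter> {a, k, b} = {k, b}" using k by auto
      have "in_face {{a, k}, {k, b}} S \<longleftrightarrow> S \<subseteq> {a, k} \<or> S \<subseteq> {k, b}" by simp
      also have "\<dots> \<longleftrightarrow> (in_face (B a k) S \<or> in_face (B k b) S) \<and> S \<subseteq> {a, k, b}"
      proof
        assume "S \<subseteq> {a, k} \<or> S \<subseteq> {k, b}"
        then show "(in_face (B a k) S \<or> in_face (B k b) S) \<and> S \<subseteq> {a, k, b}"
          using bexI[OF _ edges(1), of "(\<subseteq>) S"] bexI[OF _ edges(2), of "(\<subseteq>) S"] by auto
      next
        assume *: "(in_face (B a k) S \<or> in_face (B k b) S) \<and> S \<subseteq> {a, k, b}"
        then have "S \<subseteq> {a..k} \<or> S \<subseteq> {k..b}" using range[of S] range'[of S] by argo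
        then show "S \<subseteq> {a, k} \<or> S \<subseteq> {k, b}"
          using * Int_greatest[of S "{a..k}" "{a, k, b}"] Int_greatest[of S "{k..b}" "{a, k, b}"]
          unfolding caps by argo
      qed
      finally show "in_face {{a, k}, {k, b}} S \<longleftrightarrow> in_face (B a k \<union> B k b) S \<and> in_face {{a, k, b}} S"
        by (simp add: bex_Un)
    qed
    have sub1: "in_face (B a k \<union> spine k b) J" if "J \<in> spine a b" for J
      using that L(2) by (auto simp: spine)
    have sub2: "in_face (B a k \<union> B k b) J" if "J \<in> B a k \<union> spine k b" for J
      using that R(2) by auto
    have sub3: "in_face (B a b) J" if "J \<in> B a k \<union> B k b" for J
      using Bab[of J] that by blast
    have sub12: "in_face (B a k \<union> B k b) J" if "J \<in> spine a b" for J
      using sub1[OF that] sub2 by (meson order.trans)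
    have sub: "in_face (B a b) J" if "J \<in> spine a b" for J
      using sub12[OF that] sub3 by (meson order.trans)
    have step12: "points_lift C V (face_union n (spine a b)) (face_union n (B a k \<union> B k b)) f"
      by (rule points_lift_trans[OF sub_sset_face_union[OF sub1] sub_sset_face_union[OF sub2] step1
          step2[unfolded Un_commute[of _ "B a k"]]])
    have "points_lift C V (face_union n (spine a b)) (face_union n (B a b)) f"
      by (rule points_lift_trans[OF sub_sset_face_union[OF sub12] sub_sset_face_union[OF sub3] step12 step3])
    then show ?thesis
      using sub by blast
  qed
  then show ?case unfolding B_def .
qed

text \<open>The case a = 0, b = n of the induction. The added face {0, n} changes nothing, being an
  edge of a triangle {0, k, n} of \<open>T\<close>.\<close>

lemma points_lift_triangulation:
  assumes lift: "points_lift C V (face_union 2 (spine 0 2)) (std_simplex 2) f"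
    and poly: "convex_polygon n v" and T: "triangulates n v T" and n: "n \<ge> 2"
  shows "points_lift C V (face_union n (spine 0 n)) (face_union n T) f"
    and "sub_sset (face_union n (spine 0 n)) (face_union n T)"
proof -
  have Tsub: "J \<subseteq> {..n}" if "J \<in> T" for J using T that by (auto simp: triangulates_def)
  then have TB: "{J \<in> T. J \<subseteq> {0..n}} = T" by (auto simp: atLeast0AtMost)
  note * = points_lift_spine_triangulation[OF lift poly T, of 0 n, unfolded TB]
  obtain k where k: "{0, k, n} \<in> T"
    using triangulates_triangle_below[OF poly T, of 0 n] n by auto
  have eq: "in_face (insert {0, n} T) S \<longleftrightarrow> in_face T S" for S
  proof
    assume "in_face (insert {0, n} T) S"
    then have "S \<subseteq> {0, n} \<or> in_face T S" by simp
    moreover have "in_face T S" if "S \<subseteq> {0, n}"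
      using that by (intro bexI[OF _ k]) auto
    ultimately show "in_face T S" by argo
  qed simp
  have main: "points_lift C V (face_union n (spine 0 n)) (face_union n (insert {0, n} T)) f"
    and faces: "\<And>J. J \<in> spine 0 n \<Longrightarrow> in_face (insert {0, n} T) J"
    using * n by simp_all
  have sub: "sub_sset (face_union n (insert {0, n} T)) (face_union n T)"
    by (rule sub_sset_face_union) (rule eq[THEN iffD1], rule bexI, rule order.refl)
  show "points_lift C V (face_union n (spine 0 n)) (face_union n T) f"
    by (rule points_lift_trans[OF sub_sset_face_union[OF faces] sub main points_lift_face_union_eq[OF eq]])
  show "sub_sset (face_union n (spine 0 n)) (face_union n T)"
    by (rule sub_sset_face_union) (rule eq[THEN iffD1, OF faces])
qed

section \<open>Comparison of the Segal model structures\<close>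

text \<open>Lifting against a trivial fibration is done one summand at a time: summands in
  \<open>A\<close> are prescribed by \<open>u\<close>, each remaining one is a copy of the cofibrant
  unit.\<close>

lemma (in copower_category) copower_map_Cof:
  assumes M: "model_category U C M" and Unit: "cofibrant C M (Unit V)"
    and B: "finite B" and AB: "A \<subseteq> B"
  shows "copower_map C V A B (\<lambda>x. x) \<in> Cof M"
proof -
  interpret M: model_category U C M by (rule M)
  have A: "finite A" using AB B by (rule finite_subset)
  have sub: "\<And>a. a \<in> A \<Longrightarrow> a \<in> B" using AB by blast
  define c where "c = copower_map C V A B (\<lambda>x. x)"
  have c: "c \<in> Hom C (fst (copower C V A)) (fst (copower C V B))"
      "\<And>a. a \<in> A \<Longrightarrow> c \<cdot> snd (copower C V A) a = snd (copower C V B) a"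
    unfolding c_def using copower_map[OF A B, of "\<lambda>x. x"] sub by simp_all
  obtain z i where z: "is_initial C z" and i: "i \<in> Hom C z (Unit V)" "i \<in> Cof M"
    using Unit by (auto simp: cofibrant_def)
  have "has_lift C c p" if p: "p \<in> Fib M \<inter> Weq M" for p
  proof (rule has_liftI[OF c(1)])
    define X Y where "X = Dom C p" and "Y = Cod C p"
    show pH: "p \<in> Hom C X Y" using p M.classes by (auto simp: Hom_iff X_def Y_def)
    fix u v assume u: "u \<in> Hom C (fst (copower C V A)) X" and v: "v \<in> Hom C (fst (copower C V B)) Y"
      and sq: "p \<cdot> u = v \<cdot> c"
    have "\<exists>k. k \<in> Hom C (Unit V) X \<and> p \<cdot> k = v \<cdot> snd (copower C V B) b
        \<and> (b \<in> A \<longrightarrow> k = u \<cdot> snd (copower C V A) b)" if b: "b \<in> B" for b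
    proof (cases "b \<in> A")
      case True
      have "p \<cdot> (u \<cdot> snd (copower C V A) b) = v \<cdot> snd (copower C V B) b"
        using Comp_assoc[OF copower_Hom[OF A True] u pH] Comp_assoc[OF copower_Hom[OF A True] c(1) v]
          c(2)[OF True] sq by simp
      then show ?thesis using Comp_Hom[OF copower_Hom[OF A True] u] by blast
    next
      \<comment> \<open>The map from the initial object to the unit is a cofibration, and a square
        starting at an initial object commutes.\<close>
      case False
      have vb: "v \<cdot> snd (copower C V B) b \<in> Hom C (Unit V) Y" by (rule Comp_Hom[OF copower_Hom[OF B b] v])
      obtain x where x: "x \<in> Hom C z X" using z Hom_Obj[OF pH] by (auto simp: is_initial_def)
      have "p \<cdot> x = (v \<cdot> snd (copower C V B) b) \<cdot> i"
        using z Comp_Hom[OF x pH] Comp_Hom[OF i(1) vb] Hom_Obj[OF pH] unfolding is_initial_def by blast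
      then show ?thesis
        using has_liftD[OF M.lifting(2)[OF i(2) p] i(1) pH x vb] False by metis
    qed
    then have "\<forall>b \<in> B. \<exists>k. k \<in> Hom C (Unit V) X \<and> p \<cdot> k = v \<cdot> snd (copower C V B) b
        \<and> (b \<in> A \<longrightarrow> k = u \<cdot> snd (copower C V A) b)"
      by (rule ballI)
    from bchoice[OF this] obtain k where "\<forall>b \<in> B. k b \<in> Hom C (Unit V) X
        \<and> p \<cdot> k b = v \<cdot> snd (copower C V B) b \<and> (b \<in> A \<longrightarrow> k b = u \<cdot> snd (copower C V A) b)"
      by (rule exE)
    then have k: "\<And>b. b \<in> B \<Longrightarrow> k b \<in> Hom C (Unit V) X"
        "\<And>b. b \<in> B \<Longrightarrow> p \<cdot> k b = v \<cdot> snd (copower C V B) b"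
        "\<And>b. b \<in> A \<Longrightarrow> k b = u \<cdot> snd (copower C V A) b"
      using sub by simp_all
    obtain h where h: "h \<in> Hom C (fst (copower C V B)) X" "\<And>b. b \<in> B \<Longrightarrow> h \<cdot> snd (copower C V B) b = k b"
      using copower_universal[OF B Hom_Obj(1)[OF pH], of k, OF k(1)] by blast
    have "h \<cdot> c = u"
    proof (rule copower_ext[OF A Comp_Hom[OF c(1) h(1)] u])
      show "(h \<cdot> c) \<cdot> snd (copower C V A) a = u \<cdot> snd (copower C V A) a" if "a \<in> A" for a
        using Comp_assoc[OF copower_Hom[OF A that] c(1) h(1)] c(2)[OF that] h(2)[OF sub[OF that]] k(3)[OF that]
        by simp
    qed
    moreover have "p \<cdot> h = v"
    proof (rule copower_ext[OF B Comp_Hom[OF h(1) pH] v])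
      show "(p \<cdot> h) \<cdot> snd (copower C V B) b = v \<cdot> snd (copower C V B) b" if "b \<in> B" for b
        using Comp_assoc[OF copower_Hom[OF B that] h(1) pH] h(2)[OF that] k(2)[OF that] by simp
    qed
    ultimately show "\<exists>h \<in> Hom C (fst (copower C V B)) X. h \<cdot> c = u \<and> p \<cdot> h = v"
      using h(1) by blast
  qed
  then show ?thesis using c(1) unfolding c_def[symmetric] M.Cof_iff by (simp add: Hom_iff)
qed

lemma (in copower_category) free_incl_Cof:
  assumes M: "model_category U C M" and Unit: "cofibrant C M (Unit V)"
    and D: "finite_simplicial_set D" and D': "finite_simplicial_set D'" and s: "sub_sset D D'"
  shows "free_incl C V D D' \<in> Cof (simp_injective C M)"
proof -
  have "NCmp (free_incl C V D D') p \<in> Cof M" for p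
    using copower_map_Cof[OF M Unit finite_simplicial_set.finite_Simp[OF D']] s
    by (simp add: free_incl_def sub_sset_def)
  then show ?thesis
    using free_incl_Hom[OF D D' s]
    by (simp add: simp_injective_def injective_def levelwise_def Hom_iff simp_cat_def)
qed

text \<open>A local object is by definition one that sees each generator as an isomorphism.\<close>

lemma local_equivalences_generators:
  "g \<in> G \<Longrightarrow> g \<in> Arr (simp_cat C) \<Longrightarrow> g \<in> local_equivalences C M V G"
  by (simp add: local_equivalences_def is_local_def)

text \<open>If all of \<open>G\<close> are \<open>H\<close>-equivalences, every
  \<open>H\<close>-local object is \<open>G\<close>-local, so \<open>G\<close>-equivalences are
  tested on at least the \<open>H\<close>-local objects.\<close>

lemma local_equivalences_mono:
  assumes "G \<subseteq> local_equivalences C M V H"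
  shows "local_equivalences C M V G \<subseteq> local_equivalences C M V H"
proof -
  have "is_local C M V G Z" if "is_local C M V H Z" for Z
    using that assms by (auto simp: is_local_def local_equivalences_def)
  then show ?thesis by (auto simp: local_equivalences_def)
qed

lemma (in copower_category) triangulation_local_equivalence:
  assumes M: "model_category U C M" and Unit: "cofibrant C M (Unit V)"
    and N: "segal_model U C M V S1 N"
  shows "free_incls C V S2 \<subseteq> Weq N"
proof
  fix g assume "g \<in> free_incls C V S2"
  then obtain n T v where n: "n \<ge> 3" and poly: "convex_polygon n v" and T: "triangulates n v T"
      and g: "g = free_incl C V (face_union n T) (std_simplex n)"
    by (auto simp: free_incls_def S2_def)
  interpret N: model_category U "simp_cat C" N using N by (simp add: segal_model_def)
  have Weq: "Weq N = local_equivalences C M V (free_incls C V S1)"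
    and Cof: "Cof N = Cof (simp_injective C M)" using N by (simp_all add: segal_model_def)
  note fss = finite_simplicial_set_face_union
  have std: "finite_simplicial_set (std_simplex m)" for m
    unfolding std_simplex_eq_face_union by (rule fss)
  have sub: "sub_sset (face_union m \<J>) (std_simplex m)" if "\<And>J. J \<in> \<J> \<Longrightarrow> J \<subseteq> {..m}" for m \<J>
    unfolding std_simplex_eq_face_union using that by (intro sub_sset_face_union) auto
  have spine: "sub_sset (face_union m (spine 0 m)) (std_simplex m)" for m
    by (rule sub) (auto simp: spine_def)
  have S1: "free_incl C V (face_union m (spine 0 m)) (std_simplex m) \<in> Weq N" if "m \<ge> 2" for m
  proof -
    have "(face_union m (spine 0 m), m) \<in> S1"
      using that by (auto simp: S1_def spine_def atLeast0LessThan)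
    then have "free_incl C V (face_union m (spine 0 m)) (std_simplex m) \<in> free_incls C V S1"
      unfolding free_incls_def by (rule rev_image_eqI) simp
    then show ?thesis
      unfolding Weq using free_incl_Hom[OF fss std spine]
      by (intro local_equivalences_generators) (auto simp: Hom_iff)
  qed
  have gen: "free_incl C V (face_union 2 (spine 0 2)) (std_simplex 2) \<in> Cof N \<inter> Weq N"
    using S1 free_incl_Cof[OF M Unit fss std spine] by (simp add: Cof)
  \<comment> \<open>Only the generator for n = 2 is used for gluing triangles; those for larger n
    enter through two-out-of-three at the end.\<close>
  have "points_lift C V (face_union 2 (spine 0 2)) (std_simplex 2) f" if f: "f \<in> Fib N" for f
    using N.lifting(1)[OF gen f] has_lift_free_incl_iff[OF N.category fss std spine] f N.classes by blast
  note PL = points_lift_triangulation[OF this poly T]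
  \<comment> \<open>The inclusion \<open>sT\<close> comes out of a lemma that assumes lifting
    against some map, so one fibration must be exhibited; factoring an identity yields it.\<close>
  obtain f0 where "f0 \<in> Fib N"
    using N.factorization(1) N.Ident_Hom free_sobj_Obj[OF std] by blast
  then have sT: "sub_sset (face_union n (spine 0 n)) (face_union n T)" using PL(2) n by auto
  define j where "j = free_incl C V (face_union n (spine 0 n)) (face_union n T)"
  have jH: "j \<in> Hom (simp_cat C) (free_sobj C V (face_union n (spine 0 n))) (free_sobj C V (face_union n T))"
    unfolding j_def by (rule free_incl_Hom[OF fss fss sT])
  have "has_lift (simp_cat C) j f" if "f \<in> Fib N" for f
    unfolding j_def using has_lift_free_incl_iff[OF N.category fss fss sT] PL(1) n that N.classes by auto
  then have "j \<in> Weq N" using N.trivial_cofibration_iff[of j] jH by (auto simp: Hom_iff)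
  moreover have sT': "sub_sset (face_union n T) (std_simplex n)"
    using T by (intro sub) (auto simp: triangulates_def)
  moreover have "Comp (simp_cat C) g j = free_incl C V (face_union n (spine 0 n)) (std_simplex n)"
    unfolding g j_def by (rule free_incl_Comp[OF N.category fss fss std sT sT'])
  ultimately show "g \<in> Weq N"
    using N.two_of_three(2)[OF jH free_incl_Hom[OF fss std sT'], folded g] S1[of n] n by auto
qed

theorem corollary5p3p3:
  fixes U :: "'u itself"
    and C :: "('o, 'm) cat"
    and M :: "'m model"
    and V :: "('o, 'm) monoidal"
    and Seg1 Seg2 :: "('o, 'm) smap model"
  defines "I \<equiv> simp_injective C M"
  assumes "universe U"
    and "symmetric_monoidal_model_category U C M V"
    and "left_proper C M"
    and "tractable U C M"
    and "model_category U (simp_cat C) I"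
    and "segal_model U C M V S1 Seg1"
    and "segal_model U C M V S2 Seg2"
  shows "Weq I \<subseteq> Weq Seg2 \<and> Weq Seg2 \<subseteq> Weq Seg1
    \<and> Fib I \<supseteq> Fib Seg2 \<and> Fib Seg2 \<supseteq> Fib Seg1
    \<and> Cof I = Cof Seg2 \<and> Cof Seg2 = Cof Seg1
    \<and> quillen_adjunction U (simp_cat C) I (simp_cat C) Seg2 id_functor id_functor
    \<and> quillen_adjunction U (simp_cat C) Seg2 (simp_cat C) Seg1 id_functor id_functor"
proof -
  have M: "model_category U C M" and V: "closed_symmetric_monoidal V C" and Unit: "cofibrant C M (Unit V)"
    using assms(3) by (simp_all add: symmetric_monoidal_model_category_def)
  interpret copower_category U C V
    using M V assms(2) unfolding copower_category_def copower_category_axioms_def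
    by (simp add: model_category.category model_category.colimits closed_symmetric_monoidal.unit_Obj)
  have m1: "model_category U (simp_cat C) Seg1" and m2: "model_category U (simp_cat C) Seg2"
    and c1: "Cof Seg1 = Cof I" and c2: "Cof Seg2 = Cof I"
    using assms(7,8) by (simp_all add: segal_model_def I_def)
  have "fibrant (simp_cat C) I Z" if "fibrant (simp_cat C) Seg2 Z" for Z
    using assms(8) that by (simp add: segal_model_def I_def)
  then have w2: "Weq I \<subseteq> Weq Seg2"
    using Weq_mono_of_fibrant[OF assms(2) assms(6) m2] c2 by simp
  have w1: "Weq Seg2 \<subseteq> Weq Seg1"
    using local_equivalences_mono[of "free_incls C V S2" C M V "free_incls C V S1"]
      triangulation_local_equivalence[OF M Unit assms(7)] assms(7,8)
    by (simp add: segal_model_def)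
  have "Fib Seg2 \<subseteq> Fib I"
    using Fib_antimono[OF assms(6) m2] c2 w2 by simp
  moreover have "Fib Seg1 \<subseteq> Fib Seg2"
    using Fib_antimono[OF m2 m1] c1 c2 w1 by simp
  ultimately show ?thesis
    using w1 w2 c1 c2 id_quillen_adjunction[OF assms(6) m2] id_quillen_adjunction[OF m2 m1] by simp
qed

end
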